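(* (i) Let $\vec\alpha=(\alpha_1,\alpha_2,\alpha_3,\alpha_4)\in\mathcal A$. Then the operator $H_{\vec\alpha}=-\frac{d^2}{dx^2}$ with domain $D(H_{\vec\alpha})=\{\psi\in D(H_0^* ):\psi\text{ satisfies }BC(\vec\alpha)\}$ is a self-adjoint extension of $H_0$. (ii) Suppose $\vec\alpha\in\mathcal A$ is moreover a solution of the system $\mathcal S$. Define $$\gamma_\to=(\alpha_1+\alpha_2e^{-i\pi/4})e^{i\sqrt2\Lambda}\ \Big(=(\alpha_3+\alpha_4e^{-i\pi/4})e^{i(\sqrt2\Lambda+3\pi/4)}\Big),$$ $$\gamma_\leftarrow=(\alpha_1+\alpha_2e^{i\pi/4})^{-1}e^{i\sqrt2\Lambda}\ \Big(=(\alpha_3+\alpha_4e^{i\pi/4})^{-1}e^{i(\sqrt2\Lambda+3\pi/4)}\Big),$$ $f=L_++\gamma_\to R_-$, $g=R_++\gamma_\leftarrow L_-$, and let $H_\gamma=-\frac{d^2}{dx^2}$ with domain $D(H_\gamma)=\{\psi_0+c_Lf+c_Rg:\psi_0\in D(H_0),\ c_L,c_R\in\mathbb C\}$. Then these quantities are well defined, $H_\gamma$ is a self-adjoint extension of $H_0$, and $H_{\vec\alpha}=H_\gamma$.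
   Context: Fix $\Lambda>0$, $\Omega_\Lambda=(-\infty,-\Lambda)\cup(\Lambda,\infty)$, Hilbert space $L^2(\Omega_\Lambda)$. $AC^2(\overline{\Omega_\Lambda})$ is the set of functions $\psi$ with $\psi,\psi'$ locally absolutely continuous on each closed half-line $(-\infty,-\Lambda]$, $[\Lambda,\infty)$ and $\psi''$ square integrable; $\psi(\pm\Lambda),\psi'(\pm\Lambda)$ are one-sided boundary values. $H_{00}=-\frac{d^2}{dx^2}$ on $C_0^\infty(\Omega_\Lambda)$, $H_0=\overline{H_{00}}$; $D(H_0^* )=\{\psi\in L^2(\Omega_\Lambda):\psi\in AC^2(\overline{\Omega_\Lambda})\}$ with $H_0^*=-\frac{d^2}{dx^2}$, and $D(H_0)=\{\psi\in D(H_0^* ):\psi(\pm\Lambda)=\psi'(\pm\Lambda)=0\}$. A self-adjoint extension of $H_0$ is a self-adjoint operator extending $H_0$. Let $N=2^{1/4}e^{\Lambda/\sqrt2}$ and define on $\Omega_\Lambda$: $R_\pm(x)=0$ for $x<-\Lambda$, $R_\pm(x)=Ne^{(-1\pm i)x/\sqrt2}$ for $x>\Lambda$; $L_\pm(x)=Ne^{(1\mp i)x/\sqrt2}$ for $x<-\Lambda$, $L_\pm(x)=0$ for $x>\Lambda$. Class $\mathcal A$: $\vec\alpha=(\alpha_1,\alpha_2,\alpha_3,\alpha_4)\in\mathbb C^4$ belongs to $\mathcal A$ if ($\mathcal A1$) $\alpha_1\overline{\alpha_4}-\overline{\alpha_2}\alpha_3=1$ and ($\mathcal A2$) $\alpha_1\overline{\alpha_3}\in\mathbb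 R$ and $\alpha_2\overline{\alpha_4}\in\mathbb R$. Boundary condition $BC(\vec\alpha)$: $\psi\in D(H_0^* )$ satisfies $BC(\vec\alpha)$ if $\psi(\Lambda)=\alpha_1\psi(-\Lambda)+\alpha_2\psi'(-\Lambda)$ and $\psi'(\Lambda)=\alpha_3\psi(-\Lambda)+\alpha_4\psi'(-\Lambda)$. System $\mathcal S$: with $F(z_1,z_2)=|z_1|^2+\sqrt2 z_1z_2+|z_2|^2-1$, $\vec\alpha$ solves $\mathcal S$ if ($\mathcal S1$) $F(\alpha_1,\alpha_2)=0=F(\alpha_3,\alpha_4)$; ($\mathcal S2$) $\alpha_1+\alpha_2e^{-i\pi/4}=(\alpha_3+\alpha_4e^{-i\pi/4})e^{i3\pi/4}$; ($\mathcal S3$) $\alpha_1+\alpha_2e^{i\pi/4}=(\alpha_3+\alpha_4e^{i\pi/4})e^{-i3\pi/4}$. *)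

theory Defs
  imports "HOL-Analysis.Analysis"
begin

text \<open>Functions on Omega are modelled as complex-valued functions on the real line;
their values on the gap (-Lambda, Lambda) are irrelevant. Elements of L^2 are
identified up to equality almost everywhere on Omega (Lebesgue measure).
All operators considered act as minus the second derivative, so an operator is
given by its domain D (a set of representatives) together with the action Hop.\<close>

definition Omega :: "real \<Rightarrow> real set" where
  "Omega \<Lambda> = {..<-\<Lambda>} \<union> {\<Lambda><..}"

definition L2 :: "real \<Rightarrow> (real \<Rightarrow> complex) \<Rightarrow> bool" where
  "L2 \<Lambda> f \<longleftrightarrow> set_borel_measurable lebesgue (Omega \<Lambda>) f \<and>
     set_integrable lebesgue (Omega \<Lambda>) (\<lambda>x. (cmod (f x))\<^sup>2)"

definition ip :: "real \<Rightarrow> (real \<Rightarrow> complex) \<Rightarrow> (real \<Rightarrow> complex) \<Rightarrow> complex" where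
  "ip \<Lambda> f g = (LINT x:Omega \<Lambda>|lebesgue. cnj (f x) * g x)"

definition l2norm :: "real \<Rightarrow> (real \<Rightarrow> complex) \<Rightarrow> real" where
  "l2norm \<Lambda> f = sqrt (LINT x:Omega \<Lambda>|lebesgue. (cmod (f x))\<^sup>2)"

definition aeq :: "real \<Rightarrow> (real \<Rightarrow> complex) \<Rightarrow> (real \<Rightarrow> complex) \<Rightarrow> bool" where
  "aeq \<Lambda> f g \<longleftrightarrow> (AE x in lebesgue. x \<in> Omega \<Lambda> \<longrightarrow> f x = g x)"

definition abs_cont_on :: "real set \<Rightarrow> (real \<Rightarrow> complex) \<Rightarrow> bool" where
  "abs_cont_on S f \<longleftrightarrow>
     (\<forall>\<epsilon>>0. \<exists>\<delta>>0. \<forall>(n::nat) a b.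
        (\<forall>k<n. a k \<in> S \<and> b k \<in> S \<and> a k \<le> b k) \<and>
        (\<forall>k. Suc k < n \<longrightarrow> b k \<le> a (Suc k)) \<and>
        (\<Sum>k<n. b k - a k) < \<delta> \<longrightarrow>
        (\<Sum>k<n. cmod (f (b k) - f (a k))) < \<epsilon>)"

definition loc_abs_cont_on :: "real set \<Rightarrow> (real \<Rightarrow> complex) \<Rightarrow> bool" where
  "loc_abs_cont_on S f \<longleftrightarrow> (\<forall>c d. {c..d} \<subseteq> S \<longrightarrow> abs_cont_on {c..d} f)"

text \<open>The closed half-line containing x (for x in the closure of Omega).\<close>
definition halfline :: "real \<Rightarrow> real \<Rightarrow> real set" where
  "halfline \<Lambda> x = (if x \<ge> 0 then {\<Lambda>..} else {..-\<Lambda>})"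

definition d1 :: "real \<Rightarrow> (real \<Rightarrow> complex) \<Rightarrow> real \<Rightarrow> complex" where
  "d1 \<Lambda> \<psi> x = vector_derivative \<psi> (at x within halfline \<Lambda> x)"

definition d2 :: "real \<Rightarrow> (real \<Rightarrow> complex) \<Rightarrow> real \<Rightarrow> complex" where
  "d2 \<Lambda> \<psi> x = vector_derivative (d1 \<Lambda> \<psi>) (at x)"

definition AC2 :: "real \<Rightarrow> (real \<Rightarrow> complex) \<Rightarrow> bool" where
  "AC2 \<Lambda> \<psi> \<longleftrightarrow>
     loc_abs_cont_on {..-\<Lambda>} \<psi> \<and> loc_abs_cont_on {\<Lambda>..} \<psi> \<and>
     (\<forall>x \<in> {..-\<Lambda>} \<union> {\<Lambda>..}. \<psi> differentiable (at x within halfline \<Lambda> x)) \<and>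
     loc_abs_cont_on {..-\<Lambda>} (d1 \<Lambda> \<psi>) \<and> loc_abs_cont_on {\<Lambda>..} (d1 \<Lambda> \<psi>) \<and>
     L2 \<Lambda> (d2 \<Lambda> \<psi>)"

definition Hop :: "real \<Rightarrow> (real \<Rightarrow> complex) \<Rightarrow> real \<Rightarrow> complex" where
  "Hop \<Lambda> \<psi> = (\<lambda>x. - d2 \<Lambda> \<psi> x)"

definition D_H0star :: "real \<Rightarrow> (real \<Rightarrow> complex) set" where
  "D_H0star \<Lambda> = {\<psi>. L2 \<Lambda> \<psi> \<and> AC2 \<Lambda> \<psi>}"

definition D_H0 :: "real \<Rightarrow> (real \<Rightarrow> complex) set" where
  "D_H0 \<Lambda> = {\<psi> \<in> D_H0star \<Lambda>. \<psi> \<Lambda> = 0 \<and> \<psi> (-\<Lambda>) = 0 \<and>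
                  d1 \<Lambda> \<psi> \<Lambda> = 0 \<and> d1 \<Lambda> \<psi> (-\<Lambda>) = 0}"

text \<open>Self-adjointness of the operator (D, T) in L^2(Omega): densely defined,
symmetric, and every element of the domain of the adjoint lies (up to a.e. equality)
in D with adjoint action equal to T.\<close>
definition self_adjoint_op ::
  "real \<Rightarrow> (real \<Rightarrow> complex) set \<Rightarrow> ((real \<Rightarrow> complex) \<Rightarrow> (real \<Rightarrow> complex)) \<Rightarrow> bool" where
  "self_adjoint_op \<Lambda> D T \<longleftrightarrow>
     (\<forall>\<psi>\<in>D. L2 \<Lambda> \<psi> \<and> L2 \<Lambda> (T \<psi>)) \<and>
     (\<forall>\<phi>. L2 \<Lambda> \<phi> \<longrightarrow> (\<forall>\<epsilon>>0. \<exists>\<psi>\<in>D. l2norm \<Lambda> (\<lambda>x. \<phi> x - \<psi> x) < \<epsilon>)) \<and>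
     (\<forall>\<psi>1\<in>D. \<forall>\<psi>2\<in>D. ip \<Lambda> \<psi>1 (T \<psi>2) = ip \<Lambda> (T \<psi>1) \<psi>2) \<and>
     (\<forall>\<phi> \<eta>. L2 \<Lambda> \<phi> \<and> L2 \<Lambda> \<eta> \<and> (\<forall>\<psi>\<in>D. ip \<Lambda> \<phi> (T \<psi>) = ip \<Lambda> \<eta> \<psi>) \<longrightarrow>
        (\<exists>\<psi>\<in>D. aeq \<Lambda> \<phi> \<psi> \<and> aeq \<Lambda> \<eta> (T \<psi>)))"

definition op_le ::
  "real \<Rightarrow> (real \<Rightarrow> complex) set \<Rightarrow> ((real \<Rightarrow> complex) \<Rightarrow> (real \<Rightarrow> complex)) \<Rightarrow>
   (real \<Rightarrow> complex) set \<Rightarrow> ((real \<Rightarrow> complex) \<Rightarrow> (real \<Rightarrow> complex)) \<Rightarrow> bool" where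
  "op_le \<Lambda> D1 T1 D2 T2 \<longleftrightarrow> (\<forall>\<psi>\<in>D1. \<exists>\<phi>\<in>D2. aeq \<Lambda> \<psi> \<phi> \<and> aeq \<Lambda> (T1 \<psi>) (T2 \<phi>))"

definition self_adjoint_ext_H0 :: "real \<Rightarrow> (real \<Rightarrow> complex) set \<Rightarrow> bool" where
  "self_adjoint_ext_H0 \<Lambda> D \<longleftrightarrow>
     self_adjoint_op \<Lambda> D (Hop \<Lambda>) \<and> op_le \<Lambda> (D_H0 \<Lambda>) (Hop \<Lambda>) D (Hop \<Lambda>)"

definition class_A :: "complex \<Rightarrow> complex \<Rightarrow> complex \<Rightarrow> complex \<Rightarrow> bool" where
  "class_A a1 a2 a3 a4 \<longleftrightarrow>
     a1 * cnj a4 - cnj a2 * a3 = 1 \<and> a1 * cnj a3 \<in> \<real> \<and> a2 * cnj a4 \<in> \<real>"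

definition BC :: "real \<Rightarrow> complex \<Rightarrow> complex \<Rightarrow> complex \<Rightarrow> complex \<Rightarrow> (real \<Rightarrow> complex) \<Rightarrow> bool" where
  "BC \<Lambda> a1 a2 a3 a4 \<psi> \<longleftrightarrow>
     \<psi> \<Lambda> = a1 * \<psi> (-\<Lambda>) + a2 * d1 \<Lambda> \<psi> (-\<Lambda>) \<and>
     d1 \<Lambda> \<psi> \<Lambda> = a3 * \<psi> (-\<Lambda>) + a4 * d1 \<Lambda> \<psi> (-\<Lambda>)"

definition D_Halpha :: "real \<Rightarrow> complex \<Rightarrow> complex \<Rightarrow> complex \<Rightarrow> complex \<Rightarrow> (real \<Rightarrow> complex) set" where
  "D_Halpha \<Lambda> a1 a2 a3 a4 = {\<psi> \<in> D_H0star \<Lambda>. BC \<Lambda> a1 a2 a3 a4 \<psi>}"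

definition Fsys :: "complex \<Rightarrow> complex \<Rightarrow> complex" where
  "Fsys z1 z2 = of_real ((cmod z1)\<^sup>2) + of_real (sqrt 2) * z1 * z2 + of_real ((cmod z2)\<^sup>2) - 1"

definition system_S :: "complex \<Rightarrow> complex \<Rightarrow> complex \<Rightarrow> complex \<Rightarrow> bool" where
  "system_S a1 a2 a3 a4 \<longleftrightarrow>
     Fsys a1 a2 = 0 \<and> Fsys a3 a4 = 0 \<and>
     a1 + a2 * exp (- \<i> * pi / 4) = (a3 + a4 * exp (- \<i> * pi / 4)) * exp (\<i> * 3 * pi / 4) \<and>
     a1 + a2 * exp (\<i> * pi / 4) = (a3 + a4 * exp (\<i> * pi / 4)) * exp (- \<i> * 3 * pi / 4)"

definition Nc :: "real \<Rightarrow> real" where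
  "Nc \<Lambda> = 2 powr (1/4) * exp (\<Lambda> / sqrt 2)"

text \<open>R_+, R_-, L_+, L_- (values on the gap set to 0; at the boundary points they are
the one-sided limits).\<close>
definition Rp :: "real \<Rightarrow> real \<Rightarrow> complex" where
  "Rp \<Lambda> x = (if x \<ge> \<Lambda> then of_real (Nc \<Lambda>) * exp ((-1 + \<i>) * of_real x / of_real (sqrt 2)) else 0)"
definition Rm :: "real \<Rightarrow> real \<Rightarrow> complex" where
  "Rm \<Lambda> x = (if x \<ge> \<Lambda> then of_real (Nc \<Lambda>) * exp ((-1 - \<i>) * of_real x / of_real (sqrt 2)) else 0)"
definition Lp :: "real \<Rightarrow> real \<Rightarrow> complex" where
  "Lp \<Lambda> x = (if x \<le> -\<Lambda> then of_real (Nc \<Lambda>) * exp ((1 - \<i>) * of_real x / of_real (sqrt 2)) else 0)"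
definition Lm :: "real \<Rightarrow> real \<Rightarrow> complex" where
  "Lm \<Lambda> x = (if x \<le> -\<Lambda> then of_real (Nc \<Lambda>) * exp ((1 + \<i>) * of_real x / of_real (sqrt 2)) else 0)"

definition gamma_to :: "real \<Rightarrow> complex \<Rightarrow> complex \<Rightarrow> complex" where
  "gamma_to \<Lambda> a1 a2 = (a1 + a2 * exp (- \<i> * pi / 4)) * exp (\<i> * sqrt 2 * \<Lambda>)"

definition gamma_from :: "real \<Rightarrow> complex \<Rightarrow> complex \<Rightarrow> complex" where
  "gamma_from \<Lambda> a1 a2 = inverse (a1 + a2 * exp (\<i> * pi / 4)) * exp (\<i> * sqrt 2 * \<Lambda>)"

definition D_Hgamma :: "real \<Rightarrow> complex \<Rightarrow> complex \<Rightarrow> (real \<Rightarrow> complex) set" where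
  "D_Hgamma \<Lambda> gt gf =
     {(\<lambda>x. \<psi>0 x + cL * (Lp \<Lambda> x + gt * Rm \<Lambda> x) + cR * (Rp \<Lambda> x + gf * Lm \<Lambda> x)) | \<psi>0 cL cR.
        \<psi>0 \<in> D_H0 \<Lambda>}"

end

theory Submission
  imports Defs
begin

text \<open>On each half-line, elements of \<open>D(H\<^sub>0\<^sup>*)\<close> and their derivatives tend to \<open>0\<close> at infinity, so Green's
formula expresses the failure of symmetry by the boundary form
\<open>cnj \<phi> \<psi>' - cnj \<phi>' \<psi>\<close> at \<open>\<Lambda>\<close> minus the same at \<open>-\<Lambda>\<close>. Class \<open>A\<close> says that the matrix \<open>M\<close> of
the boundary condition satisfies \<open>M\<^sup>* J M = J\<close>, hence the condition is symmetric; since also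
\<open>M J M\<^sup>* = J\<close> and all boundary values occur, every element of the adjoint domain satisfies the
condition too. The adjoint of \<open>H\<^sub>0\<close> itself is found by testing against functions of compact support.
For the second part, \<open>f\<close> and \<open>g\<close> satisfy the boundary condition by \<open>(S2)\<close> and \<open>(S3)\<close>, and their boundary
values at \<open>-\<Lambda>\<close> are linearly independent, so that the two domains coincide.\<close>

section \<open>Absolutely continuous functions\<close>

text \<open>Absolute continuity is given by an epsilon-delta condition, whereas Green's formula
  needs an almost everywhere derivative whose integral gives back the function. The dyadic
  construction supplies this bridge, first for real functions on \<open>[0,1]\<close> and then, by
  an affine change of variable and by real and imaginary parts, on any compact interval. A second
  obstacle is that the adjoint condition sees classes modulo null sets only, while boundary values
  belong to functions: a representative in \<open>D_H0star\<close> has to be constructed before the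
  boundary condition can be stated for it. In the second part everything rests on \<open>zp\<close>
  and \<open>zm\<close>, i.e. e^(i pi/4) and its inverse: each deficiency function is an exponential
  with rate plus or minus one of them, so its derivative at a boundary point is a fixed multiple of
  its value. The boundary conditions for \<open>f\<close> and \<open>g\<close> thereby become scalar
  equations of the system.\<close>

definition dyadic_incr :: "(real \<Rightarrow> real) \<Rightarrow> nat \<Rightarrow> nat \<Rightarrow> real" where
  "dyadic_incr f n k = f (real (Suc k) / 2^n) - f (real k / 2^n)"

text \<open>Refining the dyadic grid increases the sum of the positive increments, so the positive
variation is an increasing limit. Absolute continuity makes its Stieltjes measure absolutely
continuous, and Radon-Nikodym then supplies the density.\<close>

definition dyadic_pv :: "(real \<Rightarrow> real) \<Rightarrow> nat \<Rightarrow> real \<Rightarrow> real" where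
  "dyadic_pv f n x = (\<Sum>k<nat \<lfloor>x * 2^n\<rfloor>. max 0 (dyadic_incr f n k))"

definition pos_variation :: "(real \<Rightarrow> real) \<Rightarrow> real \<Rightarrow> real" where
  "pos_variation f x = (SUP n. dyadic_pv f n x)"

text \<open>Cells of one level never overlap, so a finite set of indices can replace the ordered
  list of intervals in \<open>abs_cont_on\<close>; \<open>real (card K) / 2^n\<close> is their total
  length.\<close>

definition dyadic_ac :: "(real \<Rightarrow> real) \<Rightarrow> bool" where
  "dyadic_ac f \<longleftrightarrow> (\<forall>\<epsilon>>0. \<exists>\<delta>>0. \<forall>n K. finite K \<longrightarrow> real (card K) / 2^n < \<delta> \<longrightarrow>
      (\<Sum>k\<in>K. \<bar>dyadic_incr f n k\<bar>) < \<epsilon>)"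

lemma dyadic_acD:
  assumes "dyadic_ac f" "\<epsilon> > 0"
  obtains \<delta> where "\<delta> > 0" "\<And>n K. finite K \<Longrightarrow> real (card K) / 2^n < \<delta> \<Longrightarrow>
      (\<Sum>k\<in>K. \<bar>dyadic_incr f n k\<bar>) < \<epsilon>"
  using assms unfolding dyadic_ac_def by blast

lemma dyadic_incr_split:
  "dyadic_incr f n k = dyadic_incr f (Suc n) (2*k) + dyadic_incr f (Suc n) (Suc (2*k))"
proof -
  have "real (2*k) / 2^Suc n = real k / 2^n" "real (Suc (Suc (2*k))) / 2^Suc n = real (Suc k) / 2^n"
    by (auto simp: field_simps)
  then show ?thesis unfolding dyadic_incr_def by (simp del: of_nat_Suc of_nat_mult power_Suc)
qed

text \<open>Halving the complete cells of \<open>[0,x]\<close> gives complete cells of the next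
  level, with possibly one more left over at the end. For negative \<open>x\<close> both sides are
  0, since \<open>nat\<close> truncates.\<close>

lemma double_nat_floor_le: "2 * nat \<lfloor>x * 2^n\<rfloor> \<le> nat \<lfloor>x * 2^Suc n\<rfloor>" for x :: real
proof (cases "x \<ge> 0")
  case True
  have "2 * \<lfloor>x * 2^n\<rfloor> \<le> \<lfloor>x * 2^Suc n\<rfloor>"
    by (subst le_floor_iff) (use of_int_floor_le[of "x * 2^n"] in \<open>simp add: algebra_simps\<close>)
  then show ?thesis using True by (simp add: nat_le_iff le_nat_iff)
next
  case False
  then have "x * 2^n < 0" by (simp add: mult_less_0_iff)
  then have "\<lfloor>x * 2^n\<rfloor> < 0" by simp
  then show ?thesis by simp
qed

lemma sum_lessThan_double: "(\<Sum>k<2*m. g k) = (\<Sum>k<m. g (2*k) + g (Suc (2*k)))" for g :: "nat \<Rightarrow> real"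
  by (induction m) auto

lemma dyadic_pv_Suc: "dyadic_pv f n x \<le> dyadic_pv f (Suc n) x"
proof -
  let ?m = "nat \<lfloor>x * 2^n\<rfloor>"
  have "dyadic_pv f n x \<le> (\<Sum>k<?m. max 0 (dyadic_incr f (Suc n) (2*k)) + max 0 (dyadic_incr f (Suc n) (Suc (2*k))))"
    unfolding dyadic_pv_def by (intro sum_mono) (use dyadic_incr_split[of f n] in \<open>auto simp: max_def\<close>)
  also have "\<dots> = (\<Sum>k<2*?m. max 0 (dyadic_incr f (Suc n) k))"
    by (simp add: sum_lessThan_double)
  also have "\<dots> \<le> dyadic_pv f (Suc n) x"
    unfolding dyadic_pv_def using double_nat_floor_le[of x n] by (intro sum_mono2) auto
  finally show ?thesis .
qed

lemma incseq_dyadic_pv: "incseq (\<lambda>n. dyadic_pv f n x)"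
  by (intro incseq_SucI dyadic_pv_Suc)

lemma dyadic_pv_mono: "x \<le> y \<Longrightarrow> dyadic_pv f n x \<le> dyadic_pv f n y"
  unfolding dyadic_pv_def by (intro sum_mono2) (auto intro!: nat_mono floor_mono simp: less_le_trans)

text \<open>Model case: the grid starts at 0 and the function is constant beyond 1, so only
  \<open>2^n\<close> cells of level \<open>n\<close> matter and the total mass is finite. The locale
  is interpreted for \<open>f\<close> and for \<open>-f\<close>, whose positive variations form a
  Jordan decomposition.\<close>

locale dyadic_ac_fun =
  fixes f :: "real \<Rightarrow> real"
  assumes ac: "dyadic_ac f" and cont: "continuous_on UNIV f"
    and const_right: "\<And>x. x \<ge> 1 \<Longrightarrow> f x = f 1"
begin

lemma dyadic_incr_eq_0: "2^n \<le> k \<Longrightarrow> dyadic_incr f n k = 0"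
proof -
  assume "2^n \<le> k"
  then have "real k / 2^n \<ge> 1" by (simp add: le_divide_eq)
  moreover have "real k / 2^n \<le> real (Suc k) / 2^n" by (intro divide_right_mono) auto
  ultimately have "real k / 2^n \<ge> 1" "real (Suc k) / 2^n \<ge> 1" by linarith+
  then show ?thesis unfolding dyadic_incr_def using const_right[of "real k / 2^n"] const_right[of "real (Suc k) / 2^n"] by simp
qed

lemma pv_diff: 
  assumes "x \<le> y"
  shows "dyadic_pv f n y - dyadic_pv f n x = (\<Sum>k\<in>{nat \<lfloor>x * 2^n\<rfloor>..<nat \<lfloor>y * 2^n\<rfloor>}. max 0 (dyadic_incr f n k))"
proof -
  have "nat \<lfloor>x * 2^n\<rfloor> \<le> nat \<lfloor>y * 2^n\<rfloor>" using assms by (intro nat_mono floor_mono) auto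
  then show ?thesis unfolding dyadic_pv_def
    by (simp add: lessThan_atLeast0 sum_diff_nat_ivl)
qed

text \<open>Take \<open>\<delta>\<close> for the value 1 and a level \<open>m\<close> whose cells
  are shorter than \<open>\<delta>\<close>. At every finer level each of the \<open>2^m\<close>
  coarse cells contributes less than 1, whatever the refinement; lower levels follow by monotonicity
  in \<open>n\<close>.\<close>

lemma pv_bounded: "\<exists>B. \<forall>n x. dyadic_pv f n x \<le> B"
proof -
  obtain \<delta> where \<delta>: "\<delta> > 0" "\<And>n K. finite K \<Longrightarrow> real (card K) / 2^n < \<delta> \<Longrightarrow> (\<Sum>k\<in>K. \<bar>dyadic_incr f n k\<bar>) < 1"
    using dyadic_acD[OF ac, of 1] by auto
  obtain m where m: "(1/2)^m < \<delta>" using real_arch_pow_inv[OF \<delta>(1), of "1/2"] by auto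
  have *: "dyadic_pv f (m + n) x \<le> 2^m" for n x
  proof -
    have "dyadic_pv f (m + n) x \<le> (\<Sum>k<nat \<lfloor>x * 2^(m+n)\<rfloor>. \<bar>dyadic_incr f (m+n) k\<bar>)"
      unfolding dyadic_pv_def by (intro sum_mono) auto
    \<comment> \<open>Increments of cells beyond 1 vanish, which caps the number of indices
      independently of \<open>x\<close>.\<close>
    also have "\<dots> = (\<Sum>k\<in>{..<nat \<lfloor>x * 2^(m+n)\<rfloor>} \<inter> {..<2^m*2^n}. \<bar>dyadic_incr f (m+n) k\<bar>)"
      by (rule sum.mono_neutral_right) (use dyadic_incr_eq_0 not_le in \<open>auto simp: power_add[symmetric]\<close>)
    also have "\<dots> \<le> (\<Sum>k<2^m*2^n. \<bar>dyadic_incr f (m+n) k\<bar>)"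
      by (intro sum_mono2) auto
    also have "\<dots> = (\<Sum>i<2^m. \<Sum>k\<in>{i*2^n..<i*2^n+2^n}. \<bar>dyadic_incr f (m+n) k\<bar>)"
      by (rule sum.nat_group[symmetric])
    also have "\<dots> \<le> (\<Sum>i<(2::nat)^m. 1)"
    proof (intro sum_mono less_imp_le \<delta>(2))
      show "real (card {i*2^n..<i*2^n+2^n}) / 2^(m+n) < \<delta>" for i :: nat
        using m by (simp add: power_add field_simps power_one_over)
    qed auto
    finally show ?thesis by simp
  qed
  have "dyadic_pv f n x \<le> 2^m" for n x
    using incseqD[OF incseq_dyadic_pv[of f x], of n "m+n"] *[of n x] by auto
  then show ?thesis by blast
qed

lemma pv_bdd_above: "bdd_above (range (\<lambda>n. dyadic_pv f n x))"
  using pv_bounded unfolding bdd_above_def by blast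

lemma pv_tendsto: "(\<lambda>n. dyadic_pv f n x) \<longlonglongrightarrow> pos_variation f x"
  unfolding pos_variation_def by (rule LIMSEQ_incseq_SUP[OF pv_bdd_above incseq_dyadic_pv])

lemma pos_variation_mono: "x \<le> y \<Longrightarrow> pos_variation f x \<le> pos_variation f y"
  by (rule LIMSEQ_le[OF pv_tendsto pv_tendsto]) (use dyadic_pv_mono in blast)

lemma pos_variation_nonpos: "x \<le> 0 \<Longrightarrow> pos_variation f x = 0"
proof -
  assume "x \<le> 0"
  then have "x * 2^n \<le> 0" for n by (simp add: mult_le_0_iff)
  then have "x * 2^n < 1" for n by (meson le_less_trans zero_less_one)
  then have "nat \<lfloor>x * 2^n\<rfloor> = 0" for n by (simp add: floor_le_iff)
  then show ?thesis unfolding pos_variation_def dyadic_pv_def by simp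
qed

lemma pos_variation_ge_1: "x \<ge> 1 \<Longrightarrow> pos_variation f x = pos_variation f 1"
proof -
  assume "x \<ge> 1"
  have "dyadic_pv f n x = dyadic_pv f n 1" for n
  proof -
    have "dyadic_pv f n x - dyadic_pv f n 1 = 0"
      unfolding pv_diff[OF \<open>x \<ge> 1\<close>]
    proof (intro sum.neutral ballI)
      fix k assume "k \<in> {nat \<lfloor>1 * 2 ^ n::real\<rfloor>..<nat \<lfloor>x * 2 ^ n\<rfloor>}"
      then show "max 0 (dyadic_incr f n k) = 0" by (auto simp: dyadic_incr_eq_0 nat_power_eq)
    qed
    then show ?thesis by simp
  qed
  then show ?thesis unfolding pos_variation_def by simp
qed

text \<open>The growth between two points is a limit of sums over the grid cells between them, which
  the dyadic condition makes small. Continuity is what gives \<open>{x<..y}\<close> the difference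
  of the values as Stieltjes measure.\<close>

lemma pos_variation_continuous: "isCont (pos_variation f) x"
proof -
  have key: "\<exists>\<delta>>0. \<forall>x y. x \<le> y \<and> y - x < \<delta> \<longrightarrow> pos_variation f y - pos_variation f x \<le> \<epsilon>" if "\<epsilon> > 0" for \<epsilon>
  proof -
    obtain \<delta> where \<delta>: "\<delta> > 0" "\<And>n K. finite K \<Longrightarrow> real (card K) / 2^n < \<delta> \<Longrightarrow> (\<Sum>k\<in>K. \<bar>dyadic_incr f n k\<bar>) < \<epsilon>"
      using dyadic_acD[OF ac \<open>\<epsilon>>0\<close>] by auto
    have "pos_variation f y - pos_variation f x \<le> \<epsilon>" if xy: "x \<le> y" "y - x < \<delta>/2" for x y
    proof (rule LIMSEQ_le_const2[OF tendsto_diff[OF pv_tendsto pv_tendsto]])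
      obtain m where m: "(1/2)^m < \<delta>/2" using real_arch_pow_inv[of "\<delta>/2" "1/2"] \<delta>(1) by auto
      show "\<exists>N. \<forall>n\<ge>N. dyadic_pv f n y - dyadic_pv f n x \<le> \<epsilon>"
      proof (intro exI[of _ m] allI impI)
        fix n assume "n \<ge> m"
        let ?K = "{nat \<lfloor>x * 2^n\<rfloor>..<nat \<lfloor>y * 2^n\<rfloor>}"
        have "(1/2::real)^n \<le> (1/2)^m" using \<open>n \<ge> m\<close> by (intro power_decreasing) auto
        then have n: "1 / 2^n < \<delta>/2" using m by (simp add: power_one_over)
        \<comment> \<open>Rounding at the two ends can add one cell; its length
          \<open>1 / 2^n\<close> is absorbed by the second half of \<open>\<delta>\<close>.\<close>
        have "real (card ?K) \<le> (y - x) * 2^n + 1"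
        proof (cases "nat \<lfloor>y * 2^n\<rfloor> \<le> nat \<lfloor>x * 2^n\<rfloor>")
          case True
          then show ?thesis using xy by simp
        next
          case False
          then have "\<lfloor>y * 2^n\<rfloor> \<ge> 0" by linarith
          have "real (card ?K) = real (nat \<lfloor>y * 2^n\<rfloor>) - real (nat \<lfloor>x * 2^n\<rfloor>)" using False by simp
          also have "\<dots> \<le> real_of_int \<lfloor>y * 2^n\<rfloor> - real_of_int \<lfloor>x * 2^n\<rfloor>" using \<open>\<lfloor>y * 2^n\<rfloor> \<ge> 0\<close> by linarith
          also have "\<dots> \<le> y * 2^n - x * 2^n + 1" by linarith
          finally show ?thesis by (simp add: algebra_simps)
        qed
        then have "real (card ?K) / 2^n \<le> (y - x) + 1/2^n"
          by (simp add: field_simps)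
        then have "real (card ?K) / 2^n < \<delta>" using n xy by linarith
        then have "(\<Sum>k\<in>?K. \<bar>dyadic_incr f n k\<bar>) < \<epsilon>" by (intro \<delta>(2)) auto
        moreover have "dyadic_pv f n y - dyadic_pv f n x \<le> (\<Sum>k\<in>?K. \<bar>dyadic_incr f n k\<bar>)"
          unfolding pv_diff[OF xy(1)] by (intro sum_mono) auto
        ultimately show "dyadic_pv f n y - dyadic_pv f n x \<le> \<epsilon>" by linarith
      qed
    qed
    then show ?thesis using \<delta>(1) by (intro exI[of _ "\<delta>/2"]) auto
  qed
  show ?thesis unfolding continuous_at_eps_delta
  proof (intro allI impI)
    fix e :: real assume "e > 0"
    then obtain \<delta> where \<delta>: "\<delta> > 0" "\<And>x y. x \<le> y \<Longrightarrow> y - x < \<delta> \<Longrightarrow> pos_variation f y - pos_variation f x \<le> e/2"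
      using key[of "e/2"] by auto
    show "\<exists>d>0. \<forall>x'. dist x' x < d \<longrightarrow> dist (pos_variation f x') (pos_variation f x) < e"
    proof (intro exI[of _ \<delta>] conjI allI impI)
      fix x' assume "dist x' x < \<delta>"
      then have "\<bar>pos_variation f x' - pos_variation f x\<bar> \<le> e/2"
        using \<delta>(2)[of x' x] \<delta>(2)[of x x'] pos_variation_mono[of x x'] pos_variation_mono[of x' x]
        by (cases "x \<le> x'") (auto simp: dist_real_def abs_if)
      then show "dist (pos_variation f x') (pos_variation f x) < e" using \<open>e > 0\<close> by (simp add: dist_real_def)
    qed (rule \<delta>(1))
  qed
qed

definition \<nu> where "\<nu> = interval_measure (pos_variation f)"

lemma sets_\<nu>[simp, measurable_cong]: "sets \<nu> = sets borel" and space_\<nu>[simp]: "space \<nu> = UNIV"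
  by (auto simp: \<nu>_def)

lemma emeasure_\<nu>_Ioc: "x \<le> y \<Longrightarrow> emeasure \<nu> {x<..y} = ennreal (pos_variation f y - pos_variation f x)"
  unfolding \<nu>_def
  using pos_variation_continuous by (intro emeasure_interval_measure_Ioc pos_variation_mono)
     (auto intro: continuous_within_subset simp: continuous_at_imp_continuous_at_within)

text \<open>After this and the next lemma only mass in \<open>(0,1]\<close> remains, so dyadic cells
  suffice for covering arguments and \<open>\<nu>\<close> is finite.\<close>

lemma emeasure_\<nu>_Iic: "emeasure \<nu> {..0} = 0"
proof -
  have "emeasure \<nu> (\<Union>n. {-real n<..0}) = 0"
    by (rule emeasure_UN_eq_0) (auto simp: emeasure_\<nu>_Ioc pos_variation_nonpos)
  moreover have "(\<Union>n. {-real n<..0}) = {..0::real}"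
    using reals_Archimedean2 by (auto, metis minus_less_iff)
  ultimately show ?thesis by simp
qed

lemma emeasure_\<nu>_Ioi: "emeasure \<nu> {1<..} = 0"
proof -
  have "emeasure \<nu> (\<Union>n. {1<..1+real n}) = 0"
    by (rule emeasure_UN_eq_0) (use pos_variation_ge_1[of "1 + real _"] in \<open>auto simp: emeasure_\<nu>_Ioc\<close>)
  moreover have "(\<Union>n. {1<..1+real n}) = {1::real<..}"
  proof (intro equalityI subsetI)
    fix x :: real assume "x \<in> {1<..}"
    moreover obtain n where "x - 1 \<le> real n" using real_arch_simple by blast
    ultimately show "x \<in> (\<Union>n. {1<..1+real n})" by (auto intro!: exI[of _ n])
  qed auto
  ultimately show ?thesis by simp
qed

lemma dyadic_cells_disjoint: "disjoint_family (\<lambda>k::nat. {real k / 2^m <.. real (Suc k) / 2^m})"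
proof -
  have "k = l" if "real k / 2^m < x" "x \<le> real (Suc k) / 2^m" "real l / 2^m < x" "x \<le> real (Suc l) / 2^m" for k l :: nat and x
  proof -
    have "real k < real (Suc l)" "real l < real (Suc k)" using that by (auto simp: field_simps)
    then show ?thesis by linarith
  qed
  then show ?thesis unfolding disjoint_family_on_def by fastforce
qed

text \<open>The part of an open set in \<open>(0,1]\<close> is exhausted from within by dyadic
  cells, finitely many at each level. Their total length is at most the Lebesgue measure of the set,
  so the dyadic condition bounds their \<open>\<nu>\<close>-mass, and monotone convergence passes to
  the union.\<close>

lemma emeasure_\<nu>_small:
  assumes "\<epsilon> > 0"
  shows "\<exists>\<delta>>0. \<forall>U. open U \<longrightarrow> emeasure lborel U < ennreal \<delta> \<longrightarrow> emeasure \<nu> U \<le> ennreal \<epsilon>"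
proof -
  obtain \<delta> where \<delta>: "\<delta> > 0" "\<And>n K. finite K \<Longrightarrow> real (card K) / 2^n < \<delta> \<Longrightarrow> (\<Sum>k\<in>K. \<bar>dyadic_incr f n k\<bar>) < \<epsilon>"
    using dyadic_acD[OF ac \<open>\<epsilon>>0\<close>] by auto
  have "emeasure \<nu> U \<le> ennreal \<epsilon>" if U: "open U" "emeasure lborel U < ennreal \<delta>" for U
  proof -
    \<comment> \<open>The cells \<open>?c\<close> are half open, so that distinct ones are disjoint;
      the closed cells \<open>?C\<close> serve as the test for lying inside
      \<open>U\<close>.\<close>
    let ?c = "\<lambda>m k::nat. {real k / 2^m <.. real (Suc k) / 2^m}"
    let ?C = "\<lambda>m k::nat. {real k / 2^m .. real (Suc k) / 2^m}"
    define J where "J m = {k. k < 2^m \<and> ?C m k \<subseteq> U}" for m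
    define V where "V m = (\<Union>k\<in>J m. ?c m k)" for m
    have finJ: "finite (J m)" for m unfolding J_def by auto
    have VU: "V m \<subseteq> U" for m unfolding V_def J_def by fastforce
    have V_borel[measurable]: "V m \<in> sets borel" for m unfolding V_def using finJ by auto
    have disj: "disjoint_family_on (?c m) (J m)" for m
      using dyadic_cells_disjoint[of m] by (rule disjoint_family_on_mono[rotated]) auto
    have inc: "incseq V"
    proof (rule incseq_SucI, rule subsetI)
      fix m x assume "x \<in> V m"
      then obtain k where k: "k < 2^m" "?C m k \<subseteq> U" "x \<in> ?c m k" unfolding V_def J_def by auto
      have e: "real (2*k) / 2^Suc m = real k / 2^m" "real (Suc (Suc (2*k))) / 2^Suc m = real (Suc k) / 2^m"
        by (auto simp: field_simps)
      have le: "real (2*k) / 2^Suc m \<le> real (Suc (2*k)) / 2^Suc m" "real (Suc (2*k)) / 2^Suc m \<le> real (Suc (Suc (2*k))) / 2^Suc m"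
        by (rule divide_right_mono; simp)+
      have "?C (Suc m) (2*k) \<subseteq> ?C m k" "?C (Suc m) (Suc (2*k)) \<subseteq> ?C m k"
        using e le by (auto simp del: of_nat_Suc of_nat_mult power_Suc)
      then have J: "2*k \<in> J (Suc m)" "Suc (2*k) \<in> J (Suc m)"
        using k unfolding J_def by auto
      have "x \<in> ?c (Suc m) (2*k) \<or> x \<in> ?c (Suc m) (Suc (2*k))"
        using k(3) e by (auto simp del: of_nat_Suc of_nat_mult power_Suc)
      then show "x \<in> V (Suc m)" unfolding V_def using J by blast
    qed
    have cover: "U \<inter> {0<..1} \<subseteq> (\<Union>m. V m)"
    proof
      fix x assume x: "x \<in> U \<inter> {0<..1}"
      then obtain e where e: "e > 0" "ball x e \<subseteq> U" using U(1) openE by blast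
      obtain m where m: "(1/2)^m < e" using real_arch_pow_inv[OF e(1), of "1/2"] by auto
      \<comment> \<open>The cells are closed on the right, hence a ceiling: \<open>k\<close> is the
        index of the half-open cell containing \<open>x\<close>.\<close>
      define k where "k = nat (\<lceil>x * 2^m\<rceil> - 1)"
      have pos: "x * 2^m > 0" using x by simp
      then have c: "\<lceil>x * 2^m\<rceil> \<ge> 1" by linarith
      then have rk: "real k = real_of_int \<lceil>x * 2^m\<rceil> - 1" unfolding k_def by simp
      have k1: "real k < x * 2^m" "x * 2^m \<le> real (Suc k)" using rk by linarith+
      have "x * 2^m \<le> 2^m" using x by simp
      then have "real k < 2^m" using k1 by linarith
      then have k2: "k < 2^m" by (metis of_nat_less_iff of_nat_numeral of_nat_power)
      have k3: "real k / 2^m < x" "x \<le> real (Suc k) / 2^m" using k1 by (auto simp: field_simps)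
      have "real (Suc k) / 2^m - real k / 2^m = (1/2)^m" by (simp add: field_simps power_one_over)
      then have "?C m k \<subseteq> ball x e" using k3 m by (auto simp: dist_real_def simp del: of_nat_Suc)
      then have "k \<in> J m" unfolding J_def using k2 e by auto
      then have "x \<in> V m" unfolding V_def using k3 by auto
      then show "x \<in> (\<Union>m. V m)" by blast
    qed
    have Vle: "emeasure \<nu> (V m) \<le> ennreal \<epsilon>" for m
    proof -
      have "emeasure lborel (V m) = (\<Sum>k\<in>J m. emeasure lborel (?c m k))"
        unfolding V_def by (rule sum_emeasure[symmetric]) (use disj finJ in auto)
      also have "\<dots> = (\<Sum>k\<in>J m. ennreal (1/2^m))"
        by (intro sum.cong refl) (simp add: divide_right_mono diff_divide_distrib[symmetric])
      also have "\<dots> = ennreal (real (card (J m)) / 2^m)"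
        by (simp add: ennreal_of_nat_eq_real_of_nat ennreal_mult[symmetric] divide_inverse)
      finally have lV: "emeasure lborel (V m) = ennreal (real (card (J m)) / 2^m)" .
      have "ennreal (real (card (J m)) / 2^m) \<le> emeasure lborel U"
        unfolding lV[symmetric] using VU U(1) by (intro emeasure_mono) auto
      then have "ennreal (real (card (J m)) / 2^m) < ennreal \<delta>" using U(2) by simp
      then have card: "real (card (J m)) / 2^m < \<delta>" by (simp add: ennreal_less_iff)
      have "emeasure \<nu> (V m) = (\<Sum>k\<in>J m. emeasure \<nu> (?c m k))"
        unfolding V_def by (rule sum_emeasure[symmetric]) (use disj finJ in auto)
      also have "\<dots> = (\<Sum>k\<in>J m. ennreal (pos_variation f (real (Suc k) / 2^m) - pos_variation f (real k / 2^m)))"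
        by (intro sum.cong refl emeasure_\<nu>_Ioc divide_right_mono) auto
      also have "\<dots> = ennreal (\<Sum>k\<in>J m. pos_variation f (real (Suc k) / 2^m) - pos_variation f (real k / 2^m))"
        by (intro sum_ennreal) (auto intro!: pos_variation_mono divide_right_mono)
      \<comment> \<open>The increments of \<open>pos_variation\<close> are limits over finer levels
        \<open>n\<close>. There each cell of \<open>J m\<close> splits into \<open>2^(n-m)\<close>
        cells of unchanged total length, so the same \<open>\<delta>\<close> applies.\<close>
      also have "\<dots> \<le> ennreal \<epsilon>"
      proof (rule ennreal_leI, rule LIMSEQ_le_const2)
        show "(\<lambda>n. \<Sum>k\<in>J m. dyadic_pv f n (real (Suc k) / 2^m) - dyadic_pv f n (real k / 2^m)) \<longlonglongrightarrow>
          (\<Sum>k\<in>J m. pos_variation f (real (Suc k) / 2^m) - pos_variation f (real k / 2^m))"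
          by (intro tendsto_sum tendsto_diff pv_tendsto)
        show "\<exists>N. \<forall>n\<ge>N. (\<Sum>k\<in>J m. dyadic_pv f n (real (Suc k) / 2^m) - dyadic_pv f n (real k / 2^m)) \<le> \<epsilon>"
        proof (intro exI[of _ m] allI impI)
          fix n assume "n \<ge> m"
          then obtain d where d: "n = m + d" using le_Suc_ex by blast
          let ?I = "\<lambda>k::nat. {k * 2^d..<Suc k * 2^d}"
          have fl: "nat \<lfloor>real k / 2^m * 2^n\<rfloor> = k * 2^d" for k :: nat
          proof -
            have "real k / 2^m * 2^n = real (k * 2^d)" by (simp add: d power_add)
            then show ?thesis by (metis floor_of_nat nat_int)
          qed
          have "(\<Sum>k\<in>J m. dyadic_pv f n (real (Suc k) / 2^m) - dyadic_pv f n (real k / 2^m)) =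
              (\<Sum>k\<in>J m. \<Sum>i\<in>?I k. max 0 (dyadic_incr f n i))"
          proof (intro sum.cong refl)
            fix k
            have "real k / 2^m \<le> real (Suc k) / 2^m" by (intro divide_right_mono) auto
            show "dyadic_pv f n (real (Suc k) / 2^m) - dyadic_pv f n (real k / 2^m) = (\<Sum>i\<in>?I k. max 0 (dyadic_incr f n i))"
              unfolding pv_diff[OF \<open>real k / 2^m \<le> real (Suc k) / 2^m\<close>] fl by (rule refl)
          qed
          also have "\<dots> \<le> (\<Sum>k\<in>J m. \<Sum>i\<in>?I k. \<bar>dyadic_incr f n i\<bar>)"
            by (intro sum_mono) auto
          also have "\<dots> = (\<Sum>i\<in>(\<Union>k\<in>J m. ?I k). \<bar>dyadic_incr f n i\<bar>)"
          proof (rule sum.UNION_disjoint[symmetric])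
            have "k = l" if "i \<in> ?I k" "i \<in> ?I l" for i k l
            proof -
              have "i div 2^d = k" "i div 2^d = l" using that
                by (auto intro!: div_nat_eqI simp: mult.commute)
              then show ?thesis by simp
            qed
            then show "\<forall>k\<in>J m. \<forall>l\<in>J m. k \<noteq> l \<longrightarrow> ?I k \<inter> ?I l = {}" by blast
          qed (use finJ in auto)
          also have "\<dots> < \<epsilon>"
          proof (rule \<delta>(2))
            have "real (card (\<Union>k\<in>J m. ?I k)) \<le> (\<Sum>k\<in>J m. real (card (?I k)))"
              using card_UN_le[OF finJ, of ?I m] unfolding of_nat_sum[symmetric] of_nat_le_iff .
            also have "\<dots> = real (card (J m)) * 2^d" by simp
            finally have "real (card (\<Union>k\<in>J m. ?I k)) / 2^n \<le> real (card (J m)) / 2^m"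
              by (simp add: d power_add field_simps)
            then show "real (card (\<Union>k\<in>J m. ?I k)) / 2^n < \<delta>" using card by linarith
          qed (use finJ in auto)
          finally show "(\<Sum>k\<in>J m. dyadic_pv f n (real (Suc k) / 2^m) - dyadic_pv f n (real k / 2^m)) \<le> \<epsilon>" by simp
        qed
      qed
      finally show ?thesis .
    qed
    have "U \<subseteq> ({..0} \<union> {1<..}) \<union> (\<Union>m. V m)" using cover by force
    then have "emeasure \<nu> U \<le> emeasure \<nu> (({..0} \<union> {1<..}) \<union> (\<Union>m. V m))"
      by (intro emeasure_mono) auto
    also have "\<dots> \<le> emeasure \<nu> ({..0} \<union> {1<..}) + emeasure \<nu> (\<Union>m. V m)"
      by (intro emeasure_subadditive) auto
    also have "emeasure \<nu> ({..0} \<union> {1<..}) \<le> emeasure \<nu> {..0} + emeasure \<nu> {1<..}"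
      by (intro emeasure_subadditive) auto
    also have "\<dots> = 0" by (simp add: emeasure_\<nu>_Iic emeasure_\<nu>_Ioi)
    also have "emeasure \<nu> (\<Union>m. V m) = (SUP m. emeasure \<nu> (V m))"
      by (intro SUP_emeasure_incseq[symmetric] inc) auto
    also have "\<dots> \<le> ennreal \<epsilon>" by (intro SUP_least Vle)
    finally show ?thesis by simp
  qed
  then show ?thesis using \<delta>(1) by blast
qed

text \<open>Outer regularity encloses a Lebesgue null set in open sets of arbitrarily small measure,
  whose \<open>\<nu>\<close>-mass is small by the preceding lemma.\<close>

lemma absolutely_continuous_\<nu>: "absolutely_continuous lborel \<nu>"
  unfolding absolutely_continuous_def
proof
  fix N assume "N \<in> null_sets (lborel :: real measure)"
  then have N: "N \<in> sets borel" "emeasure lborel N = 0" by auto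
  have "emeasure \<nu> N \<le> ennreal \<epsilon>" if "\<epsilon> > 0" for \<epsilon>
  proof -
    obtain \<delta> where \<delta>: "\<delta> > 0" "\<And>U. open U \<Longrightarrow> emeasure lborel U < ennreal \<delta> \<Longrightarrow> emeasure \<nu> U \<le> ennreal \<epsilon>"
      using emeasure_\<nu>_small[OF \<open>\<epsilon>>0\<close>] by blast
    obtain U where U: "open U" "N \<subseteq> U" "emeasure lborel (U - N) < ennreal \<delta>"
      using outer_regular_lborel[OF N(1) \<delta>(1)] .
    have "emeasure lborel U \<le> emeasure lborel (U - N) + emeasure lborel N"
    proof -
      have "emeasure lborel ((U - N) \<union> N) \<le> emeasure lborel (U - N) + emeasure lborel N"
        by (intro emeasure_subadditive) (use U N in auto)
      moreover have "(U - N) \<union> N = U" using U by auto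
      ultimately show ?thesis by simp
    qed
    then have "emeasure lborel U < ennreal \<delta>" using U(3) N(2) by simp
    then have "emeasure \<nu> U \<le> ennreal \<epsilon>" by (intro \<delta>(2) U)
    moreover have "emeasure \<nu> N \<le> emeasure \<nu> U" using U N by (intro emeasure_mono) auto
    ultimately show ?thesis by simp
  qed
  then have "emeasure \<nu> N = 0"
    using ennreal_le_epsilon[of 0 "emeasure \<nu> N"] by simp
  then show "N \<in> null_sets \<nu>" using N by auto
qed

text \<open>The Radon-Nikodym derivative takes values in \<open>ennreal\<close>. Since
  \<open>\<nu>\<close> has finite total mass it is finite almost everywhere, so replacing it by its
  real value costs only a null set.\<close>

lemma pos_variation_density:
  "\<exists>g. integrable lborel g \<and> (\<forall>x\<ge>0. (LBINT t:{0<..x}. g t) = pos_variation f x)"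
proof -
  obtain d where d[measurable]: "d \<in> borel_measurable lborel" and dens: "density lborel d = \<nu>"
    using sigma_finite_measure.Radon_Nikodym[OF sigma_finite_lborel absolutely_continuous_\<nu>] by auto
  have \<nu>_eq: "emeasure \<nu> A = (\<integral>\<^sup>+t. d t * indicator A t \<partial>lborel)" if "A \<in> sets borel" for A
    unfolding dens[symmetric] using that by (intro emeasure_density) auto
  have "emeasure \<nu> UNIV \<le> emeasure \<nu> ({..0} \<union> {0<..1}) + emeasure \<nu> {1<..}"
    by (subst plus_emeasure) (auto intro!: emeasure_mono)
  also have "\<dots> \<le> emeasure \<nu> {..0} + emeasure \<nu> {0<..1} + emeasure \<nu> {1<..}"
    by (intro add_right_mono emeasure_subadditive) auto
  also have "\<dots> < \<infinity>" by (simp add: emeasure_\<nu>_Iic emeasure_\<nu>_Ioi emeasure_\<nu>_Ioc)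
  finally have fin: "(\<integral>\<^sup>+t. d t \<partial>lborel) < \<infinity>" using \<nu>_eq[of UNIV] by simp
  then have AE: "AE t in lborel. d t \<noteq> \<infinity>" by (intro nn_integral_PInf_AE) auto
  define g where "g t = enn2real (d t)" for t
  have gm[measurable]: "g \<in> borel_measurable lborel" unfolding g_def by measurable
  have AE2: "AE t in lborel. ennreal (g t) = d t"
    using AE by eventually_elim (auto simp: g_def less_top)
  have int: "integrable lborel g"
  proof (rule integrableI_bounded)
    have "(\<integral>\<^sup>+t. ennreal (norm (g t)) \<partial>lborel) = (\<integral>\<^sup>+t. d t \<partial>lborel)"
      by (intro nn_integral_cong_AE) (use AE2 in eventually_elim, auto simp: g_def)
    then show "(\<integral>\<^sup>+t. ennreal (norm (g t)) \<partial>lborel) < \<infinity>" using fin by simp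
  qed simp
  have "(LBINT t:{0<..x}. g t) = pos_variation f x" if "x \<ge> 0" for x
  proof -
    have "(LBINT t:{0<..x}. g t) = enn2real (\<integral>\<^sup>+t. ennreal (indicator {0<..x} t *\<^sub>R g t) \<partial>lborel)"
      unfolding set_lebesgue_integral_def by (rule integral_eq_nn_integral) (auto simp: g_def)
    also have "(\<integral>\<^sup>+t. ennreal (indicator {0<..x} t *\<^sub>R g t) \<partial>lborel) = (\<integral>\<^sup>+t. d t * indicator {0<..x} t \<partial>lborel)"
      by (intro nn_integral_cong_AE) (use AE2 in eventually_elim, auto simp: indicator_def)
    also have "\<dots> = emeasure \<nu> {0<..x}" by (rule \<nu>_eq[symmetric]) auto
    also have "\<dots> = ennreal (pos_variation f x)" using that by (simp add: emeasure_\<nu>_Ioc pos_variation_nonpos)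
    finally show ?thesis using pos_variation_mono[OF that] by (simp add: pos_variation_nonpos)
  qed
  then show ?thesis using int by blast
qed

end

text \<open>On each grid the positive variation of \<open>f\<close> minus that of \<open>-f\<close>
  telescopes to \<open>f\<close> at the last grid point not exceeding \<open>x\<close>, minus
  \<open>f 0\<close>. Continuity lets this grid point tend to \<open>x\<close>.\<close>

lemma dyadic_ac_fun_integral:
  assumes "dyadic_ac_fun f"
  shows "\<exists>g. integrable lborel g \<and> (\<forall>x\<ge>0. f x - f 0 = (LBINT t:{0<..x}. g t))"
proof -
  interpret p: dyadic_ac_fun f by fact
  have incr: "dyadic_incr (\<lambda>x. - f x) n k = - dyadic_incr f n k" for n k by (simp add: dyadic_incr_def)
  interpret m: dyadic_ac_fun "\<lambda>x. - f x"
  proof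
    show "dyadic_ac (\<lambda>x. - f x)" using p.ac unfolding dyadic_ac_def incr by simp
    show "continuous_on UNIV (\<lambda>x. - f x)" using p.cont by (intro continuous_intros)
    show "- f x = - f 1" if "x \<ge> 1" for x using p.const_right[OF that] by simp
  qed
  obtain g1 where g1: "integrable lborel g1" "\<And>x. x \<ge> 0 \<Longrightarrow> (LBINT t:{0<..x}. g1 t) = pos_variation f x"
    using p.pos_variation_density by blast
  obtain g2 where g2: "integrable lborel g2" "\<And>x. x \<ge> 0 \<Longrightarrow> (LBINT t:{0<..x}. g2 t) = pos_variation (\<lambda>x. - f x) x"
    using m.pos_variation_density by blast
  have si: "set_integrable lborel {0<..x} g1" "set_integrable lborel {0<..x} g2" for x
    unfolding set_integrable_def using g1(1) g2(1) by (auto intro!: integrable_mult_indicator simp del: real_scaleR_def)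
  have "f x - f 0 = (LBINT t:{0<..x}. g1 t - g2 t)" if x: "x \<ge> 0" for x
  proof -
    have tel: "dyadic_pv f n x - dyadic_pv (\<lambda>x. - f x) n x = f (real (nat \<lfloor>x * 2^n\<rfloor>) / 2^n) - f 0" for n
    proof -
      have "dyadic_pv f n x - dyadic_pv (\<lambda>x. - f x) n x = (\<Sum>k<nat \<lfloor>x * 2^n\<rfloor>. dyadic_incr f n k)"
        unfolding dyadic_pv_def incr sum_subtractf[symmetric] by (intro sum.cong) auto
      also have "\<dots> = f (real (nat \<lfloor>x * 2^n\<rfloor>) / 2^n) - f 0"
        unfolding dyadic_incr_def by (subst sum_lessThan_telescope) simp
      finally show ?thesis .
    qed
    have lim: "(\<lambda>n. real (nat \<lfloor>x * 2^n\<rfloor>) / 2^n) \<longlonglongrightarrow> x"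
    proof (rule real_tendsto_sandwich)
      show "\<forall>\<^sub>F n in sequentially. x - (1/2)^n \<le> real (nat \<lfloor>x * 2^n\<rfloor>) / 2^n"
      proof (intro always_eventually allI)
        fix n
        have "x * 2^n - 1 \<le> real (nat \<lfloor>x * 2^n\<rfloor>)" by linarith
        then have "(x * 2^n - 1) / 2^n \<le> real (nat \<lfloor>x * 2^n\<rfloor>) / 2^n" by (rule divide_right_mono) simp
        then show "x - (1/2)^n \<le> real (nat \<lfloor>x * 2^n\<rfloor>) / 2^n" by (simp add: diff_divide_distrib power_one_over)
      qed
      show "\<forall>\<^sub>F n in sequentially. real (nat \<lfloor>x * 2^n\<rfloor>) / 2^n \<le> x"
      proof (intro always_eventually allI)
        fix n
        have "real (nat \<lfloor>x * 2^n\<rfloor>) \<le> x * 2^n" using x by (simp add: of_nat_nat)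
        then show "real (nat \<lfloor>x * 2^n\<rfloor>) / 2^n \<le> x" by (simp add: field_simps)
      qed
      show "(\<lambda>n. x - (1/2)^n) \<longlonglongrightarrow> x" by (rule tendsto_eq_intros LIMSEQ_power_zero | simp)+
    qed auto
    have "isCont f x" using p.cont by (simp add: continuous_on_eq_continuous_at)
    then have "(\<lambda>n. f (real (nat \<lfloor>x * 2^n\<rfloor>) / 2^n) - f 0) \<longlonglongrightarrow> f x - f 0"
      by (intro tendsto_diff tendsto_const isCont_tendsto_compose[OF _ lim])
    moreover have "(\<lambda>n. dyadic_pv f n x - dyadic_pv (\<lambda>x. - f x) n x) \<longlonglongrightarrow> pos_variation f x - pos_variation (\<lambda>x. - f x) x"
      by (intro tendsto_diff p.pv_tendsto m.pv_tendsto)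
    ultimately have "f x - f 0 = pos_variation f x - pos_variation (\<lambda>x. - f x) x"
      unfolding tel using LIMSEQ_unique by blast
    also have "\<dots> = (LBINT t:{0<..x}. g1 t - g2 t)"
      using g1(2)[OF x] g2(2)[OF x] set_integral_diff(2)[OF si] by simp
    finally show ?thesis .
  qed
  then show ?thesis using g1(1) g2(1) by (intro exI[of _ "\<lambda>t. g1 t - g2 t"]) auto
qed

section \<open>Integrals and derivatives of absolutely continuous functions\<close>

lemma abs_cont_onD:
  assumes "abs_cont_on S f" "\<epsilon> > 0"
  obtains \<delta> where "\<delta> > 0" "\<forall>(n::nat) a b. (\<forall>k<n. a k \<in> S \<and> b k \<in> S \<and> a k \<le> b k) \<and>
        (\<forall>k. Suc k < n \<longrightarrow> b k \<le> a (Suc k)) \<and>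
        (\<Sum>k<n. b k - a k) < \<delta> \<longrightarrow> (\<Sum>k<n. cmod (f (b k) - f (a k))) < \<epsilon>"
  using assms(1)[unfolded abs_cont_on_def, rule_format, OF assms(2)] by (elim exE conjE)

lemma abs_cont_on_imp_continuous_on:
  assumes "abs_cont_on {a..b} f" shows "continuous_on {a..b} f"
  unfolding continuous_on_iff
proof (intro ballI allI impI)
  fix x and e :: real assume x: "x \<in> {a..b}" and "e > 0"
  obtain \<delta> where \<delta>: "\<delta> > 0" "\<forall>(n::nat) a' b'. (\<forall>k<n. a' k \<in> {a..b} \<and> b' k \<in> {a..b} \<and> a' k \<le> b' k) \<and>
     (\<forall>k. Suc k < n \<longrightarrow> b' k \<le> a' (Suc k)) \<and> (\<Sum>k<n. b' k - a' k) < \<delta> \<longrightarrow>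
     (\<Sum>k<n. cmod (f (b' k) - f (a' k))) < e"
    by (rule abs_cont_onD[OF assms \<open>e > 0\<close>])
  show "\<exists>d>0. \<forall>x'\<in>{a..b}. dist x' x < d \<longrightarrow> dist (f x') (f x) < e"
  proof (intro exI[of _ \<delta>] conjI ballI impI \<delta>(1))
    fix y assume y: "y \<in> {a..b}" "dist y x < \<delta>"
    have "cmod (f (max x y) - f (min x y)) < e"
      using \<delta>(2)[THEN spec, of 1, THEN spec, of "\<lambda>_. min x y", THEN spec, of "\<lambda>_. max x y"] x y by (auto simp: dist_real_def)
    then show "dist (f y) (f x) < e"
      by (cases "x \<le> y") (auto simp: dist_norm max_def min_def norm_minus_commute)
  qed
qed

text \<open>One comparison principle yields differences, products, conjugates and real and imaginary
  parts. Two dominating functions are allowed because a product needs both factors;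
  \<open>2 * (C + 1)\<close> keeps the division legitimate when \<open>C = 0\<close>.\<close>

lemma abs_cont_on_dominated:
  assumes f: "abs_cont_on S f" and g: "abs_cont_on S g" and C: "C \<ge> 0"
    and le: "\<And>x y. x \<in> S \<Longrightarrow> y \<in> S \<Longrightarrow> cmod (h x - h y) \<le> C * (cmod (f x - f y) + cmod (g x - g y))"
  shows "abs_cont_on S h"
  unfolding abs_cont_on_def
proof (intro allI impI)
  fix \<epsilon> :: real assume "\<epsilon> > 0"
  then have e: "\<epsilon> / (2 * (C + 1)) > 0" using C by auto
  obtain \<delta>1 where \<delta>1: "\<delta>1 > 0" "\<forall>(n::nat) a b. (\<forall>k<n. a k \<in> S \<and> b k \<in> S \<and> a k \<le> b k) \<and>
     (\<forall>k. Suc k < n \<longrightarrow> b k \<le> a (Suc k)) \<and> (\<Sum>k<n. b k - a k) < \<delta>1 \<longrightarrow>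
     (\<Sum>k<n. cmod (f (b k) - f (a k))) < \<epsilon> / (2 * (C + 1))" by (rule abs_cont_onD[OF f e])
  obtain \<delta>2 where \<delta>2: "\<delta>2 > 0" "\<forall>(n::nat) a b. (\<forall>k<n. a k \<in> S \<and> b k \<in> S \<and> a k \<le> b k) \<and>
     (\<forall>k. Suc k < n \<longrightarrow> b k \<le> a (Suc k)) \<and> (\<Sum>k<n. b k - a k) < \<delta>2 \<longrightarrow>
     (\<Sum>k<n. cmod (g (b k) - g (a k))) < \<epsilon> / (2 * (C + 1))" by (rule abs_cont_onD[OF g e])
  show "\<exists>\<delta>>0. \<forall>(n::nat) a b.
        (\<forall>k<n. a k \<in> S \<and> b k \<in> S \<and> a k \<le> b k) \<and>
        (\<forall>k. Suc k < n \<longrightarrow> b k \<le> a (Suc k)) \<and>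
        (\<Sum>k<n. b k - a k) < \<delta> \<longrightarrow>
        (\<Sum>k<n. cmod (h (b k) - h (a k))) < \<epsilon>"
  proof (intro exI[of _ "min \<delta>1 \<delta>2"] conjI allI impI)
    fix n :: nat and a b assume A: "(\<forall>k<n. a k \<in> S \<and> b k \<in> S \<and> a k \<le> b k) \<and>
        (\<forall>k. Suc k < n \<longrightarrow> b k \<le> a (Suc k)) \<and> (\<Sum>k<n. b k - a k) < min \<delta>1 \<delta>2"
    have lt: "C * (e0 + e0) < 2 * (C + 1) * e0" if "e0 > 0" for e0 using that by (simp add: algebra_simps)
    have 1: "(\<Sum>k<n. cmod (f (b k) - f (a k))) < \<epsilon> / (2 * (C + 1))" by (rule \<delta>1(2)[THEN spec, THEN spec, THEN spec, THEN mp]) (use A in auto)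
    have 2: "(\<Sum>k<n. cmod (g (b k) - g (a k))) < \<epsilon> / (2 * (C + 1))" by (rule \<delta>2(2)[THEN spec, THEN spec, THEN spec, THEN mp]) (use A in auto)
    have "(\<Sum>k<n. cmod (h (b k) - h (a k))) \<le> (\<Sum>k<n. C * (cmod (f (b k) - f (a k)) + cmod (g (b k) - g (a k))))"
      by (intro sum_mono le) (use A in auto)
    also have "\<dots> = C * ((\<Sum>k<n. cmod (f (b k) - f (a k))) + (\<Sum>k<n. cmod (g (b k) - g (a k))))"
      by (simp add: sum_distrib_left[symmetric] sum.distrib)
    also have "\<dots> \<le> C * (\<epsilon> / (2 * (C + 1)) + \<epsilon> / (2 * (C + 1)))"
      using 1 2 C by (intro mult_left_mono) auto
    also note lt[OF e]
    also have "2 * (C + 1) * (\<epsilon> / (2 * (C + 1))) = \<epsilon>" using C by simp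
    finally show "(\<Sum>k<n. cmod (h (b k) - h (a k))) < \<epsilon>" .
  qed (use \<delta>1 \<delta>2 in auto)
qed

lemma abs_cont_on_diff: "abs_cont_on S f \<Longrightarrow> abs_cont_on S g \<Longrightarrow> abs_cont_on S (\<lambda>x. f x - g x)"
proof (rule abs_cont_on_dominated[of S f g 1])
  show "cmod (f x - g x - (f y - g y)) \<le> 1 * (cmod (f x - f y) + cmod (g x - g y))" for x y
    using norm_triangle_ineq4[of "f x - f y" "g x - g y"] by (simp add: algebra_simps)
qed auto

lemma abs_cont_on_cnj: "abs_cont_on S f \<Longrightarrow> abs_cont_on S (\<lambda>x. cnj (f x))"
  by (rule abs_cont_on_dominated[of S f f 1]) (auto simp: complex_cnj_diff[symmetric] simp del: complex_cnj_diff)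

lemma abs_cont_on_cong: "(\<And>x. x \<in> S \<Longrightarrow> f x = g x) \<Longrightarrow> abs_cont_on S f \<Longrightarrow> abs_cont_on S g"
  by (rule abs_cont_on_dominated[of S f f 1]) auto

lemma abs_cont_on_mult:
  assumes f: "abs_cont_on {a..b} f" and g: "abs_cont_on {a..b} g"
  shows "abs_cont_on {a..b} (\<lambda>x. f x * g x)"
proof -
  have "bounded (f ` {a..b})" "bounded (g ` {a..b})"
    using assms by (auto intro!: compact_imp_bounded compact_continuous_image abs_cont_on_imp_continuous_on)
  then obtain A B where A: "\<And>x. x \<in> {a..b} \<Longrightarrow> cmod (f x) \<le> A" and B: "\<And>x. x \<in> {a..b} \<Longrightarrow> cmod (g x) \<le> B"
    unfolding bounded_iff by blast
  show ?thesis
  proof (rule abs_cont_on_dominated[OF f g, of "max 0 (max A B)"])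
    fix x y assume xy: "x \<in> {a..b}" "y \<in> {a..b}"
    have "f x * g x - f y * g y = (f x - f y) * g x + f y * (g x - g y)" by (simp add: algebra_simps)
    then have "cmod (f x * g x - f y * g y) \<le> cmod (f x - f y) * cmod (g x) + cmod (f y) * cmod (g x - g y)"
      by (metis norm_mult norm_triangle_ineq)
    also have "\<dots> \<le> cmod (f x - f y) * max 0 (max A B) + max 0 (max A B) * cmod (g x - g y)"
      using A[OF xy(2)] B[OF xy(1)] by (intro add_mono mult_mono) auto
    finally show "cmod (f x * g x - f y * g y) \<le> max 0 (max A B) * (cmod (f x - f y) + cmod (g x - g y))"
      by (simp add: algebra_simps)
  qed auto
qed

text \<open>The parametrization \<open>a + (b - a) * s\<close>, clamped to \<open>{a..b}\<close>,
  reduces to the model case: clamping makes the composed function defined on the whole line and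
  constant beyond 1.\<close>

lemma abs_cont_on_real_integral:
  fixes u :: "real \<Rightarrow> real"
  assumes ac: "abs_cont_on {a..b} (\<lambda>x. complex_of_real (u x))" and ab: "a < b"
  shows "\<exists>G. integrable lborel G \<and> (\<forall>x\<in>{a..b}. u x - u a = (LBINT t:{a<..x}. G t))"
proof -
  define p where "p s = max a (min b (a + (b - a) * s))" for s
  define F where "F s = u (p s)" for s
  have p_mem: "p s \<in> {a..b}" for s unfolding p_def using ab by auto
  have cu: "continuous_on {a..b} u"
    using continuous_on_Re[OF abs_cont_on_imp_continuous_on[OF ac]] by simp
  have "dyadic_ac_fun F"
  proof
    have p1: "p s = b" if "s \<ge> 1" for s
    proof -
      have "b - a \<le> (b - a) * s" using mult_left_mono[OF that, of "b - a"] ab by simp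
      then show ?thesis unfolding p_def using ab by linarith
    qed
    show "F x = F 1" if "x \<ge> 1" for x using p1[OF that] p1[of 1] by (simp add: F_def)
    have "continuous_on UNIV p" unfolding p_def by (intro continuous_intros)
    then show "continuous_on UNIV F" unfolding F_def
      by (rule continuous_on_compose2[OF cu]) (use p_mem in auto)
    show "dyadic_ac F" unfolding dyadic_ac_def
    proof (intro allI impI)
      fix \<epsilon> :: real assume "\<epsilon> > 0"
      obtain \<delta> where \<delta>: "\<delta> > 0" "\<forall>(n::nat) a' b'. (\<forall>k<n. a' k \<in> {a..b} \<and> b' k \<in> {a..b} \<and> a' k \<le> b' k) \<and>
         (\<forall>k. Suc k < n \<longrightarrow> b' k \<le> a' (Suc k)) \<and> (\<Sum>k<n. b' k - a' k) < \<delta> \<longrightarrow>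
         (\<Sum>k<n. cmod (complex_of_real (u (b' k)) - complex_of_real (u (a' k)))) < \<epsilon>"
        by (rule abs_cont_onD[OF ac \<open>\<epsilon> > 0\<close>])
      have "(\<Sum>k\<in>K. \<bar>dyadic_incr F n k\<bar>) < \<epsilon>" if K: "finite K" "real (card K) / 2^n < \<delta> / (b - a)" for n K
      proof -
        \<comment> \<open>The set \<open>K\<close> is listed in increasing order, since
          \<open>abs_cont_on\<close> asks for consecutive intervals. The map \<open>p\<close> is
          monotone and Lipschitz with constant \<open>b - a\<close>, so order is kept and the total
          length grows by at most that factor.\<close>
        define e where "e = sorted_list_of_set K"
        have e: "length e = card K" "set e = K" "distinct e" "sorted_wrt (<) e"
          unfolding e_def using K(1) by auto
        have bij: "bij_betw (\<lambda>i. e ! i) {..<card K} K"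
          using bij_betw_nth[OF e(3)] e(1,2) by (metis lessThan_iff)
        have p_mono: "p s \<le> p t" if "s \<le> t" for s t
          unfolding p_def using that ab mult_left_mono[of s t "b - a"] by linarith
        have p_lip: "p t - p s \<le> (b - a) * (t - s)" if "s \<le> t" for s t
          unfolding p_def using that ab mult_left_mono[of s t "b - a"] by (auto simp: algebra_simps max_def min_def)
        let ?A = "\<lambda>i. p (real (e ! i) / 2^n)" and ?B = "\<lambda>i. p (real (Suc (e ! i)) / 2^n)"
        have "(\<Sum>i<card K. cmod (complex_of_real (u (?B i)) - complex_of_real (u (?A i)))) < \<epsilon>"
        proof (rule \<delta>(2)[THEN spec, THEN spec, THEN spec, THEN mp], intro conjI allI impI)
          show "?A i \<in> {a..b}" "?B i \<in> {a..b}" for i by (rule p_mem)+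
          show "?A i \<le> ?B i" for i by (intro p_mono divide_right_mono) auto
          show "?B i \<le> ?A (Suc i)" if "Suc i < card K" for i
          proof -
            have "e ! i < e ! Suc i" using e(1,4) that by (auto simp: sorted_wrt_iff_nth_less)
            then show ?thesis by (intro p_mono divide_right_mono) auto
          qed
          have "(\<Sum>i<card K. ?B i - ?A i) \<le> (\<Sum>i<card K. (b - a) * (1 / 2^n))"
          proof (rule sum_mono)
            fix i
            have "?B i - ?A i \<le> (b - a) * (real (Suc (e ! i)) / 2^n - real (e ! i) / 2^n)"
              by (intro p_lip divide_right_mono) auto
            also have "\<dots> = (b - a) * (1 / 2^n)" by (simp add: diff_divide_distrib[symmetric])
            finally show "?B i - ?A i \<le> (b - a) * (1 / 2^n)" .
          qed
          also have "\<dots> = (b - a) * (real (card K) / 2^n)" by simp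
          also have "\<dots> < \<delta>" using K(2) ab by (simp add: field_simps)
          finally show "(\<Sum>i<card K. ?B i - ?A i) < \<delta>" .
        qed
        also have "(\<Sum>i<card K. cmod (complex_of_real (u (?B i)) - complex_of_real (u (?A i)))) = 
            (\<Sum>i<card K. \<bar>dyadic_incr F n (e ! i)\<bar>)"
          unfolding dyadic_incr_def F_def of_real_diff[symmetric] norm_of_real ..
        also have "\<dots> = (\<Sum>k\<in>K. \<bar>dyadic_incr F n k\<bar>)"
          using sum.reindex_bij_betw[OF bij] .
        finally show ?thesis .
      qed
      moreover have "\<delta> / (b - a) > 0" using \<delta>(1) ab by simp
      ultimately show "\<exists>\<delta>>0. \<forall>n K. finite K \<longrightarrow> real (card K) / 2 ^ n < \<delta> \<longrightarrow> (\<Sum>k\<in>K. \<bar>dyadic_incr F n k\<bar>) < \<epsilon>"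
        by blast
    qed
  qed
  then obtain g where g: "integrable lborel g" "\<And>s. s \<ge> 0 \<Longrightarrow> F s - F 0 = (LBINT t:{0<..s}. g t)"
    using dyadic_ac_fun_integral by blast
  \<comment> \<open>\<open>?t + ?c * x\<close> is the inverse parametrization
    \<open>(x - a) / (b - a)\<close>, and the factor \<open>?c\<close> in \<open>G\<close> is its
    Jacobian.\<close>
  let ?c = "1 / (b - a)" and ?t = "- a / (b - a)"
  define G where "G x = ?c * g (?t + ?c * x)" for x
  have "u x - u a = (LBINT t:{a<..x}. G t)" if x: "x \<in> {a..b}" for x
  proof -
    define s where "s = (x - a) / (b - a)"
    have s: "s \<ge> 0" "p s = x" using x ab by (auto simp: s_def p_def)
    have "u x - u a = F s - F 0" unfolding F_def s by (simp add: p_def ab less_imp_le)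
    also have "\<dots> = (LBINT t. indicator {0<..s} t *\<^sub>R g t)" using g(2)[OF s(1)] by (simp add: set_lebesgue_integral_def)
    also have "\<dots> = \<bar>?c\<bar> *\<^sub>R (LBINT y. indicator {0<..s} (?t + ?c * y) *\<^sub>R g (?t + ?c * y))"
      by (rule lborel_integral_real_affine) (use ab in auto)
    also have "\<dots> = (LBINT y. \<bar>?c\<bar> *\<^sub>R (indicator {0<..s} (?t + ?c * y) *\<^sub>R g (?t + ?c * y)))"
      by (rule integral_scaleR_right[symmetric])
    also have "\<dots> = (LBINT t:{a<..x}. G t)"
      unfolding set_lebesgue_integral_def
    proof (rule Bochner_Integration.integral_cong[OF refl])
      fix y
      have "(0 < ?t + ?c * y \<and> ?t + ?c * y \<le> s) = (a < y \<and> y \<le> x)"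
      proof -
        have "?t + ?c * y = (y - a) / (b - a)" by (simp add: diff_divide_distrib)
        then show ?thesis using ab unfolding s_def by (simp add: zero_less_divide_iff divide_le_cancel)
      qed
      then show "\<bar>?c\<bar> *\<^sub>R (indicator {0<..s} (?t + ?c * y) *\<^sub>R g (?t + ?c * y)) = indicator {a<..x} y *\<^sub>R G y"
        using ab by (simp add: indicator_def G_def)
    qed
    finally show ?thesis .
  qed
  moreover have "integrable lborel G" unfolding G_def
    using ab by (intro integrable_mult_right lborel_integrable_real_affine g(1)) auto
  ultimately show ?thesis by blast
qed

text \<open>Real and imaginary parts are treated separately. The Lebesgue integral over
  \<open>{a<..x}\<close> is also traded for a gauge integral over \<open>{a..x}\<close>, in which
  null sets and endpoints are easily exchanged.\<close>

lemma abs_cont_on_integral: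
  assumes ac: "abs_cont_on {a..b} f" and ab: "a < b"
  shows "\<exists>g. g absolutely_integrable_on {a..b} \<and> (\<forall>x\<in>{a..b}. (g has_integral (f x - f a)) {a..x})"
proof -
  have "abs_cont_on {a..b} (\<lambda>x. complex_of_real (Re (f x)))"
  proof (rule abs_cont_on_dominated[OF ac ac, of 1])
    show "cmod (complex_of_real (Re (f x)) - complex_of_real (Re (f y))) \<le> 1 * (cmod (f x - f y) + cmod (f x - f y))" for x y
      using abs_Re_le_cmod[of "f x - f y"] unfolding of_real_diff[symmetric] norm_of_real by simp
  qed simp
  from abs_cont_on_real_integral[OF this ab]
  obtain G1 where G1: "integrable lborel G1" "\<And>x. x\<in>{a..b} \<Longrightarrow> Re (f x) - Re (f a) = (LBINT t:{a<..x}. G1 t)"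
    by blast
  have "abs_cont_on {a..b} (\<lambda>x. complex_of_real (Im (f x)))"
  proof (rule abs_cont_on_dominated[OF ac ac, of 1])
    show "cmod (complex_of_real (Im (f x)) - complex_of_real (Im (f y))) \<le> 1 * (cmod (f x - f y) + cmod (f x - f y))" for x y
      using abs_Im_le_cmod[of "f x - f y"] unfolding of_real_diff[symmetric] norm_of_real by simp
  qed simp
  from abs_cont_on_real_integral[OF this ab]
  obtain G2 where G2: "integrable lborel G2" "\<And>x. x\<in>{a..b} \<Longrightarrow> Im (f x) - Im (f a) = (LBINT t:{a<..x}. G2 t)"
    by blast
  define g where "g x = complex_of_real (G1 x) + \<i> * complex_of_real (G2 x)" for x
  have gi: "integrable lborel g" unfolding g_def
    by (intro Bochner_Integration.integrable_add integrable_mult_right integrable_of_real G1(1) G2(1))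
  have sG: "set_integrable lborel S G1" "set_integrable lborel S G2" "set_integrable lborel S g"
    if "S \<in> sets borel" for S
    unfolding set_integrable_def using that G1(1) G2(1) gi by (auto intro!: integrable_mult_indicator simp del: real_scaleR_def)
  have 1: "g absolutely_integrable_on {a..b}"
    using sG(3)[of "{a..b}"] unfolding set_integrable_def by (auto intro: integrable_completion[THEN iffD2])
  have "(g has_integral (f x - f a)) {a..x}" if x: "x \<in> {a..b}" for x
  proof -
    have h: "(G has_integral (LBINT t:{a<..x}. G t)) {a..x}" if "set_integrable lborel {a<..x} G" for G :: "real \<Rightarrow> real"
    proof -
      have "(G has_integral (LBINT t:{a<..x}. G t)) {a<..x}"
        using set_borel_integral_eq_integral[OF that] by (simp add: has_integral_iff)
      moreover have "negligible (sym_diff {a<..x} {a..x})"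
        by (rule negligible_subset[of "{a}"]) auto
      ultimately show ?thesis
        by (subst has_integral_spike_set_eq[of _ "{a<..x}"])
           (auto intro: negligible_subset[of "{a}"])
    qed
    have 1: "(G1 has_integral (Re (f x) - Re (f a))) {a..x}" using h[OF sG(1)] G1(2)[OF x] by simp
    have 2: "(G2 has_integral (Im (f x) - Im (f a))) {a..x}" using h[OF sG(2)] G2(2)[OF x] by simp
    have "(g has_integral (complex_of_real (Re (f x) - Re (f a)) + \<i> * complex_of_real (Im (f x) - Im (f a)))) {a..x}"
      unfolding g_def by (intro has_integral_add has_integral_mult_right has_integral_of_real 1 2)
    moreover have "complex_of_real (Re (f x) - Re (f a)) + \<i> * complex_of_real (Im (f x) - Im (f a)) = f x - f a"
      by (simp add: complex_eq_iff)
    ultimately show ?thesis by simp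
  qed
  then show ?thesis using 1 by blast
qed

text \<open>The library's differentiation theorem is one-sided; the left-hand quotient comes from
reflecting the function.\<close>

lemma indefinite_integral_has_vector_derivative:
  fixes g :: "real \<Rightarrow> complex"
  assumes g: "g integrable_on {a..b}"
    and F: "\<And>x. x \<in> {a..b} \<Longrightarrow> F x = c + integral {a..x} g"
  shows "\<exists>N. negligible N \<and> (\<forall>x\<in>{a<..<b} - N. (F has_vector_derivative g x) (at x))"
proof -
  \<comment> \<open>Extension by zero: the differentiation theorem is applied to functions
    integrable on every interval.\<close>
  define g0 where "g0 x = (if x \<in> {a..b} then g x else 0)" for x
  have g0U: "g0 integrable_on UNIV" unfolding g0_def integrable_restrict_UNIV by (rule g)
  have g0i: "g0 integrable_on cbox c d" for c d
    by (rule integrable_on_subcbox[OF g0U]) auto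
  have g0r: "(\<lambda>x. g0 (- x)) integrable_on cbox c d" for c d
    using g0i[of "-d" "-c"] Henstock_Kurzweil_Integration.integrable_reflect_real[where f=g0 and a="-d" and b="-c"] by simp
  obtain N1 where N1: "negligible N1" "\<And>x e. x \<notin> N1 \<Longrightarrow> 0 < e \<Longrightarrow> \<exists>d>0. \<forall>h. 0 < h \<and> h < d \<longrightarrow>
       norm (integral (cbox x (x + h *\<^sub>R One)) g0 /\<^sub>R h ^ DIM(real) - g0 x) < e"
    using integrable_ccontinuous_explicit[OF g0i] by blast
  obtain N2 where N2: "negligible N2" "\<And>x e. x \<notin> N2 \<Longrightarrow> 0 < e \<Longrightarrow> \<exists>d>0. \<forall>h. 0 < h \<and> h < d \<longrightarrow>
       norm (integral (cbox x (x + h *\<^sub>R One)) (\<lambda>x. g0 (- x)) /\<^sub>R h ^ DIM(real) - g0 (- x)) < e"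
    using integrable_ccontinuous_explicit[OF g0r] by blast
  have N2': "negligible (uminus ` N2)"
    using N2(1) by (intro negligible_differentiable_image_negligible) (auto intro!: derivative_intros simp: differentiable_on_def)
  have "(F has_vector_derivative g x) (at x)" if x: "x \<in> {a<..<b}" "x \<notin> N1" "x \<notin> uminus ` N2" for x
    unfolding has_vector_derivative_def has_derivative_at_alt
  proof (intro conjI allI impI)
    show "bounded_linear (\<lambda>y. y *\<^sub>R g x)" by (rule bounded_linear_scaleR_left)
    fix e :: real assume "e > 0"
    have gx: "g0 x = g x" using x by (simp add: g0_def)
    obtain d1 where d1: "d1 > 0" "\<And>h. 0 < h \<Longrightarrow> h < d1 \<Longrightarrow> norm (integral {x..x+h} g0 /\<^sub>R h - g x) < e"
      using N1(2)[OF x(2) \<open>e>0\<close>] gx by auto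
    have "- x \<notin> N2" using x(3) by force
    then obtain d2 where d2: "d2 > 0" "\<And>h. 0 < h \<Longrightarrow> h < d2 \<Longrightarrow> norm (integral {-x..-x+h} (\<lambda>x. g0 (- x)) /\<^sub>R h - g x) < e"
      using N2(2)[of "-x", OF _ \<open>e>0\<close>] gx by auto
    have d2': "norm (integral {x-h..x} g0 /\<^sub>R h - g x) < e" if "0 < h" "h < d2" for h
      using d2(2)[OF that] Henstock_Kurzweil_Integration.integral_reflect_real[where a="x-h" and b=x and f=g0] by (simp add: algebra_simps)
    have Fd: "F t - F s = integral {s..t} g0" if "a \<le> s" "s \<le> t" "t \<le> b" for s t
    proof -
      have "integral {a..s} g + integral {s..t} g = integral {a..t} g"
        by (rule Henstock_Kurzweil_Integration.integral_combine) (use that in \<open>auto intro: integrable_subinterval_real[OF g]\<close>)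
      moreover have "integral {s..t} g0 = integral {s..t} g"
        by (rule Henstock_Kurzweil_Integration.integral_cong) (use that in \<open>auto simp: g0_def\<close>)
      ultimately show ?thesis using F[of s] F[of t] that by (auto simp: algebra_simps)
    qed
    have quot: "norm (I - h *\<^sub>R v) \<le> e * h" if "h > 0" "norm (I /\<^sub>R h - v) < e" for I v :: complex and h :: real
    proof -
      have "I - h *\<^sub>R v = h *\<^sub>R (I /\<^sub>R h - v)" using that by (simp add: scaleR_right_diff_distrib)
      then have "norm (I - h *\<^sub>R v) = h * norm (I /\<^sub>R h - v)" using that by simp
      then show ?thesis using that by (simp add: mult.commute mult_left_mono less_imp_le)
    qed
    show "\<exists>d>0. \<forall>y. norm (y - x) < d \<longrightarrow> norm (F y - F x - (y - x) *\<^sub>R g x) \<le> e * norm (y - x)"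
    \<comment> \<open>The last two entries of the minimum keep \<open>y\<close> inside
      \<open>{a..b}\<close>, where \<open>F\<close> is the indefinite integral.\<close>
    proof (intro exI[of _ "Min {d1, d2, x - a, b - x}"] conjI allI impI)
      fix y assume y: "norm (y - x) < Min {d1, d2, x - a, b - x}"
      consider "y = x" | "y > x" | "y < x" by linarith
      then show "norm (F y - F x - (y - x) *\<^sub>R g x) \<le> e * norm (y - x)"
      proof cases
        case 2
        have "norm (integral {x..y} g0 - (y - x) *\<^sub>R g x) \<le> e * (y - x)"
          using d1(2)[of "y - x"] y 2 by (intro quot) auto
        then show ?thesis using Fd[of x y] x y 2 by auto
      next
        case 3
        have "norm (integral {y..x} g0 - (x - y) *\<^sub>R g x) \<le> e * (x - y)"
          using d2'[of "x - y"] y 3 by (intro quot) auto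
        moreover have "F y - F x - (y - x) *\<^sub>R g x = - (integral {y..x} g0 - (x - y) *\<^sub>R g x)"
          using Fd[of y x] x y 3 by (auto simp: algebra_simps)
        ultimately show ?thesis using 3 by (metis abs_minus_commute abs_of_pos diff_gt_0_iff_gt norm_minus_cancel real_norm_def)
      qed simp
    qed (use d1(1) d2(1) x in auto)
  qed
  then show ?thesis using N1(1) N2' by (intro exI[of _ "N1 \<union> uminus ` N2"]) auto
qed

lemma abs_cont_on_derivative:
  assumes ac: "abs_cont_on {a..b} f" and ab: "a < b"
  obtains g N where "g absolutely_integrable_on {a..b}" "negligible N"
    "\<And>x. x \<in> {a<..<b} - N \<Longrightarrow> (f has_vector_derivative g x) (at x)"
    "(g has_integral (f b - f a)) {a..b}"
proof -
  obtain g where g: "g absolutely_integrable_on {a..b}" "\<And>x. x\<in>{a..b} \<Longrightarrow> (g has_integral (f x - f a)) {a..x}"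
    using abs_cont_on_integral[OF assms] by blast
  have "\<exists>N. negligible N \<and> (\<forall>x\<in>{a<..<b} - N. (f has_vector_derivative g x) (at x))"
  proof (rule indefinite_integral_has_vector_derivative)
    show "g integrable_on {a..b}" using g(1) by (simp add: set_lebesgue_integral_eq_integral)
    show "f x = f a + integral {a..x} g" if "x \<in> {a..b}" for x
      using g(2)[OF that] by (simp add: integral_unique)
  qed
  then show thesis using that g ab by (meson atLeastAtMost_iff less_imp_le order_refl)
qed

text \<open>Derivatives are unique, so any function that is a derivative of \<open>f\<close> off a
  null set agrees almost everywhere with the density already found and inherits its integral.
  Green's formula uses absolute continuity in this form.\<close>

lemma abs_cont_on_FTC:
  assumes ac: "abs_cont_on {a..b} f" and ab: "a < b" and N: "negligible N"
    and d: "\<And>x. x \<in> {a<..<b} - N \<Longrightarrow> (f has_vector_derivative g x) (at x)"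
  shows "g absolutely_integrable_on {a..b}" "(g has_integral (f b - f a)) {a..b}"
proof -
  obtain g' N' where g': "g' absolutely_integrable_on {a..b}" "negligible N'"
    "\<And>x. x \<in> {a<..<b} - N' \<Longrightarrow> (f has_vector_derivative g' x) (at x)" "(g' has_integral (f b - f a)) {a..b}"
    using abs_cont_on_derivative[OF ac ab] by blast
  let ?M = "N \<union> N' \<union> {a, b}"
  have M: "negligible ?M" using N g'(2) by auto
  have eq: "g x = g' x" if "x \<in> {a..b} - ?M" for x
    using vector_derivative_unique_at[OF d[of x] g'(3)[of x]] that by auto
  show "g absolutely_integrable_on {a..b}" by (rule absolutely_integrable_spike[OF g'(1) M eq])
  show "(g has_integral (f b - f a)) {a..b}" by (rule has_integral_spike[OF M eq g'(4)])
qed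

text \<open>Adding the increments over the gaps, nonnegative by monotonicity, makes the sum
  telescope.\<close>

lemma sum_ordered_intervals_le:
  fixes \<Phi> :: "real \<Rightarrow> real"
  assumes mono: "\<And>x y. a \<le> x \<Longrightarrow> x \<le> y \<Longrightarrow> y \<le> b \<Longrightarrow> \<Phi> x \<le> \<Phi> y" and ab: "a \<le> b"
    and mem: "\<And>k. k < n \<Longrightarrow> s k \<in> {a..b} \<and> t k \<in> {a..b} \<and> s k \<le> t k"
    and ord: "\<And>k. Suc k < n \<Longrightarrow> t k \<le> s (Suc k)"
  shows "(\<Sum>k<n. \<Phi> (t k) - \<Phi> (s k)) \<le> \<Phi> b - \<Phi> a"
proof -
  have *: "(\<Sum>k<Suc m. \<Phi> (t k) - \<Phi> (s k)) \<le> \<Phi> (t m) - \<Phi> a" if "m < n" for m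
    using that
  proof (induction m)
    case 0
    then show ?case using mono[of a "s 0"] mem[of 0] by auto
  next
    case (Suc m)
    then have "(\<Sum>k<Suc m. \<Phi> (t k) - \<Phi> (s k)) \<le> \<Phi> (t m) - \<Phi> a" by simp
    moreover have "\<Phi> (t m) \<le> \<Phi> (s (Suc m))" using Suc.prems mem[of m] mem[of "Suc m"] ord[of m] by (intro mono) auto
    ultimately show ?case by simp
  qed
  show ?thesis
  proof (cases n)
    case 0
    then show ?thesis using mono[of a b] ab by simp
  next
    case (Suc m)
    then have "\<Phi> (t m) \<le> \<Phi> b" using mem[of m] by (intro mono) auto
    then show ?thesis using *[of m] Suc by simp
  qed
qed

text \<open>The excess of \<open>cmod (g x)\<close> over \<open>n\<close> vanishes once
  \<open>n\<close> has reached that value, and it is dominated by \<open>cmod (g x)\<close>;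
  dominated convergence provides a suitable \<open>M\<close>.\<close>

lemma integral_excess_small:
  fixes g :: "real \<Rightarrow> complex"
  assumes g: "g absolutely_integrable_on {a..b}" and "\<epsilon> > 0"
  shows "\<exists>M\<ge>0. (\<lambda>x. max 0 (cmod (g x) - M)) integrable_on {a..b} \<and> integral {a..b} (\<lambda>x. max 0 (cmod (g x) - M)) < \<epsilon>"
proof -
  let ?p = "\<lambda>n x. max 0 (cmod (g x) - real n)"
  have ng: "(\<lambda>x. cmod (g x)) absolutely_integrable_on {a..b}" using absolutely_integrable_norm[OF g] by (simp add: o_def)
  have pa: "?p n absolutely_integrable_on {a..b}" for n
  proof -
    have "(\<lambda>x. cmod (g x) - real n) absolutely_integrable_on {a..b}"
      by (intro set_integral_diff ng absolutely_integrable_on_const) auto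
    then show ?thesis by (intro absolutely_integrable_max_1) auto
  qed
  then have pint: "?p n integrable_on {a..b}" for n by (simp add: set_lebesgue_integral_eq_integral)
  have "(\<lambda>n. integral {a..b} (?p n)) \<longlonglongrightarrow> integral {a..b} (\<lambda>x. 0)"
  proof (rule dominated_convergence(2)[OF pint])
    show "(\<lambda>x. cmod (g x)) integrable_on {a..b}" using ng by (simp add: set_lebesgue_integral_eq_integral)
    show "norm (?p n x) \<le> cmod (g x)" for n x by simp
    show "(\<lambda>n. ?p n x) \<longlonglongrightarrow> 0" for x
    proof (rule tendsto_eventually)
      obtain m where "cmod (g x) \<le> real m" using real_arch_simple by blast
      then have "?p n x = 0" if "n \<ge> m" for n using that by simp
      then show "\<forall>\<^sub>F n in sequentially. ?p n x = 0" by (rule eventually_sequentiallyI)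
    qed
  qed
  then have "\<forall>\<^sub>F n in sequentially. integral {a..b} (?p n) < \<epsilon>"
    using \<open>\<epsilon> > 0\<close> by (intro order_tendstoD(2)) auto
  then obtain n where "integral {a..b} (?p n) < \<epsilon>" by (auto simp: eventually_sequentially)
  then show ?thesis using pint by (intro exI[of _ "real n"]) auto
qed

text \<open>Converse of the integral representation, used for functions built by integration.
  Bounding \<open>cmod (g x)\<close> by \<open>M\<close> plus its excess leaves \<open>M\<close>
  times the total length, small through \<open>\<delta>\<close>, and an excess integral that is
  below \<open>\<epsilon> / 2\<close> over the whole interval.\<close>

lemma abs_cont_on_if_integral:
  fixes g :: "real \<Rightarrow> complex"
  assumes g: "g absolutely_integrable_on {a..b}"
    and F: "\<And>x y. a \<le> x \<Longrightarrow> x \<le> y \<Longrightarrow> y \<le> b \<Longrightarrow> (g has_integral (F y - F x)) {x..y}"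
  shows "abs_cont_on {a..b} F"
proof (cases "a \<le> b")
  case False
  then have "{a..b} = {}" by simp
  show ?thesis unfolding abs_cont_on_def
  proof (intro allI impI exI[of _ 1] conjI)
    fix \<epsilon> :: real and n :: nat and s t assume "\<epsilon> > 0" and "(\<forall>k<n. s k \<in> {a..b} \<and> t k \<in> {a..b} \<and> s k \<le> t k) \<and>
        (\<forall>k. Suc k < n \<longrightarrow> t k \<le> s (Suc k)) \<and> (\<Sum>k<n. t k - s k) < 1"
    then have "n = 0" using \<open>{a..b} = {}\<close> by (cases n) auto
    then show "(\<Sum>k<n. cmod (F (t k) - F (s k))) < \<epsilon>" using \<open>\<epsilon> > 0\<close> by simp
  qed simp
next
  case True
  show ?thesis unfolding abs_cont_on_def
  proof (intro allI impI)
    fix \<epsilon> :: real assume "\<epsilon> > 0"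
    then obtain M where M: "M \<ge> 0" "(\<lambda>x. max 0 (cmod (g x) - M)) integrable_on {a..b}"
      "integral {a..b} (\<lambda>x. max 0 (cmod (g x) - M)) < \<epsilon> / 2"
      using integral_excess_small[OF g, of "\<epsilon>/2"] by auto
    define p where "p x = max 0 (cmod (g x) - M)" for x
    define \<Phi> where "\<Phi> x = integral {a..x} p" for x
    have pi: "p integrable_on {x..y}" if "a \<le> x" "y \<le> b" for x y
      using M(2) that unfolding p_def by (intro integrable_subinterval_real[OF M(2)]) auto
    have \<Phi>d: "\<Phi> y - \<Phi> x = integral {x..y} p" if "a \<le> x" "x \<le> y" "y \<le> b" for x y
      using Henstock_Kurzweil_Integration.integral_combine[of a x y p] that pi[of a y] unfolding \<Phi>_def by simp
    have \<Phi>m: "\<Phi> x \<le> \<Phi> y" if "a \<le> x" "x \<le> y" "y \<le> b" for x y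
    proof -
      have "integral {x..y} p \<ge> 0" by (intro integral_nonneg pi that) (auto simp: p_def)
      then show ?thesis using \<Phi>d[OF that] by simp
    qed
    have Fd: "cmod (F y - F x) \<le> M * (y - x) + (\<Phi> y - \<Phi> x)" if "a \<le> x" "x \<le> y" "y \<le> b" for x y
    proof -
      have i: "(\<lambda>t. M + p t) integrable_on {x..y}" by (intro integrable_add pi that integrable_const_ivl)
      have "cmod (integral {x..y} g) \<le> integral {x..y} (\<lambda>t. M + p t)"
        using F[OF that] by (intro integral_norm_bound_integral i) (auto simp: p_def)
      also have "\<dots> = M * (y - x) + integral {x..y} p"
        using that by (subst Henstock_Kurzweil_Integration.integral_add) (auto intro: pi)
      finally show ?thesis using F[OF that] \<Phi>d[OF that] by (simp add: integral_unique)
    qed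
    show "\<exists>\<delta>>0. \<forall>(n::nat) s t. (\<forall>k<n. s k \<in> {a..b} \<and> t k \<in> {a..b} \<and> s k \<le> t k) \<and>
        (\<forall>k. Suc k < n \<longrightarrow> t k \<le> s (Suc k)) \<and> (\<Sum>k<n. t k - s k) < \<delta> \<longrightarrow>
        (\<Sum>k<n. cmod (F (t k) - F (s k))) < \<epsilon>"
    proof (intro exI[of _ "\<epsilon> / (2 * (M + 1))"] conjI allI impI)
      show "\<epsilon> / (2 * (M + 1)) > 0" using \<open>\<epsilon> > 0\<close> M(1) by auto
      fix n :: nat and s t assume A: "(\<forall>k<n. s k \<in> {a..b} \<and> t k \<in> {a..b} \<and> s k \<le> t k) \<and>
        (\<forall>k. Suc k < n \<longrightarrow> t k \<le> s (Suc k)) \<and> (\<Sum>k<n. t k - s k) < \<epsilon> / (2 * (M + 1))"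
      have "(\<Sum>k<n. cmod (F (t k) - F (s k))) \<le> (\<Sum>k<n. M * (t k - s k) + (\<Phi> (t k) - \<Phi> (s k)))"
        by (intro sum_mono Fd) (use A in auto)
      also have "\<dots> = M * (\<Sum>k<n. t k - s k) + (\<Sum>k<n. \<Phi> (t k) - \<Phi> (s k))"
        by (simp add: sum.distrib sum_distrib_left)
      also have "(\<Sum>k<n. \<Phi> (t k) - \<Phi> (s k)) \<le> \<Phi> b - \<Phi> a"
        by (rule sum_ordered_intervals_le) (use A \<Phi>m True in auto)
      also have "\<Phi> b - \<Phi> a < \<epsilon> / 2" using M(3) \<Phi>d[of a b] True unfolding p_def by simp
      also have "M * (\<Sum>k<n. t k - s k) \<le> M * (\<epsilon> / (2 * (M + 1)))"
        using A M(1) by (intro mult_left_mono) auto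
      also have "\<dots> \<le> \<epsilon> / 2" using M(1) \<open>\<epsilon> > 0\<close> by (simp add: field_simps)
      finally show "(\<Sum>k<n. cmod (F (t k) - F (s k))) < \<epsilon>" by simp
    qed
  qed
qed

section \<open>Green's formula on the half-lines\<close>

lemma abs_cont_on_if_continuous_derivative:
  assumes d: "\<And>x. x \<in> {a..b} \<Longrightarrow> (f has_vector_derivative f' x) (at x within {a..b})"
    and c: "continuous_on {a..b} f'"
  shows "abs_cont_on {a..b} f"
proof (rule abs_cont_on_if_integral)
  show "f' absolutely_integrable_on {a..b}" using c by (rule absolutely_integrable_continuous_real)
  show "(f' has_integral (f y - f x)) {x..y}" if "a \<le> x" "x \<le> y" "y \<le> b" for x y
    by (rule fundamental_theorem_of_calculus) (use that in \<open>auto intro: has_vector_derivative_within_subset[OF d]\<close>)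
qed

text \<open>The fundamental theorem is applied to the Wronskian \<open>u * v1 - u1 * v\<close>, in
  whose derivative the two products \<open>u1 * v1\<close> cancel. A null set is exempted because
  second derivatives exist only almost everywhere.\<close>

lemma Green_interval:
  fixes u v :: "real \<Rightarrow> complex"
  assumes cd: "c < d" and N: "negligible N"
    and ac: "abs_cont_on {c..d} u" "abs_cont_on {c..d} u1" "abs_cont_on {c..d} v" "abs_cont_on {c..d} v1"
    and du: "\<And>x. x \<in> {c<..<d} - N \<Longrightarrow> (u has_vector_derivative u1 x) (at x)"
    and du1: "\<And>x. x \<in> {c<..<d} - N \<Longrightarrow> (u1 has_vector_derivative u2 x) (at x)"
    and dv: "\<And>x. x \<in> {c<..<d} - N \<Longrightarrow> (v has_vector_derivative v1 x) (at x)"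
    and dv1: "\<And>x. x \<in> {c<..<d} - N \<Longrightarrow> (v1 has_vector_derivative v2 x) (at x)"
  shows "((\<lambda>x. u x * v2 x - u2 x * v x) has_integral
          (u d * v1 d - u1 d * v d) - (u c * v1 c - u1 c * v c)) {c..d}"
proof (rule abs_cont_on_FTC(2)[OF _ cd N])
  show "abs_cont_on {c..d} (\<lambda>x. u x * v1 x - u1 x * v x)"
    by (intro abs_cont_on_diff abs_cont_on_mult ac)
  fix x assume x: "x \<in> {c<..<d} - N"
  have "((\<lambda>x. u x * v1 x - u1 x * v x) has_vector_derivative
      (u x * v2 x + u1 x * v1 x) - (u1 x * v1 x + u2 x * v x)) (at x)"
    by (intro has_vector_derivative_diff has_vector_derivative_mult du[OF x] du1[OF x] dv[OF x] dv1[OF x])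
  then show "((\<lambda>x. u x * v1 x - u1 x * v x) has_vector_derivative (u x * v2 x - u2 x * v x)) (at x)"
    by (simp add: algebra_simps)
qed

text \<open>Vanishing data of \<open>p\<close> at \<open>c+1\<close> leave only the term at
  \<open>c\<close> in Green's formula. The bounds 1 and 6 are those of the two Hermite cubics, on a
  unit interval, to which this is applied.\<close>

lemma Green_polynomial_bound:
  fixes v v1 v2 :: "real \<Rightarrow> complex" and p p1 p2 :: "real \<Rightarrow> real"
  assumes N: "negligible N"
    and ac: "abs_cont_on {c..c+1} v" "abs_cont_on {c..c+1} v1"
    and dv: "\<And>x. x \<in> {c<..<c+1} - N \<Longrightarrow> (v has_vector_derivative v1 x) (at x)"
    and dv1: "\<And>x. x \<in> {c<..<c+1} - N \<Longrightarrow> (v1 has_vector_derivative v2 x) (at x)"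
    and p: "\<And>x. (p has_real_derivative p1 x) (at x)" "\<And>x. (p1 has_real_derivative p2 x) (at x)"
    and p2c: "continuous_on UNIV p2"
    and b: "p (c+1) = 0" "p1 (c+1) = 0"
    and bd: "\<And>x. x \<in> {c..c+1} \<Longrightarrow> \<bar>p x\<bar> \<le> 1" "\<And>x. x \<in> {c..c+1} \<Longrightarrow> \<bar>p2 x\<bar> \<le> 6"
    and int: "(\<lambda>x. cmod (v2 x) + 6 * cmod (v x)) integrable_on {c..c+1}"
  shows "cmod (p c * v1 c - p1 c * v c) \<le> integral {c..c+1} (\<lambda>x. cmod (v2 x) + 6 * cmod (v x))"
proof -
  let ?u = "\<lambda>x. complex_of_real (p x)" and ?u1 = "\<lambda>x. complex_of_real (p1 x)" and ?u2 = "\<lambda>x. complex_of_real (p2 x)"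
  have du: "(?u has_vector_derivative ?u1 x) (at x within S)" "(?u1 has_vector_derivative ?u2 x) (at x within S)" for x S
    using p[of x] by (auto intro!: has_vector_derivative_of_real simp: has_real_derivative_iff_has_vector_derivative intro: has_vector_derivative_at_within)
  have c1: "continuous_on {c..c+1} ?u1"
    by (rule continuous_on_vector_derivative[OF du(2)])
  have "continuous_on {c..c+1} ?u2"
    using continuous_on_subset[OF p2c, of "{c..c+1}"] by (intro continuous_intros) auto
  with c1 have "abs_cont_on {c..c+1} ?u" "abs_cont_on {c..c+1} ?u1"
    by (auto intro!: abs_cont_on_if_continuous_derivative[OF du(1)] abs_cont_on_if_continuous_derivative[OF du(2)])
  from Green_interval[OF _ N this ac, of ?u2 v2]
  have G: "((\<lambda>x. ?u x * v2 x - ?u2 x * v x) has_integral - (p c * v1 c - p1 c * v c)) {c..c+1}"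
    using du dv dv1 b by simp
  have "cmod (integral {c..c+1} (\<lambda>x. ?u x * v2 x - ?u2 x * v x)) \<le> integral {c..c+1} (\<lambda>x. cmod (v2 x) + 6 * cmod (v x))"
  proof (rule integral_norm_bound_integral[OF _ int])
    show "(\<lambda>x. ?u x * v2 x - ?u2 x * v x) integrable_on {c..c+1}" using G by blast
    fix x assume x: "x \<in> {c..c+1}"
    have "cmod (?u x * v2 x - ?u2 x * v x) \<le> \<bar>p x\<bar> * cmod (v2 x) + \<bar>p2 x\<bar> * cmod (v x)"
      by (rule order_trans[OF norm_triangle_ineq4]) (simp add: norm_mult)
    also have "\<dots> \<le> 1 * cmod (v2 x) + 6 * cmod (v x)"
      using bd[OF x] by (intro add_mono mult_right_mono) auto
    finally show "cmod (?u x * v2 x - ?u2 x * v x) \<le> cmod (v2 x) + 6 * cmod (v x)" by simp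
  qed
  then show ?thesis using G by (simp add: integral_unique norm_minus_commute)
qed

text \<open>The cubics below have Hermite data \<open>(1,0)\<close> resp. \<open>(0,1)\<close> at \<open>c\<close> and \<open>(0,0)\<close> at \<open>c+1\<close>, so that
Green's formula isolates the derivative resp. the value of \<open>v\<close> at \<open>c\<close>.\<close>

lemma endpoint_bound:
  fixes v :: "real \<Rightarrow> complex"
  assumes N: "negligible N"
    and ac: "abs_cont_on {c..c+1} v" "abs_cont_on {c..c+1} v1"
    and dv: "\<And>x. x \<in> {c<..<c+1} - N \<Longrightarrow> (v has_vector_derivative v1 x) (at x)"
    and dv1: "\<And>x. x \<in> {c<..<c+1} - N \<Longrightarrow> (v1 has_vector_derivative v2 x) (at x)"
    and int: "(\<lambda>x. cmod (v2 x) + 6 * cmod (v x)) integrable_on {c..c+1}"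
  shows "cmod (v c) \<le> integral {c..c+1} (\<lambda>x. cmod (v2 x) + 6 * cmod (v x))"
    and "cmod (v1 c) \<le> integral {c..c+1} (\<lambda>x. cmod (v2 x) + 6 * cmod (v x))"
proof -
  note G = Green_polynomial_bound[OF N ac dv dv1 _ _ _ _ _ _ _ int]
  have "cmod (complex_of_real ((c - c) * (1 - (c - c))\<^sup>2) * v1 c - complex_of_real ((1 - (c - c)) * (1 - 3 * (c - c))) * v c)
      \<le> integral {c..c+1} (\<lambda>x. cmod (v2 x) + 6 * cmod (v x))"
  proof (rule G[where p = "\<lambda>x. (x - c) * (1 - (x - c))\<^sup>2" and ?p1.0 = "\<lambda>x. (1 - (x - c)) * (1 - 3 * (x - c))"
        and ?p2.0 = "\<lambda>x. 6 * (x - c) - 4"])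
    show "((\<lambda>x. (x - c) * (1 - (x - c))\<^sup>2) has_real_derivative (1 - (x - c)) * (1 - 3 * (x - c))) (at x)" for x
      by (auto intro!: derivative_eq_intros simp: power2_eq_square algebra_simps)
    show "((\<lambda>x. (1 - (x - c)) * (1 - 3 * (x - c))) has_real_derivative 6 * (x - c) - 4) (at x)" for x
      by (auto intro!: derivative_eq_intros simp: power2_eq_square algebra_simps)
    show "\<bar>(x - c) * (1 - (x - c))\<^sup>2\<bar> \<le> 1" if "x \<in> {c..c+1}" for x
    proof -
      have "(x - c) * (1 - (x - c))\<^sup>2 \<le> 1 * 1"
        using that by (intro mult_mono power_le_one) auto
      moreover have "(x - c) * (1 - (x - c))\<^sup>2 \<ge> 0" using that by auto
      ultimately show ?thesis by simp
    qed
    show "\<bar>6 * (x - c) - 4\<bar> \<le> 6" if "x \<in> {c..c+1}" for x using that by auto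
  qed (auto intro!: continuous_intros)
  then show "cmod (v c) \<le> integral {c..c+1} (\<lambda>x. cmod (v2 x) + 6 * cmod (v x))" by simp
  have "cmod (complex_of_real ((1 - (c - c))\<^sup>2 * (1 + 2 * (c - c))) * v1 c - complex_of_real (6 * (c - c) * ((c - c) - 1)) * v c)
      \<le> integral {c..c+1} (\<lambda>x. cmod (v2 x) + 6 * cmod (v x))"
  proof (rule G[where p = "\<lambda>x. (1 - (x - c))\<^sup>2 * (1 + 2 * (x - c))" and ?p1.0 = "\<lambda>x. 6 * (x - c) * ((x - c) - 1)"
        and ?p2.0 = "\<lambda>x. 12 * (x - c) - 6"])
    show "((\<lambda>x. (1 - (x - c))\<^sup>2 * (1 + 2 * (x - c))) has_real_derivative 6 * (x - c) * ((x - c) - 1)) (at x)" for x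
      by (auto intro!: derivative_eq_intros simp: power2_eq_square algebra_simps)
    show "((\<lambda>x. 6 * (x - c) * ((x - c) - 1)) has_real_derivative 12 * (x - c) - 6) (at x)" for x
      by (auto intro!: derivative_eq_intros simp: power2_eq_square algebra_simps)
    show "\<bar>(1 - (x - c))\<^sup>2 * (1 + 2 * (x - c))\<bar> \<le> 1" if "x \<in> {c..c+1}" for x
    proof -
      have "(1 - (x - c))\<^sup>2 * (1 + 2 * (x - c)) = 1 - (x - c)\<^sup>2 * (3 - 2 * (x - c))"
        by (simp add: power2_eq_square algebra_simps)
      moreover have "(x - c)\<^sup>2 * (3 - 2 * (x - c)) \<ge> 0" using that by auto
      moreover have "(1 - (x - c))\<^sup>2 * (1 + 2 * (x - c)) \<ge> 0" using that by auto
      ultimately show ?thesis by simp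
    qed
    show "\<bar>12 * (x - c) - 6\<bar> \<le> 6" if "x \<in> {c..c+1}" for x using that by auto
  qed (auto intro!: continuous_intros)
  then show "cmod (v1 c) \<le> integral {c..c+1} (\<lambda>x. cmod (v2 x) + 6 * cmod (v x))" by simp
qed

section \<open>Square integrable functions on \<open>Omega\<close>\<close>

lemma Omega_sets [measurable]: "Omega \<Lambda> \<in> sets borel" "Omega \<Lambda> \<in> sets lebesgue"
  by (auto simp: Omega_def)

lemma L2_measurable: "L2 \<Lambda> f \<Longrightarrow> (\<lambda>x. indicator (Omega \<Lambda>) x *\<^sub>R f x) \<in> borel_measurable lebesgue"
  by (simp add: L2_def set_borel_measurable_def)

lemma L2_square_integrable: "L2 \<Lambda> f \<Longrightarrow> set_integrable lebesgue (Omega \<Lambda>) (\<lambda>x. (cmod (f x))\<^sup>2)"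
  by (simp add: L2_def)

lemma L2I:
  assumes m: "set_borel_measurable lebesgue (Omega \<Lambda>) f" and g: "set_integrable lebesgue (Omega \<Lambda>) (g :: real \<Rightarrow> real)"
    and le: "\<And>x. x \<in> Omega \<Lambda> \<Longrightarrow> (cmod (f x))\<^sup>2 \<le> g x"
  shows "L2 \<Lambda> f"
  unfolding L2_def
proof (intro conjI m, rule set_integrable_bound[OF g])
  have "(\<lambda>x. (cmod (indicator (Omega \<Lambda>) x *\<^sub>R f x))\<^sup>2) \<in> borel_measurable lebesgue"
    using m unfolding set_borel_measurable_def by measurable
  also have "(\<lambda>x. (cmod (indicator (Omega \<Lambda>) x *\<^sub>R f x))\<^sup>2) = (\<lambda>x. indicator (Omega \<Lambda>) x *\<^sub>R (cmod (f x))\<^sup>2)"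
    by (auto simp: indicator_def)
  finally show "set_borel_measurable lebesgue (Omega \<Lambda>) (\<lambda>x. (cmod (f x))\<^sup>2)"
    unfolding set_borel_measurable_def .
  show "AE x in lebesgue. x \<in> Omega \<Lambda> \<longrightarrow> norm ((cmod (f x))\<^sup>2) \<le> norm (g x)"
    using le by (intro AE_I2) (auto intro: order_trans[OF _ abs_ge_self])
qed

lemma L2_cmult: assumes "L2 \<Lambda> f" shows "L2 \<Lambda> (\<lambda>x. c * f x)"
proof (rule L2I[where g = "\<lambda>x. (cmod c)\<^sup>2 * (cmod (f x))\<^sup>2"])
  have "(\<lambda>x. c * (indicator (Omega \<Lambda>) x *\<^sub>R f x)) \<in> borel_measurable lebesgue"
    using L2_measurable[OF assms] by measurable
  then show "set_borel_measurable lebesgue (Omega \<Lambda>) (\<lambda>x. c * f x)"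
    unfolding set_borel_measurable_def by (simp add: mult.left_commute scaleR_conv_of_real)
  show "set_integrable lebesgue (Omega \<Lambda>) (\<lambda>x. (cmod c)\<^sup>2 * (cmod (f x))\<^sup>2)"
    using L2_square_integrable[OF assms] by simp
qed (simp add: norm_mult power_mult_distrib)

lemma L2_add: assumes "L2 \<Lambda> f" "L2 \<Lambda> g" shows "L2 \<Lambda> (\<lambda>x. f x + g x)"
proof (rule L2I[where g = "\<lambda>x. 2 * (cmod (f x))\<^sup>2 + 2 * (cmod (g x))\<^sup>2"])
  have "(\<lambda>x. indicator (Omega \<Lambda>) x *\<^sub>R f x + indicator (Omega \<Lambda>) x *\<^sub>R g x) \<in> borel_measurable lebesgue"
    using L2_measurable[OF assms(1)] L2_measurable[OF assms(2)] by measurable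
  then show "set_borel_measurable lebesgue (Omega \<Lambda>) (\<lambda>x. f x + g x)"
    unfolding set_borel_measurable_def by (simp add: scaleR_add_right)
  show "set_integrable lebesgue (Omega \<Lambda>) (\<lambda>x. 2 * (cmod (f x))\<^sup>2 + 2 * (cmod (g x))\<^sup>2)"
    using assms[THEN L2_square_integrable] by (intro set_integral_add) auto
  show "(cmod (f x + g x))\<^sup>2 \<le> 2 * (cmod (f x))\<^sup>2 + 2 * (cmod (g x))\<^sup>2" for x
  proof -
    have "(cmod (f x + g x))\<^sup>2 \<le> (cmod (f x) + cmod (g x))\<^sup>2" by (intro power_mono norm_triangle_ineq) auto
    moreover have "0 \<le> (cmod (f x) - cmod (g x))\<^sup>2" by simp
    ultimately show ?thesis by (simp add: power2_eq_square algebra_simps)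
  qed
qed

lemma L2_diff: "L2 \<Lambda> f \<Longrightarrow> L2 \<Lambda> g \<Longrightarrow> L2 \<Lambda> (\<lambda>x. f x - g x)"
  using L2_add[of \<Lambda> f "\<lambda>x. (-1) * g x"] L2_cmult[of \<Lambda> g "-1"] by simp

text \<open>Lebesgue measure is complete, so measurability passes to a function that agrees almost
  everywhere; hence \<open>L2\<close> does not depend on the representative.\<close>

lemma L2_cong_AE: assumes "L2 \<Lambda> f" "aeq \<Lambda> f g" shows "L2 \<Lambda> g"
proof -
  have ae: "AE x in lebesgue. indicator (Omega \<Lambda>) x *\<^sub>R f x = indicator (Omega \<Lambda>) x *\<^sub>R g x"
    using assms(2) unfolding aeq_def by eventually_elim (auto simp: indicator_def)
  have ae': "AE x in lebesgue. indicator (Omega \<Lambda>) x *\<^sub>R (cmod (f x))\<^sup>2 = indicator (Omega \<Lambda>) x *\<^sub>R (cmod (g x))\<^sup>2"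
    using assms(2) unfolding aeq_def by eventually_elim (auto simp: indicator_def)
  have m: "(\<lambda>x. indicator (Omega \<Lambda>) x *\<^sub>R g x) \<in> borel_measurable lebesgue"
    by (rule borel_measurable_AE[OF L2_measurable[OF assms(1)] ae])
  have i: "integrable lebesgue (\<lambda>x. indicator (Omega \<Lambda>) x *\<^sub>R (cmod (f x))\<^sup>2)"
    using L2_square_integrable[OF assms(1)] unfolding set_integrable_def .
  have "integrable lebesgue (\<lambda>x. indicator (Omega \<Lambda>) x *\<^sub>R (cmod (g x))\<^sup>2)"
    by (rule integrable_cong_AE_imp[OF i borel_measurable_AE[OF borel_measurable_integrable[OF i] ae'] ae'])
  then show ?thesis using m unfolding L2_def set_integrable_def set_borel_measurable_def by simp
qed

lemma L2_product_integrable: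
  assumes "L2 \<Lambda> f" "L2 \<Lambda> g"
  shows "set_integrable lebesgue (Omega \<Lambda>) (\<lambda>x. cnj (f x) * g x)"
proof (rule set_integrable_bound)
  show "set_integrable lebesgue (Omega \<Lambda>) (\<lambda>x. (cmod (f x))\<^sup>2 + (cmod (g x))\<^sup>2)"
    using assms[THEN L2_square_integrable] by (intro set_integral_add) auto
  have "(\<lambda>x. cnj (indicator (Omega \<Lambda>) x *\<^sub>R f x) * (indicator (Omega \<Lambda>) x *\<^sub>R g x)) \<in> borel_measurable lebesgue"
    by (intro borel_measurable_times L2_measurable assms
          measurable_compose[OF L2_measurable[OF assms(1)] borel_measurable_continuous_onI] continuous_intros)
  also have "(\<lambda>x. cnj (indicator (Omega \<Lambda>) x *\<^sub>R f x) * (indicator (Omega \<Lambda>) x *\<^sub>R g x)) = (\<lambda>x. indicator (Omega \<Lambda>) x *\<^sub>R (cnj (f x) * g x))"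
    by (auto simp: indicator_def)
  finally show "set_borel_measurable lebesgue (Omega \<Lambda>) (\<lambda>x. cnj (f x) * g x)"
    unfolding set_borel_measurable_def .
  show "AE x in lebesgue. x \<in> Omega \<Lambda> \<longrightarrow> norm (cnj (f x) * g x) \<le> norm ((cmod (f x))\<^sup>2 + (cmod (g x))\<^sup>2)"
  proof (intro AE_I2 impI)
    fix x
    have "0 \<le> (cmod (f x) - cmod (g x))\<^sup>2" "0 \<le> cmod (f x) * cmod (g x)" by auto
    then have "cmod (f x) * cmod (g x) \<le> (cmod (f x))\<^sup>2 + (cmod (g x))\<^sup>2" unfolding power2_diff by linarith
    then show "norm (cnj (f x) * g x) \<le> norm ((cmod (f x))\<^sup>2 + (cmod (g x))\<^sup>2)" by (simp add: norm_mult)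
  qed
qed

text \<open>Unlike \<open>halfline\<close>, this speaks of the set and not of a point in it, so that
  one argument covers both components with their endpoints.\<close>

definition is_halfline :: "real \<Rightarrow> real set \<Rightarrow> bool" where
  "is_halfline \<Lambda> S \<longleftrightarrow> S = {..-\<Lambda>} \<or> S = {\<Lambda>..}"

lemma is_halfline_simps [simp]: "is_halfline \<Lambda> {..-\<Lambda>}" "is_halfline \<Lambda> {\<Lambda>..}"
  by (auto simp: is_halfline_def)

lemma halfline_eq: "\<Lambda> > 0 \<Longrightarrow> is_halfline \<Lambda> S \<Longrightarrow> x \<in> S \<Longrightarrow> halfline \<Lambda> x = S"
  by (auto simp: is_halfline_def halfline_def)

lemma halfline_interior:
  "is_halfline \<Lambda> S \<Longrightarrow> {c..d} \<subseteq> S \<Longrightarrow> x \<in> {c<..<d} \<Longrightarrow> x \<in> interior S"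
  using interior_mono[of "{c..d}" S] by (simp add: interior_atLeastAtMost_real subset_iff)

lemma open_interval_Omega: "is_halfline \<Lambda> S \<Longrightarrow> {c..d} \<subseteq> S \<Longrightarrow> {c<..<d} \<subseteq> Omega \<Lambda>"
  by (auto simp: is_halfline_def Omega_def subset_iff) (smt (verit))+

text \<open>\<open>Omega\<close> omits the boundary points, which a closed interval in the half-line
  may contain; integrability is therefore obtained on the open interval, and the endpoints are added
  as a null set.\<close>

lemma Omega_absolutely_integrable_interval:
  fixes f :: "real \<Rightarrow> 'a :: euclidean_space"
  assumes "set_integrable lebesgue (Omega \<Lambda>) f" "is_halfline \<Lambda> S" "{c..d} \<subseteq> S"
  shows "f absolutely_integrable_on {c..d}"
proof -
  have "f absolutely_integrable_on {c<..<d}"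
    by (rule set_integrable_subset[OF assms(1)]) (use open_interval_Omega[OF assms(2,3)] in auto)
  then show ?thesis using absolutely_integrable_on_open_interval[where f=f and a=c and b=d] by simp
qed

text \<open>Constants are integrable on a bounded interval, so
  \<open>cmod (f x) \<le> (cmod (f x))\<^sup>2 + 1\<close> suffices.\<close>

lemma L2_absolutely_integrable_interval:
  assumes "L2 \<Lambda> f" "is_halfline \<Lambda> S" "{c..d} \<subseteq> S"
  shows "f absolutely_integrable_on {c..d}"
proof -
  have "f absolutely_integrable_on {c<..<d}"
  proof (rule set_integrable_bound)
    have sub: "{c<..<d} \<subseteq> Omega \<Lambda>" by (rule open_interval_Omega[OF assms(2,3)])
    have "(\<lambda>x. (cmod (f x))\<^sup>2) absolutely_integrable_on {c<..<d}"
      by (rule set_integrable_subset[OF L2_square_integrable[OF assms(1)]]) (use sub in auto)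
    moreover have "(\<lambda>x. 1 :: real) absolutely_integrable_on {c<..<d}"
      using absolutely_integrable_on_open_interval[where f="\<lambda>x. 1::real" and a=c and b=d] by (simp add: absolutely_integrable_on_const)
    ultimately show "(\<lambda>x. (cmod (f x))\<^sup>2 + 1) absolutely_integrable_on {c<..<d}"
      by (rule set_integral_add)
    have "(\<lambda>x. indicator {c<..<d} x *\<^sub>R (indicator (Omega \<Lambda>) x *\<^sub>R f x)) \<in> borel_measurable lebesgue"
      by (intro borel_measurable_scaleR[OF borel_measurable_indicator L2_measurable[OF assms(1)]]) auto
    also have "(\<lambda>x. indicator {c<..<d} x *\<^sub>R (indicator (Omega \<Lambda>) x *\<^sub>R f x)) = (\<lambda>x. indicator {c<..<d} x *\<^sub>R f x)"
      using sub by (intro ext) (auto simp: indicator_def)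
    finally show "set_borel_measurable lebesgue {c<..<d} f" unfolding set_borel_measurable_def .
    show "AE x in lebesgue. x \<in> {c<..<d} \<longrightarrow> norm (f x) \<le> norm ((cmod (f x))\<^sup>2 + 1)"
    proof (intro AE_I2 impI)
      fix x
      have "0 \<le> (cmod (f x) - 1/2)\<^sup>2" by simp
      then have "cmod (f x) \<le> (cmod (f x))\<^sup>2 + 1" by (simp add: power2_eq_square algebra_simps)
      then show "norm (f x) \<le> norm ((cmod (f x))\<^sup>2 + 1)" by simp
    qed
  qed
  then show ?thesis using absolutely_integrable_on_open_interval[where f=f and a=c and b=d] by simp
qed

text \<open>Dominated convergence turns integrals over the two components into limits of integrals
  over compact intervals, on which Green's formula is available.\<close>

lemma set_integrable_Omega_halves:
  fixes f :: "real \<Rightarrow> 'a :: euclidean_space"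
  assumes "\<Lambda> > 0" "set_integrable lebesgue (Omega \<Lambda>) f"
  shows "(\<lambda>n. integral {\<Lambda>..\<Lambda>+real n} f) \<longlonglongrightarrow> (LINT x:{\<Lambda><..}|lebesgue. f x)"
    and "(\<lambda>n. integral {-\<Lambda>-real n..-\<Lambda>} f) \<longlonglongrightarrow> (LINT x:{..<-\<Lambda>}|lebesgue. f x)"
    and "(LINT x:Omega \<Lambda>|lebesgue. f x) = (LINT x:{..<-\<Lambda>}|lebesgue. f x) + (LINT x:{\<Lambda><..}|lebesgue. f x)"
proof -
  have R: "set_integrable lebesgue {\<Lambda><..} f" and L: "set_integrable lebesgue {..<-\<Lambda>} f"
    by (rule set_integrable_subset[OF assms(2)], auto simp: Omega_def)+
  show "(LINT x:Omega \<Lambda>|lebesgue. f x) = (LINT x:{..<-\<Lambda>}|lebesgue. f x) + (LINT x:{\<Lambda><..}|lebesgue. f x)"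
    unfolding Omega_def by (rule set_integral_Un[OF _ L R]) (use assms(1) in auto)
  have lim: "(\<lambda>n. LINT x:A n|lebesgue. f x) \<longlonglongrightarrow> (LINT x:T|lebesgue. f x)"
    if A: "\<And>n. A n \<in> sets lebesgue" "\<And>n. A n \<subseteq> T" "\<And>x. x \<in> T \<Longrightarrow> \<forall>\<^sub>F n in sequentially. x \<in> A n"
      and T: "set_integrable lebesgue T f" for A :: "nat \<Rightarrow> real set" and T
    unfolding set_lebesgue_integral_def
  proof (rule integral_dominated_convergence)
    have Ai: "integrable lebesgue (\<lambda>x. indicator (A n) x *\<^sub>R f x)" for n
      using set_integrable_subset[OF T A(1,2)] unfolding set_integrable_def .
    show "(\<lambda>x. indicator T x *\<^sub>R f x) \<in> borel_measurable lebesgue" 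
      using T unfolding set_integrable_def by auto
    show "(\<lambda>x. indicator (A n) x *\<^sub>R f x) \<in> borel_measurable lebesgue" for n using Ai by auto
    show "integrable lebesgue (\<lambda>x. norm (indicator T x *\<^sub>R f x))"
      using T unfolding set_integrable_def by (rule integrable_norm)
    show "AE x in lebesgue. (\<lambda>n. indicator (A n) x *\<^sub>R f x) \<longlonglongrightarrow> indicator T x *\<^sub>R f x"
    proof (intro AE_I2 tendsto_eventually)
      fix x show "\<forall>\<^sub>F n in sequentially. indicator (A n) x *\<^sub>R f x = indicator T x *\<^sub>R f x"
      proof (cases "x \<in> T")
        case True
        from A(3)[OF this] show ?thesis by eventually_elim (use True in auto)
      next
        case False
        then have "x \<notin> A n" for n using A(2) by blast
        then show ?thesis using False by simp
      qed
    qed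
    show "AE x in lebesgue. norm (indicator (A n) x *\<^sub>R f x) \<le> norm (indicator T x *\<^sub>R f x)" for n
      using A(2)[of n] by (intro AE_I2) (auto simp: indicator_def)
  qed
  have "(\<lambda>n. LINT x:{\<Lambda><..<\<Lambda>+real n}|lebesgue. f x) \<longlonglongrightarrow> (LINT x:{\<Lambda><..}|lebesgue. f x)"
  proof (rule lim[OF _ _ _ R])
    fix x assume "x \<in> {\<Lambda><..}"
    obtain m where m: "x - \<Lambda> < real m" using reals_Archimedean2 by blast
    have "x \<in> {\<Lambda><..<\<Lambda>+real n}" if "n \<ge> m" for n
    proof -
      have "real m \<le> real n" using that by simp
      then show ?thesis using m \<open>x \<in> {\<Lambda><..}\<close> by auto
    qed
    then show "\<forall>\<^sub>F n in sequentially. x \<in> {\<Lambda><..<\<Lambda>+real n}" by (rule eventually_sequentiallyI)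
  qed auto
  moreover have "(LINT x:{\<Lambda><..<\<Lambda>+real n}|lebesgue. f x) = integral {\<Lambda>..\<Lambda>+real n} f" for n
  proof -
    have "f absolutely_integrable_on {\<Lambda><..<\<Lambda>+real n}" by (rule set_integrable_subset[OF R]) auto
    then show ?thesis by (simp add: set_lebesgue_integral_eq_integral integral_open_interval_real)
  qed
  ultimately show "(\<lambda>n. integral {\<Lambda>..\<Lambda>+real n} f) \<longlonglongrightarrow> (LINT x:{\<Lambda><..}|lebesgue. f x)" by simp
  have "(\<lambda>n. LINT x:{-\<Lambda>-real n<..<-\<Lambda>}|lebesgue. f x) \<longlonglongrightarrow> (LINT x:{..<-\<Lambda>}|lebesgue. f x)"
  proof (rule lim[OF _ _ _ L])
    fix x assume "x \<in> {..<-\<Lambda>}"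
    obtain m where m: "-\<Lambda> - x < real m" using reals_Archimedean2 by blast
    have "x \<in> {-\<Lambda>-real n<..<-\<Lambda>}" if "n \<ge> m" for n
    proof -
      have "real m \<le> real n" using that by simp
      then show ?thesis using m \<open>x \<in> {..<-\<Lambda>}\<close> by auto
    qed
    then show "\<forall>\<^sub>F n in sequentially. x \<in> {-\<Lambda>-real n<..<-\<Lambda>}" by (rule eventually_sequentiallyI)
  qed auto
  moreover have "(LINT x:{-\<Lambda>-real n<..<-\<Lambda>}|lebesgue. f x) = integral {-\<Lambda>-real n..-\<Lambda>} f" for n
  proof -
    have "f absolutely_integrable_on {-\<Lambda>-real n<..<-\<Lambda>}" by (rule set_integrable_subset[OF L]) auto
    then show ?thesis by (simp add: set_lebesgue_integral_eq_integral integral_open_interval_real)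
  qed
  ultimately show "(\<lambda>n. integral {-\<Lambda>-real n..-\<Lambda>} f) \<longlonglongrightarrow> (LINT x:{..<-\<Lambda>}|lebesgue. f x)" by simp
qed

text \<open>A unit cell contributes the difference of two consecutive terms of a convergent sequence
  of partial integrals.\<close>

lemma cell_integral_tendsto_0:
  fixes f :: "real \<Rightarrow> real"
  assumes "\<Lambda> > 0" "set_integrable lebesgue (Omega \<Lambda>) f"
  shows "(\<lambda>n. integral {\<Lambda>+real n..\<Lambda>+real n+1} f) \<longlonglongrightarrow> 0"
    and "(\<lambda>n. integral {-\<Lambda>-real (Suc n)..-\<Lambda>-real (Suc n)+1} f) \<longlonglongrightarrow> 0"
proof -
  note I = Omega_absolutely_integrable_interval[OF assms(2), THEN set_lebesgue_integral_eq_integral(1)]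
  note lim = set_integrable_Omega_halves[OF assms]
  have "(\<lambda>n. integral {\<Lambda>..\<Lambda>+real (Suc n)} f - integral {\<Lambda>..\<Lambda>+real n} f) \<longlonglongrightarrow> 
      (LINT x:{\<Lambda><..}|lebesgue. f x) - (LINT x:{\<Lambda><..}|lebesgue. f x)"
    by (intro tendsto_diff LIMSEQ_Suc lim)
  moreover have "integral {\<Lambda>..\<Lambda>+real (Suc n)} f - integral {\<Lambda>..\<Lambda>+real n} f = integral {\<Lambda>+real n..\<Lambda>+real n+1} f" for n
    using Henstock_Kurzweil_Integration.integral_combine[of \<Lambda> "\<Lambda>+real n" "\<Lambda>+real (Suc n)" f] I[of "{\<Lambda>..}" \<Lambda> "\<Lambda>+real (Suc n)"]
    by (simp add: add.commute add.left_commute)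
  ultimately show "(\<lambda>n. integral {\<Lambda>+real n..\<Lambda>+real n+1} f) \<longlonglongrightarrow> 0" by simp
  have "(\<lambda>n. integral {-\<Lambda>-real (Suc n)..-\<Lambda>} f - integral {-\<Lambda>-real n..-\<Lambda>} f) \<longlonglongrightarrow> 
      (LINT x:{..<-\<Lambda>}|lebesgue. f x) - (LINT x:{..<-\<Lambda>}|lebesgue. f x)"
    by (intro tendsto_diff LIMSEQ_Suc lim)
  moreover have "integral {-\<Lambda>-real (Suc n)..-\<Lambda>} f - integral {-\<Lambda>-real n..-\<Lambda>} f = integral {-\<Lambda>-real (Suc n)..-\<Lambda>-real (Suc n)+1} f" for n
  proof -
    have e: "-\<Lambda>-real (Suc n)+1 = -\<Lambda>-real n" by simp
    show ?thesis unfolding e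
      using Henstock_Kurzweil_Integration.integral_combine[of "-\<Lambda>-real (Suc n)" "-\<Lambda>-real n" "-\<Lambda>" f] I[of "{..-\<Lambda>}" "-\<Lambda>-real (Suc n)" "-\<Lambda>"]
      by simp
  qed
  ultimately show "(\<lambda>n. integral {-\<Lambda>-real (Suc n)..-\<Lambda>-real (Suc n)+1} f) \<longlonglongrightarrow> 0" by simp
qed

section \<open>Derivatives, decay at infinity and the boundary form\<close>

definition bdry_form :: "real \<Rightarrow> (real \<Rightarrow> complex) \<Rightarrow> (real \<Rightarrow> complex) \<Rightarrow> real \<Rightarrow> complex" where
  "bdry_form \<Lambda> \<phi> \<psi> x = cnj (\<phi> x) * d1 \<Lambda> \<psi> x - cnj (d1 \<Lambda> \<phi> x) * \<psi> x"

lemma AC2_has_d1: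
  assumes "\<Lambda> > 0" "AC2 \<Lambda> \<psi>" "is_halfline \<Lambda> S" "x \<in> S"
  shows "(\<psi> has_vector_derivative d1 \<Lambda> \<psi> x) (at x within S)"
proof -
  have "x \<in> {..-\<Lambda>} \<union> {\<Lambda>..}" using assms(3,4) by (auto simp: is_halfline_def)
  then have "\<psi> differentiable (at x within S)"
    using assms(2) halfline_eq[OF assms(1,3,4)] unfolding AC2_def by metis
  then show ?thesis unfolding d1_def halfline_eq[OF assms(1,3,4)]
    by (simp add: vector_derivative_works)
qed

lemma AC2_has_d1_at:
  assumes "\<Lambda> > 0" "AC2 \<Lambda> \<psi>" "is_halfline \<Lambda> S" "{c..d} \<subseteq> S" "x \<in> {c<..<d}"
  shows "(\<psi> has_vector_derivative d1 \<Lambda> \<psi> x) (at x)"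
proof -
  have "x \<in> S" using assms(4,5) by (auto simp: subset_iff)
  moreover have "at x within S = at x" by (rule at_within_interior[OF halfline_interior[OF assms(3,4,5)]])
  ultimately show ?thesis using AC2_has_d1[OF assms(1-3)] by metis
qed

lemma AC2_abs_cont:
  assumes "AC2 \<Lambda> \<psi>" "is_halfline \<Lambda> S" "{c..d} \<subseteq> S"
  shows "abs_cont_on {c..d} \<psi>" "abs_cont_on {c..d} (d1 \<Lambda> \<psi>)"
  using assms by (auto simp: AC2_def is_halfline_def loc_abs_cont_on_def)

text \<open>The \<open>vector_derivative\<close> in \<open>d2\<close> is a choice at every point;
  off a null set it is the true derivative, because an absolutely continuous function is
  differentiable almost everywhere.\<close>

lemma AC2_has_d2:
  assumes "AC2 \<Lambda> \<psi>" "is_halfline \<Lambda> S" "{c..d} \<subseteq> S" "c < d"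
  shows "\<exists>N. negligible N \<and> (\<forall>x\<in>{c<..<d} - N. (d1 \<Lambda> \<psi> has_vector_derivative d2 \<Lambda> \<psi> x) (at x))"
proof (rule abs_cont_on_derivative[OF AC2_abs_cont(2)[OF assms(1-3)] assms(4)])
  fix g N assume N: "negligible N" "\<And>x. x \<in> {c<..<d} - N \<Longrightarrow> (d1 \<Lambda> \<psi> has_vector_derivative g x) (at x)"
  have "(d1 \<Lambda> \<psi> has_vector_derivative d2 \<Lambda> \<psi> x) (at x)" if "x \<in> {c<..<d} - N" for x
    unfolding d2_def vector_derivative_at[OF N(2)[OF that]] by (rule N(2)[OF that])
  then show ?thesis using N(1) by blast
qed

lemma AC2_d2_integral:
  assumes "AC2 \<Lambda> \<psi>" "is_halfline \<Lambda> S" "{c..d} \<subseteq> S" "c \<le> d"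
  shows "(d2 \<Lambda> \<psi> has_integral (d1 \<Lambda> \<psi> d - d1 \<Lambda> \<psi> c)) {c..d}"
proof (cases "c < d")
  case True
  obtain N where N: "negligible N" "\<And>x. x \<in> {c<..<d} - N \<Longrightarrow> (d1 \<Lambda> \<psi> has_vector_derivative d2 \<Lambda> \<psi> x) (at x)"
    using AC2_has_d2[OF assms(1-3) True] by blast
  show ?thesis by (rule abs_cont_on_FTC(2)[OF AC2_abs_cont(2)[OF assms(1-3)] True N])
next
  case False
  then have "c = d" using assms(4) by simp
  then show ?thesis using has_integral_refl(2)[of "d2 \<Lambda> \<psi>" d] by simp
qed

lemma AC2_Green:
  assumes "\<Lambda> > 0" "AC2 \<Lambda> \<phi>" "AC2 \<Lambda> \<psi>" "is_halfline \<Lambda> S" "{c..d} \<subseteq> S" "c \<le> d"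
  shows "((\<lambda>x. cnj (\<phi> x) * d2 \<Lambda> \<psi> x - cnj (d2 \<Lambda> \<phi> x) * \<psi> x) has_integral
          bdry_form \<Lambda> \<phi> \<psi> d - bdry_form \<Lambda> \<phi> \<psi> c) {c..d}"
proof (cases "c < d")
  case True
  obtain N where N: "negligible N" "\<And>x. x \<in> {c<..<d} - N \<Longrightarrow> (d1 \<Lambda> \<psi> has_vector_derivative d2 \<Lambda> \<psi> x) (at x)"
    using AC2_has_d2[OF assms(3-5) True] by blast
  obtain M where M: "negligible M" "\<And>x. x \<in> {c<..<d} - M \<Longrightarrow> (d1 \<Lambda> \<phi> has_vector_derivative d2 \<Lambda> \<phi> x) (at x)"
    using AC2_has_d2[OF assms(2) assms(4,5) True] by blast
  note cnj_deriv = bounded_linear.has_vector_derivative[OF bounded_linear_cnj]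
  show ?thesis unfolding bdry_form_def
  proof (rule Green_interval[OF True, of "N \<union> M" "\<lambda>x. cnj (\<phi> x)" "\<lambda>x. cnj (d1 \<Lambda> \<phi> x)"])
    show "negligible (N \<union> M)" using N(1) M(1) by simp
    show "abs_cont_on {c..d} (\<lambda>x. cnj (\<phi> x))" "abs_cont_on {c..d} (\<lambda>x. cnj (d1 \<Lambda> \<phi> x))"
      "abs_cont_on {c..d} \<psi>" "abs_cont_on {c..d} (d1 \<Lambda> \<psi>)"
      using AC2_abs_cont[OF assms(2,4,5)] AC2_abs_cont[OF assms(3-5)] by (auto intro: abs_cont_on_cnj)
    fix x assume x: "x \<in> {c<..<d} - (N \<union> M)"
    show "((\<lambda>x. cnj (\<phi> x)) has_vector_derivative cnj (d1 \<Lambda> \<phi> x)) (at x)"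
      by (rule cnj_deriv[OF AC2_has_d1_at[OF assms(1,2,4,5)]]) (use x in auto)
    show "((\<lambda>x. cnj (d1 \<Lambda> \<phi> x)) has_vector_derivative cnj (d2 \<Lambda> \<phi> x)) (at x)"
      by (rule cnj_deriv[OF M(2)]) (use x in auto)
    show "(\<psi> has_vector_derivative d1 \<Lambda> \<psi> x) (at x)"
      by (rule AC2_has_d1_at[OF assms(1,3-5)]) (use x in auto)
    show "(d1 \<Lambda> \<psi> has_vector_derivative d2 \<Lambda> \<psi> x) (at x)"
      by (rule N(2)) (use x in auto)
  qed
next
  case False
  then have "c = d" using assms(6) by simp
  then show ?thesis using has_integral_refl(2)[of "\<lambda>x. cnj (\<phi> x) * d2 \<Lambda> \<psi> x - cnj (d2 \<Lambda> \<phi> x) * \<psi> x" d] by simp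
qed

lemma D_H0starD: "\<psi> \<in> D_H0star \<Lambda> \<Longrightarrow> L2 \<Lambda> \<psi>" "\<psi> \<in> D_H0star \<Lambda> \<Longrightarrow> AC2 \<Lambda> \<psi>" "\<psi> \<in> D_H0star \<Lambda> \<Longrightarrow> L2 \<Lambda> (d2 \<Lambda> \<psi>)"
  by (auto simp: D_H0star_def AC2_def)

text \<open>The endpoint bound involves first powers on a unit cell, whereas the squares are what is
  known to be integrable over \<open>Omega\<close>. The inequality
  \<open>t \<le> \<epsilon> + t\<^sup>2 / \<epsilon>\<close> converts one into the other; its
  constant part adds up to \<open>(1 + 6) * \<epsilon>\<close>.\<close>

lemma D_H0star_cell_bound:
  assumes "\<Lambda> > 0" and \<psi>: "\<psi> \<in> D_H0star \<Lambda>" and S: "is_halfline \<Lambda> S" "{c..c+1} \<subseteq> S" and "\<epsilon> > 0"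
  shows "cmod (\<psi> c) \<le> 7 * \<epsilon> + integral {c..c+1} (\<lambda>x. (cmod (d2 \<Lambda> \<psi> x))\<^sup>2 + 6 * (cmod (\<psi> x))\<^sup>2) / \<epsilon>"
    and "cmod (d1 \<Lambda> \<psi> c) \<le> 7 * \<epsilon> + integral {c..c+1} (\<lambda>x. (cmod (d2 \<Lambda> \<psi> x))\<^sup>2 + 6 * (cmod (\<psi> x))\<^sup>2) / \<epsilon>"
proof -
  let ?r = "\<lambda>x. (cmod (d2 \<Lambda> \<psi> x))\<^sup>2 + 6 * (cmod (\<psi> x))\<^sup>2"
  let ?s = "\<lambda>x. cmod (d2 \<Lambda> \<psi> x) + 6 * cmod (\<psi> x)"
  obtain N where N: "negligible N" "\<And>x. x \<in> {c<..<c+1} - N \<Longrightarrow> (d1 \<Lambda> \<psi> has_vector_derivative d2 \<Lambda> \<psi> x) (at x)"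
    using AC2_has_d2[OF D_H0starD(2)[OF \<psi>] S] by auto
  have ai: "\<psi> absolutely_integrable_on {c..c+1}" "d2 \<Lambda> \<psi> absolutely_integrable_on {c..c+1}"
    using L2_absolutely_integrable_interval[OF D_H0starD(1)[OF \<psi>] S] L2_absolutely_integrable_interval[OF D_H0starD(3)[OF \<psi>] S] by auto
  have si: "?s integrable_on {c..c+1}"
    using ai unfolding absolutely_integrable_on_def
    by (intro integrable_add integrable_on_mult_right) auto
  have rs: "set_integrable lebesgue (Omega \<Lambda>) ?r"
    using L2_square_integrable[OF D_H0starD(1)[OF \<psi>]] L2_square_integrable[OF D_H0starD(3)[OF \<psi>]]
    by (intro set_integral_add) auto
  have ri: "?r integrable_on {c..c+1}"
    using Omega_absolutely_integrable_interval[OF rs S] by (simp add: set_lebesgue_integral_eq_integral)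
  have rie: "(\<lambda>x. 7 * \<epsilon> + ?r x / \<epsilon>) integrable_on {c..c+1}"
    by (rule integrable_add[OF integrable_const_ivl integrable_on_divide[OF ri]])
  have "integral {c..c+1} ?s \<le> integral {c..c+1} (\<lambda>x. 7 * \<epsilon> + ?r x / \<epsilon>)"
  proof (rule integral_le[OF si rie])
    fix x
    have le: "t \<le> \<epsilon> + t\<^sup>2 / \<epsilon>" if "t \<ge> 0" for t :: real
    proof -
      have "t * \<epsilon> = \<epsilon> * \<epsilon> / 4 + t\<^sup>2 - (t - \<epsilon> / 2)\<^sup>2" by (simp add: power2_eq_square algebra_simps)
      also have "\<dots> \<le> \<epsilon> * \<epsilon> + t\<^sup>2" using zero_le_power2[of "t - \<epsilon> / 2"] zero_le_square[of \<epsilon>] by linarith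
      finally have "t \<le> (\<epsilon> * \<epsilon> + t\<^sup>2) / \<epsilon>" using \<open>\<epsilon> > 0\<close> by (simp add: pos_le_divide_eq)
      then show ?thesis using \<open>\<epsilon> > 0\<close> by (simp add: add_divide_distrib)
    qed
    show "?s x \<le> 7 * \<epsilon> + ?r x / \<epsilon>"
      using le[of "cmod (\<psi> x)"] le[of "cmod (d2 \<Lambda> \<psi> x)"] by (simp add: add_divide_distrib)
  qed
  also have "\<dots> = 7 * \<epsilon> + integral {c..c+1} ?r / \<epsilon>"
    using ri by (subst Henstock_Kurzweil_Integration.integral_add) (auto intro: integrable_on_divide)
  finally have le: "integral {c..c+1} ?s \<le> 7 * \<epsilon> + integral {c..c+1} ?r / \<epsilon>" .
  have D: "(\<psi> has_vector_derivative d1 \<Lambda> \<psi> x) (at x)" if "x \<in> {c<..<c+1} - N" for x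
    by (rule AC2_has_d1_at[OF \<open>\<Lambda> > 0\<close> D_H0starD(2)[OF \<psi>] S]) (use that in auto)
  note eb = endpoint_bound[OF N(1) AC2_abs_cont[OF D_H0starD(2)[OF \<psi>] S] D N(2) si]
  show "cmod (\<psi> c) \<le> 7 * \<epsilon> + integral {c..c+1} ?r / \<epsilon>"
    by (rule order_trans[OF eb(1) le])
  show "cmod (d1 \<Lambda> \<psi> c) \<le> 7 * \<epsilon> + integral {c..c+1} ?r / \<epsilon>"
    by (rule order_trans[OF eb(2) le])
qed

text \<open>First \<open>\<epsilon>\<close> is fixed at \<open>e / 14\<close>, so that
  \<open>7 * \<epsilon>\<close> is half of \<open>e\<close>; only then is \<open>n\<close> taken
  large enough for the other term.\<close>

lemma tendsto_0_if_bounds: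
  fixes z :: "nat \<Rightarrow> complex"
  assumes le: "\<And>n \<epsilon>. \<epsilon> > 0 \<Longrightarrow> cmod (z n) \<le> 7 * \<epsilon> + \<rho> n / \<epsilon>" and \<rho>: "\<rho> \<longlonglongrightarrow> 0"
  shows "z \<longlonglongrightarrow> 0"
proof (rule tendstoI)
  fix e :: real assume "e > 0"
  define \<epsilon> where "\<epsilon> = e / 14"
  have "\<epsilon> > 0" using \<open>e > 0\<close> by (simp add: \<epsilon>_def)
  then have "\<forall>\<^sub>F n in sequentially. \<rho> n < \<epsilon> * (e / 2)"
    using \<open>e > 0\<close> by (intro order_tendstoD(2)[OF \<rho>]) auto
  then show "\<forall>\<^sub>F n in sequentially. dist (z n) 0 < e"
  proof eventually_elim
    case (elim n)
    then have "\<rho> n / \<epsilon> < e / 2" using \<open>\<epsilon> > 0\<close> by (simp add: field_simps)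
    moreover have "7 * \<epsilon> = e / 2" by (simp add: \<epsilon>_def)
    ultimately have "cmod (z n) < e" using le[OF \<open>\<epsilon> > 0\<close>, of n] by linarith
    then show ?case by simp
  qed
qed

text \<open>The integrals of the two squares over successive unit cells tend to 0, and each cell
  controls value and derivative at its left endpoint.\<close>

lemma D_H0star_decay:
  assumes "\<Lambda> > 0" and \<psi>: "\<psi> \<in> D_H0star \<Lambda>"
  shows "(\<lambda>n. \<psi> (\<Lambda> + real n)) \<longlonglongrightarrow> 0" "(\<lambda>n. d1 \<Lambda> \<psi> (\<Lambda> + real n)) \<longlonglongrightarrow> 0"
    "(\<lambda>n. \<psi> (-\<Lambda> - real n)) \<longlonglongrightarrow> 0" "(\<lambda>n. d1 \<Lambda> \<psi> (-\<Lambda> - real n)) \<longlonglongrightarrow> 0"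
proof -
  let ?r = "\<lambda>x. (cmod (d2 \<Lambda> \<psi> x))\<^sup>2 + 6 * (cmod (\<psi> x))\<^sup>2"
  have rs: "set_integrable lebesgue (Omega \<Lambda>) ?r"
    using L2_square_integrable[OF D_H0starD(1)[OF \<psi>]] L2_square_integrable[OF D_H0starD(3)[OF \<psi>]]
    by (intro set_integral_add) auto
  note lim = cell_integral_tendsto_0[OF \<open>\<Lambda> > 0\<close> rs]
  have R: "{\<Lambda> + real n..\<Lambda> + real n + 1} \<subseteq> {\<Lambda>..}" for n by auto
  have L: "{-\<Lambda> - real (Suc n)..-\<Lambda> - real (Suc n) + 1} \<subseteq> {..-\<Lambda>}" for n by auto
  show "(\<lambda>n. \<psi> (\<Lambda> + real n)) \<longlonglongrightarrow> 0"
    by (rule tendsto_0_if_bounds[OF D_H0star_cell_bound(1)[OF assms _ R] lim(1)]) auto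
  show "(\<lambda>n. d1 \<Lambda> \<psi> (\<Lambda> + real n)) \<longlonglongrightarrow> 0"
    by (rule tendsto_0_if_bounds[OF D_H0star_cell_bound(2)[OF assms _ R] lim(1)]) auto
  \<comment> \<open>A cell extends to the right of its control point and would leave the half-line
    at \<open>-\<Lambda>\<close>; the sequence is therefore started one unit further out.\<close>
  show "(\<lambda>n. \<psi> (-\<Lambda> - real n)) \<longlonglongrightarrow> 0"
    by (rule LIMSEQ_imp_Suc, rule tendsto_0_if_bounds[OF D_H0star_cell_bound(1)[OF assms _ L] lim(2)]) auto
  show "(\<lambda>n. d1 \<Lambda> \<psi> (-\<Lambda> - real n)) \<longlonglongrightarrow> 0"
    by (rule LIMSEQ_imp_Suc, rule tendsto_0_if_bounds[OF D_H0star_cell_bound(2)[OF assms _ L] lim(2)]) auto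
qed

text \<open>In Green's formula on growing intervals the far ends disappear by decay. The remaining
  end is the lower limit on the right and the upper limit on the left, whence the opposite signs;
  the minus sign in \<open>Hop\<close> reverses both.\<close>

lemma ip_diff_eq_bdry_form:
  assumes "\<Lambda> > 0" and \<phi>: "\<phi> \<in> D_H0star \<Lambda>" and \<psi>: "\<psi> \<in> D_H0star \<Lambda>"
  shows "ip \<Lambda> \<phi> (Hop \<Lambda> \<psi>) - ip \<Lambda> (Hop \<Lambda> \<phi>) \<psi> = bdry_form \<Lambda> \<phi> \<psi> \<Lambda> - bdry_form \<Lambda> \<phi> \<psi> (-\<Lambda>)"
proof -
  let ?h = "\<lambda>x. cnj (\<phi> x) * d2 \<Lambda> \<psi> x - cnj (d2 \<Lambda> \<phi> x) * \<psi> x"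
  have i1: "set_integrable lebesgue (Omega \<Lambda>) (\<lambda>x. cnj (\<phi> x) * d2 \<Lambda> \<psi> x)"
    by (rule L2_product_integrable[OF D_H0starD(1)[OF \<phi>] D_H0starD(3)[OF \<psi>]])
  have i2: "set_integrable lebesgue (Omega \<Lambda>) (\<lambda>x. cnj (d2 \<Lambda> \<phi> x) * \<psi> x)"
    by (rule L2_product_integrable[OF D_H0starD(3)[OF \<phi>] D_H0starD(1)[OF \<psi>]])
  have hi: "set_integrable lebesgue (Omega \<Lambda>) ?h" by (rule set_integral_diff(1)[OF i1 i2])
  have ipd: "ip \<Lambda> \<phi> (Hop \<Lambda> \<psi>) - ip \<Lambda> (Hop \<Lambda> \<phi>) \<psi> = - (LINT x:Omega \<Lambda>|lebesgue. ?h x)"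
    unfolding set_integral_diff(2)[OF i1 i2] ip_def Hop_def
    by (simp add: set_integral_uminus[OF i1] set_integral_uminus[OF i2])
  note lim = set_integrable_Omega_halves[OF \<open>\<Lambda> > 0\<close> hi]
  note D = D_H0star_decay[OF \<open>\<Lambda> > 0\<close>]
  have c0: "(\<lambda>n. cnj (z n)) \<longlonglongrightarrow> 0" if "z \<longlonglongrightarrow> 0" for z
    using tendsto_cnj[OF that] by simp
  have WR: "(\<lambda>n. bdry_form \<Lambda> \<phi> \<psi> (\<Lambda> + real n)) \<longlonglongrightarrow> 0"
    unfolding bdry_form_def using tendsto_diff[OF tendsto_mult[OF c0[OF D(1)[OF \<phi>]] D(2)[OF \<psi>]] tendsto_mult[OF c0[OF D(2)[OF \<phi>]] D(1)[OF \<psi>]]] by simp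
  have WL: "(\<lambda>n. bdry_form \<Lambda> \<phi> \<psi> (-\<Lambda> - real n)) \<longlonglongrightarrow> 0"
    unfolding bdry_form_def using tendsto_diff[OF tendsto_mult[OF c0[OF D(3)[OF \<phi>]] D(4)[OF \<psi>]] tendsto_mult[OF c0[OF D(4)[OF \<phi>]] D(3)[OF \<psi>]]] by simp
  note G = AC2_Green[OF \<open>\<Lambda> > 0\<close> D_H0starD(2)[OF \<phi>] D_H0starD(2)[OF \<psi>], THEN integral_unique]
  have "(\<lambda>n. bdry_form \<Lambda> \<phi> \<psi> (\<Lambda> + real n) - bdry_form \<Lambda> \<phi> \<psi> \<Lambda>) \<longlonglongrightarrow> (LINT x:{\<Lambda><..}|lebesgue. ?h x)"
    using lim(1) G[of "{\<Lambda>..}" \<Lambda> "\<Lambda> + real _"] by simp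
  moreover have "(\<lambda>n. bdry_form \<Lambda> \<phi> \<psi> (\<Lambda> + real n) - bdry_form \<Lambda> \<phi> \<psi> \<Lambda>) \<longlonglongrightarrow> 0 - bdry_form \<Lambda> \<phi> \<psi> \<Lambda>"
    by (intro tendsto_diff WR tendsto_const)
  ultimately have R: "(LINT x:{\<Lambda><..}|lebesgue. ?h x) = - bdry_form \<Lambda> \<phi> \<psi> \<Lambda>" using LIMSEQ_unique by fastforce
  have "(\<lambda>n. bdry_form \<Lambda> \<phi> \<psi> (-\<Lambda>) - bdry_form \<Lambda> \<phi> \<psi> (-\<Lambda> - real n)) \<longlonglongrightarrow> (LINT x:{..<-\<Lambda>}|lebesgue. ?h x)"
    using lim(2) G[of "{..-\<Lambda>}" "-\<Lambda> - real _" "-\<Lambda>"] by simp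
  moreover have "(\<lambda>n. bdry_form \<Lambda> \<phi> \<psi> (-\<Lambda>) - bdry_form \<Lambda> \<phi> \<psi> (-\<Lambda> - real n)) \<longlonglongrightarrow> bdry_form \<Lambda> \<phi> \<psi> (-\<Lambda>) - 0"
    by (intro tendsto_diff WL tendsto_const)
  ultimately have L: "(LINT x:{..<-\<Lambda>}|lebesgue. ?h x) = bdry_form \<Lambda> \<phi> \<psi> (-\<Lambda>)" using LIMSEQ_unique by fastforce
  show ?thesis unfolding ipd lim(3) R L by simp
qed

text \<open>Needed for uniqueness of derivatives within a half-line, in particular of the one-sided
  ones at \<open>\<Lambda>\<close> and \<open>-\<Lambda>\<close>.\<close>

lemma halfline_limit: "is_halfline \<Lambda> S \<Longrightarrow> x \<in> S \<Longrightarrow> at x within S \<noteq> bot"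
proof -
  assume S: "is_halfline \<Lambda> S" "x \<in> S"
  then have "S = {..-\<Lambda>} \<or> S = {\<Lambda>..}" by (simp add: is_halfline_def)
  then have "{x-1..x} \<subseteq> S \<or> {x..x+1} \<subseteq> S" using S(2) by auto
  moreover have "at x within {x-1..x} \<noteq> bot" "at x within {x..x+1} \<noteq> bot"
    by (simp_all add: trivial_limit_within islimpt_Icc)
  ultimately show ?thesis using at_le[of _ S x] by (metis bot.extremum_uniqueI)
qed

text \<open>Countably many bounded intervals cover \<open>Omega\<close>, and their exceptional null
  sets have a null union.\<close>

lemma Omega_AE_halflines:
  assumes "\<Lambda> > 0"
    and "\<And>S c d. is_halfline \<Lambda> S \<Longrightarrow> {c..d} \<subseteq> S \<Longrightarrow> c < d \<Longrightarrow> \<exists>N. negligible N \<and> (\<forall>x\<in>{c<..<d} - N. P x)"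
  shows "AE x in lebesgue. x \<in> Omega \<Lambda> \<longrightarrow> P x"
proof -
  have "\<exists>N. negligible N \<and> (\<forall>x\<in>{\<Lambda><..<\<Lambda>+real (Suc n)} - N. P x)" for n
    by (rule assms(2)[of "{\<Lambda>..}"]) auto
  then obtain N where N: "\<And>n. negligible (N n)" "\<And>n x. x\<in>{\<Lambda><..<\<Lambda>+real (Suc n)} - N n \<Longrightarrow> P x" by metis
  have "\<exists>N. negligible N \<and> (\<forall>x\<in>{-\<Lambda>-real (Suc n)<..<-\<Lambda>} - N. P x)" for n
    by (rule assms(2)[of "{..-\<Lambda>}"]) auto
  then obtain M where M: "\<And>n. negligible (M n)" "\<And>n x. x\<in>{-\<Lambda>-real (Suc n)<..<-\<Lambda>} - M n \<Longrightarrow> P x" by metis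
  have neg: "negligible ((\<Union>n. N n) \<union> (\<Union>n. M n))" using N(1) M(1) by (intro negligible_Un negligible_Union_nat)
  show ?thesis
  proof (rule AE_I'[of "(\<Union>n. N n) \<union> (\<Union>n. M n)"])
    show "(\<Union>n. N n) \<union> (\<Union>n. M n) \<in> null_sets lebesgue" using neg by (simp add: negligible_iff_null_sets)
    have "P x" if x: "x \<in> Omega \<Lambda>" "x \<notin> (\<Union>n. N n) \<union> (\<Union>n. M n)" for x
    proof -
      obtain n where n: "\<bar>x\<bar> < real n" using reals_Archimedean2 by blast
      from x(1) consider "x > \<Lambda>" | "x < - \<Lambda>" by (auto simp: Omega_def)
      then show ?thesis
      proof cases
        case 1
        then show ?thesis using N(2)[of x n] x(2) n \<open>\<Lambda> > 0\<close> by auto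
      next
        case 2
        then show ?thesis using M(2)[of x n] x(2) n \<open>\<Lambda> > 0\<close> by auto
      qed
    qed
    then show "{x \<in> space lebesgue. \<not> (x \<in> Omega \<Lambda> \<longrightarrow> P x)} \<subseteq> (\<Union>n. N n) \<union> (\<Union>n. M n)" by blast
  qed
qed

text \<open>Membership test for the functions constructed below: it asks for a derivative
  \<open>p\<close> and for a density \<open>q\<close> of \<open>p\<close>, the latter given by its
  integrals. Absolute continuity of \<open>p\<close> then follows from \<open>q\<close>, and
  Lebesgue differentiation identifies \<open>d2\<close> with \<open>q\<close> almost
  everywhere.\<close>

lemma D_H0starI:
  assumes \<Lambda>: "\<Lambda> > 0" and \<psi>: "L2 \<Lambda> \<psi>" and q: "L2 \<Lambda> q"
    and p: "\<And>S x. is_halfline \<Lambda> S \<Longrightarrow> x \<in> S \<Longrightarrow> (\<psi> has_vector_derivative p x) (at x within S)"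
    and pq: "\<And>S c d. is_halfline \<Lambda> S \<Longrightarrow> {c..d} \<subseteq> S \<Longrightarrow> c \<le> d \<Longrightarrow> (q has_integral (p d - p c)) {c..d}"
  shows "\<psi> \<in> D_H0star \<Lambda>" and "\<And>S x. is_halfline \<Lambda> S \<Longrightarrow> x \<in> S \<Longrightarrow> d1 \<Lambda> \<psi> x = p x" and "aeq \<Lambda> (d2 \<Lambda> \<psi>) q"
proof -
  show d1: "d1 \<Lambda> \<psi> x = p x" if "is_halfline \<Lambda> S" "x \<in> S" for S x
    unfolding d1_def halfline_eq[OF \<Lambda> that] by (rule vector_derivative_within[OF halfline_limit[OF that] p[OF that]])
  have p_ac: "abs_cont_on {c..d} p" if "is_halfline \<Lambda> S" "{c..d} \<subseteq> S" for S c d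
  proof (rule abs_cont_on_if_integral)
    show "q absolutely_integrable_on {c..d}" by (rule L2_absolutely_integrable_interval[OF q that])
    show "(q has_integral p y - p x) {x..y}" if "c \<le> x" "x \<le> y" "y \<le> d" for x y
      using \<open>{c..d} \<subseteq> S\<close> that by (intro pq[OF \<open>is_halfline \<Lambda> S\<close>]) auto
  qed
  have d1_ac: "abs_cont_on {c..d} (d1 \<Lambda> \<psi>)" if "is_halfline \<Lambda> S" "{c..d} \<subseteq> S" for S c d
    by (rule abs_cont_on_cong[OF _ p_ac[OF that]]) (use d1[OF that(1)] that(2) in auto)
  have \<psi>_ac: "abs_cont_on {c..d} \<psi>" if "is_halfline \<Lambda> S" "{c..d} \<subseteq> S" for S c d
  proof (rule abs_cont_on_if_continuous_derivative)
    show "(\<psi> has_vector_derivative p x) (at x within {c..d})" if "x \<in> {c..d}" for x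
      using that \<open>{c..d} \<subseteq> S\<close> by (intro has_vector_derivative_within_subset[OF p[OF \<open>is_halfline \<Lambda> S\<close>]]) auto
    show "continuous_on {c..d} p" by (rule abs_cont_on_imp_continuous_on[OF p_ac[OF that]])
  qed
  have "AE x in lebesgue. x \<in> Omega \<Lambda> \<longrightarrow> d2 \<Lambda> \<psi> x = q x"
  proof (rule Omega_AE_halflines[OF \<Lambda>])
    fix S c d assume S: "is_halfline \<Lambda> S" "{c..d} \<subseteq> S" "c < d"
    have "\<exists>N. negligible N \<and> (\<forall>x\<in>{c<..<d} - N. (d1 \<Lambda> \<psi> has_vector_derivative q x) (at x))"
    proof (rule indefinite_integral_has_vector_derivative)
      show "q integrable_on {c..d}" using pq[OF S(1,2)] S(3) by (auto simp: has_integral_iff)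
      show "d1 \<Lambda> \<psi> x = p c + integral {c..x} q" if "x \<in> {c..d}" for x
      proof -
        have "(q has_integral (p x - p c)) {c..x}" using that S(2) by (intro pq[OF S(1)]) auto
        moreover have "x \<in> S" using that S(2) by auto
        ultimately show ?thesis using d1[OF S(1)] by (simp add: integral_unique)
      qed
    qed
    then show "\<exists>N. negligible N \<and> (\<forall>x\<in>{c<..<d} - N. d2 \<Lambda> \<psi> x = q x)"
      unfolding d2_def using vector_derivative_at by blast
  qed
  then show ae: "aeq \<Lambda> (d2 \<Lambda> \<psi>) q" unfolding aeq_def .
  have "aeq \<Lambda> q (d2 \<Lambda> \<psi>)" using ae unfolding aeq_def by eventually_elim auto
  then have "L2 \<Lambda> (d2 \<Lambda> \<psi>)" by (rule L2_cong_AE[OF q])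
  moreover have "\<psi> differentiable (at x within halfline \<Lambda> x)" if "x \<in> {..-\<Lambda>} \<union> {\<Lambda>..}" for x
  proof -
    define S where "S = (if x \<ge> \<Lambda> then {\<Lambda>..} else {..-\<Lambda>})"
    have S: "is_halfline \<Lambda> S" "x \<in> S" using that by (auto simp: S_def)
    show ?thesis unfolding halfline_eq[OF \<Lambda> S] using p[OF S] by (rule differentiableI_vector)
  qed
  moreover have "loc_abs_cont_on S \<psi> \<and> loc_abs_cont_on S (d1 \<Lambda> \<psi>)" if "is_halfline \<Lambda> S" for S
    using \<psi>_ac[OF that] d1_ac[OF that] by (simp add: loc_abs_cont_on_def)
  ultimately have "AC2 \<Lambda> \<psi>"
    unfolding AC2_def by simp
  then show "\<psi> \<in> D_H0star \<Lambda>" using \<psi> by (simp add: D_H0star_def)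
qed

lemma D_H0star_linear:
  assumes \<Lambda>: "\<Lambda> > 0" and \<psi>: "\<psi> \<in> D_H0star \<Lambda>" and \<phi>: "\<phi> \<in> D_H0star \<Lambda>"
  shows "(\<lambda>x. a * \<psi> x + b * \<phi> x) \<in> D_H0star \<Lambda>"
    and "\<And>S x. is_halfline \<Lambda> S \<Longrightarrow> x \<in> S \<Longrightarrow> d1 \<Lambda> (\<lambda>x. a * \<psi> x + b * \<phi> x) x = a * d1 \<Lambda> \<psi> x + b * d1 \<Lambda> \<phi> x"
proof -
  let ?f = "\<lambda>x. a * \<psi> x + b * \<phi> x" and ?p = "\<lambda>x. a * d1 \<Lambda> \<psi> x + b * d1 \<Lambda> \<phi> x" and ?q = "\<lambda>x. a * d2 \<Lambda> \<psi> x + b * d2 \<Lambda> \<phi> x"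
  have f: "L2 \<Lambda> ?f" by (intro L2_add L2_cmult D_H0starD \<psi> \<phi>)
  have q: "L2 \<Lambda> ?q" by (intro L2_add L2_cmult D_H0starD \<psi> \<phi>)
  have p: "(?f has_vector_derivative ?p x) (at x within S)" if "is_halfline \<Lambda> S" "x \<in> S" for S x
    using AC2_has_d1[OF \<Lambda> D_H0starD(2)[OF \<psi>] that] AC2_has_d1[OF \<Lambda> D_H0starD(2)[OF \<phi>] that]
    by (auto intro!: derivative_eq_intros)
  have pq: "(?q has_integral (?p d - ?p c)) {c..d}" if "is_halfline \<Lambda> S" "{c..d} \<subseteq> S" "c \<le> d" for S c d
  proof -
    have "(?q has_integral (a * (d1 \<Lambda> \<psi> d - d1 \<Lambda> \<psi> c) + b * (d1 \<Lambda> \<phi> d - d1 \<Lambda> \<phi> c))) {c..d}"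
      by (intro has_integral_add has_integral_mult_right AC2_d2_integral[OF D_H0starD(2)[OF \<psi>] that] AC2_d2_integral[OF D_H0starD(2)[OF \<phi>] that])
    then show ?thesis by (simp add: algebra_simps)
  qed
  note C = D_H0starI[OF \<Lambda> f q p pq]
  show "?f \<in> D_H0star \<Lambda>" by (rule C(1))
  show "d1 \<Lambda> ?f x = ?p x" if "is_halfline \<Lambda> S" "x \<in> S" for S x by (rule C(2)) (assumption | rule that)+
qed

section \<open>Density of the minimal domain\<close>

lemma L2_bounded_support:
  assumes int: "\<And>a b. f integrable_on {a..b}" and M: "\<And>x. cmod (f x) \<le> M"
    and supp: "\<And>x. \<bar>x\<bar> \<ge> R \<Longrightarrow> f x = 0"
  shows "f \<in> borel_measurable lebesgue" "L2 \<Lambda> f"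
proof -
  have "f integrable_on UNIV" by (rule integrable_on_superset[OF int[of "-\<bar>R\<bar>" "\<bar>R\<bar>"]]) (auto intro!: supp)
  then show m: "f \<in> borel_measurable lebesgue" using integrable_imp_measurable[of f UNIV] by simp
  show "L2 \<Lambda> f"
  proof (rule L2I[where g = "\<lambda>x. M\<^sup>2 * indicator {-\<bar>R\<bar>..\<bar>R\<bar>} x"])
    show "set_borel_measurable lebesgue (Omega \<Lambda>) f" unfolding set_borel_measurable_def
      by (rule borel_measurable_scaleR[OF borel_measurable_indicator m]) auto
    have "integrable lebesgue (indicator {-\<bar>R\<bar>..\<bar>R\<bar>} :: real \<Rightarrow> real)" by (rule integrable_real_indicator) auto
    then show "set_integrable lebesgue (Omega \<Lambda>) (\<lambda>x. M\<^sup>2 * indicator {-\<bar>R\<bar>..\<bar>R\<bar>} x)"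
      unfolding set_integrable_def by (intro integrable_mult_indicator integrable_mult_right) auto
    show "(cmod (f x))\<^sup>2 \<le> M\<^sup>2 * indicator {-\<bar>R\<bar>..\<bar>R\<bar>} x" for x
    proof (cases "x \<in> {-\<bar>R\<bar>..\<bar>R\<bar>}")
      case True
      then show ?thesis using M[of x] by (auto intro!: power_mono)
    next
      case False
      then show ?thesis using supp[of x] by auto
    qed
  qed
qed

text \<open>The square of \<open>l2norm\<close>. An additive bound with factor 2 takes the place of
  the triangle inequality, which is enough for approximation.\<close>

definition sqnorm :: "real \<Rightarrow> (real \<Rightarrow> complex) \<Rightarrow> real" where
  "sqnorm \<Lambda> f = (LINT x:Omega \<Lambda>|lebesgue. (cmod (f x))\<^sup>2)"

lemma sqnorm_add_le:
  assumes "L2 \<Lambda> f" "L2 \<Lambda> g"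
  shows "sqnorm \<Lambda> (\<lambda>x. f x + g x) \<le> 2 * sqnorm \<Lambda> f + 2 * sqnorm \<Lambda> g"
proof -
  have i: "set_integrable lebesgue (Omega \<Lambda>) (\<lambda>x. 2 * (cmod (f x))\<^sup>2)" "set_integrable lebesgue (Omega \<Lambda>) (\<lambda>x. 2 * (cmod (g x))\<^sup>2)"
    using assms[THEN L2_square_integrable] by auto
  have "sqnorm \<Lambda> (\<lambda>x. f x + g x) \<le> (LINT x:Omega \<Lambda>|lebesgue. 2 * (cmod (f x))\<^sup>2 + 2 * (cmod (g x))\<^sup>2)"
    unfolding sqnorm_def
  proof (rule set_integral_mono)
    show "set_integrable lebesgue (Omega \<Lambda>) (\<lambda>x. (cmod (f x + g x))\<^sup>2)" by (rule L2_square_integrable[OF L2_add[OF assms]])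
    show "set_integrable lebesgue (Omega \<Lambda>) (\<lambda>x. 2 * (cmod (f x))\<^sup>2 + 2 * (cmod (g x))\<^sup>2)"
      by (rule set_integral_add(1)[OF i])
    show "(cmod (f x + g x))\<^sup>2 \<le> 2 * (cmod (f x))\<^sup>2 + 2 * (cmod (g x))\<^sup>2" for x
    proof -
      have "(cmod (f x + g x))\<^sup>2 \<le> (cmod (f x) + cmod (g x))\<^sup>2" by (intro power_mono norm_triangle_ineq) auto
      moreover have "0 \<le> (cmod (f x) - cmod (g x))\<^sup>2" by simp
      ultimately show ?thesis by (simp add: power2_eq_square algebra_simps)
    qed
  qed
  also have "\<dots> = 2 * sqnorm \<Lambda> f + 2 * sqnorm \<Lambda> g"
    unfolding set_integral_add(2)[OF i] by (simp add: sqnorm_def)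
  finally show ?thesis .
qed

text \<open>Steklov means: averaging over \<open>{x..x+h}\<close> raises regularity by one degree,
  with the difference quotient \<open>dquot h u\<close> as derivative.\<close>

definition avg :: "real \<Rightarrow> (real \<Rightarrow> complex) \<Rightarrow> real \<Rightarrow> complex" where
  "avg h u x = integral {x..x+h} u /\<^sub>R h"

definition dquot :: "real \<Rightarrow> (real \<Rightarrow> complex) \<Rightarrow> real \<Rightarrow> complex" where
  "dquot h u x = (u (x + h) - u x) /\<^sub>R h"

lemma integral_interval_diff:
  fixes u :: "real \<Rightarrow> complex"
  assumes int: "\<And>a b. u integrable_on {a..b}" and "c \<le> x" "x \<le> y"
  shows "integral {x..y} u = integral {c..y} u - integral {c..x} u"
  using Henstock_Kurzweil_Integration.integral_combine[OF assms(2,3) int] by (simp add: algebra_simps)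

lemma has_integral_dquot:
  assumes int: "\<And>c d. c \<le> d \<Longrightarrow> (g has_integral (w d - w c)) {c..d}" and "c \<le> d"
  shows "(dquot h g has_integral (dquot h w d - dquot h w c)) {c..d}"
proof -
  have "((g \<circ> (+) h) has_integral (w (d + h) - w (c + h))) {c..d}"
    unfolding has_integral_shift_Icc_real using assms by simp
  then have "((\<lambda>x. g (x + h)) has_integral (w (d + h) - w (c + h))) {c..d}" by (simp add: o_def add.commute)
  then have "((\<lambda>x. g (x + h) - g x) has_integral ((w (d + h) - w (c + h)) - (w d - w c))) {c..d}"
    by (intro has_integral_diff int assms)
  then have "((\<lambda>x. (g (x + h) - g x) /\<^sub>R h) has_integral ((w (d + h) - w (c + h)) - (w d - w c)) /\<^sub>R h) {c..d}"
    by (rule has_integral_cmul)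
  then show ?thesis unfolding dquot_def by (simp add: scaleR_diff_right algebra_simps)
qed

lemma has_integral_avg:
  assumes int: "\<And>a b. u integrable_on {a..b}" and "h > 0" "c \<le> d"
  shows "(dquot h u has_integral (avg h u d - avg h u c)) {c..d}"
proof -
  \<comment> \<open>The base point \<open>c - \<bar>h\<bar>\<close> lies to the left of all
    intervals involved, so every integral is a difference of values of one primitive.\<close>
  have i: "(u has_integral (integral {c-\<bar>h\<bar>..y} u - integral {c-\<bar>h\<bar>..x} u)) {x..y}" if "c \<le> x" "x \<le> y" for x y
    using integral_interval_diff[OF int, of "c-\<bar>h\<bar>" x y] int[of x y] that by (simp add: has_integral_iff)
  have "((u \<circ> (+) h) has_integral (integral {c-\<bar>h\<bar>..d+h} u - integral {c-\<bar>h\<bar>..c+h} u)) {c..d}"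
    unfolding has_integral_shift_Icc_real using assms by (intro i) auto
  then have "((\<lambda>x. u (x + h)) has_integral (integral {c-\<bar>h\<bar>..d+h} u - integral {c-\<bar>h\<bar>..c+h} u)) {c..d}" by (simp add: o_def add.commute)
  then have "((\<lambda>x. u (x + h) - u x) has_integral ((integral {c-\<bar>h\<bar>..d+h} u - integral {c-\<bar>h\<bar>..c+h} u) - (integral {c-\<bar>h\<bar>..d} u - integral {c-\<bar>h\<bar>..c} u))) {c..d}"
    by (intro has_integral_diff i assms) auto
  then have "((\<lambda>x. (u (x + h) - u x) /\<^sub>R h) has_integral ((integral {c-\<bar>h\<bar>..d+h} u - integral {c-\<bar>h\<bar>..c+h} u) - (integral {c-\<bar>h\<bar>..d} u - integral {c-\<bar>h\<bar>..c} u)) /\<^sub>R h) {c..d}"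
    by (rule has_integral_cmul)
  then have R: "(dquot h u has_integral ((integral {c-\<bar>h\<bar>..d+h} u - integral {c-\<bar>h\<bar>..c+h} u) - (integral {c-\<bar>h\<bar>..d} u - integral {c-\<bar>h\<bar>..c} u)) /\<^sub>R h) {c..d}"
    unfolding dquot_def .
  have A: "avg h u x = (integral {c-\<bar>h\<bar>..x+h} u - integral {c-\<bar>h\<bar>..x} u) /\<^sub>R h" if "c \<le> x" for x
    unfolding avg_def using integral_interval_diff[OF int, of "c-\<bar>h\<bar>" x "x+h"] that \<open>h > 0\<close> by simp
  have "avg h u d - avg h u c = ((integral {c-\<bar>h\<bar>..d+h} u - integral {c-\<bar>h\<bar>..c+h} u) - (integral {c-\<bar>h\<bar>..d} u - integral {c-\<bar>h\<bar>..c} u)) /\<^sub>R h"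
    unfolding A[OF order_refl] A[OF \<open>c \<le> d\<close>] by (simp add: algebra_simps)
  then show ?thesis using R by simp
qed

text \<open>For continuous functions the difference quotient is a derivative at every point, whereas
  \<open>has_integral_avg\<close> gives an integral identity for integrable ones. The former serves
  for the second averaging, the latter for the first.\<close>

lemma avg_has_vector_derivative:
  assumes w: "continuous_on UNIV w" and "h > 0"
  shows "(avg h w has_vector_derivative dquot h w x) (at x)"
proof -
  let ?a = "x - 1" and ?b = "x + h + 1"
  let ?I = "\<lambda>y. integral {?a..y} w"
  have wc: "continuous_on {a..b} w" for a b using w continuous_on_subset by blast
  have int: "w integrable_on {a..b}" for a b by (rule integrable_continuous_interval[OF wc])
  have I: "(?I has_vector_derivative w y) (at y)" if "y \<in> {?a<..<?b}" for y
  proof -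
    have "(?I has_vector_derivative w y) (at y within {?a..?b})"
      by (rule integral_has_vector_derivative[OF wc]) (use that in auto)
    moreover have "at y within {?a..?b} = at y" by (rule at_within_interior) (use that in \<open>auto simp: interior_atLeastAtMost_real\<close>)
    ultimately show ?thesis by simp
  qed
  have 1: "((\<lambda>y. ?I (y + h)) has_vector_derivative w (x + h)) (at x)"
  proof -
    have "((?I \<circ> (\<lambda>y. y + h)) has_vector_derivative 1 *\<^sub>R w (x + h)) (at x)"
      by (rule vector_diff_chain_at) (use I[of "x+h"] \<open>h > 0\<close> in \<open>auto intro!: derivative_eq_intros\<close>)
    then show ?thesis by (simp add: o_def)
  qed
  have 2: "((\<lambda>y. (?I (y + h) - ?I y) /\<^sub>R h) has_vector_derivative (w (x + h) - w x) /\<^sub>R h) (at x)"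
    by (rule bounded_linear.has_vector_derivative[OF bounded_linear_scaleR_right has_vector_derivative_diff[OF 1 I]]) (use \<open>h > 0\<close> in auto)
  show ?thesis unfolding dquot_def
  proof (rule has_vector_derivative_transform_within_open[OF 2])
    show "open {?a<..}" by simp
    show "x \<in> {?a<..}" by simp
    fix y assume "y \<in> {?a<..}"
    then show "(?I (y + h) - ?I y) /\<^sub>R h = avg h w y"
      unfolding avg_def using integral_interval_diff[OF int, of ?a y "y+h"] \<open>h > 0\<close> by simp
  qed
qed

lemma avg_bound:
  assumes "\<And>a b. u integrable_on {a..b}" "\<And>x. cmod (u x) \<le> M" "h > 0"
  shows "cmod (avg h u x) \<le> M"
proof -
  have "cmod (integral {x..x+h} u) \<le> integral {x..x+h} (\<lambda>_. M)"
    by (rule integral_norm_bound_integral) (use assms in auto)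
  then show ?thesis using \<open>h > 0\<close> unfolding avg_def by (simp add: field_simps)
qed

lemma avg_eq_0: "avg h u x = 0" if "\<And>y. y \<in> {x..x+h} \<Longrightarrow> u y = 0"
proof -
  have "integral {x..x+h} u = integral {x..x+h} (\<lambda>_. 0)"
    by (rule Henstock_Kurzweil_Integration.integral_cong) (rule that)
  then show ?thesis by (simp add: avg_def)
qed

lemma continuous_avg:
  assumes int: "\<And>a b. u integrable_on {a..b}" and "h > 0"
  shows "continuous_on UNIV (avg h u)"
proof -
  have "isCont (avg h u) x" for x
  proof -
    let ?a = "x - 1" and ?b = "x + h + 1"
    let ?I = "\<lambda>y. integral {?a..y} u"
    have c: "continuous_on {?a..?b} ?I" by (rule indefinite_integral_continuous_1[OF int])
    have "continuous_on {?a<..<x+1} (\<lambda>y. (?I (y + h) - ?I y) /\<^sub>R h)"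
      by (intro continuous_intros continuous_on_compose2[OF c]) (use \<open>h > 0\<close> in \<open>auto intro!: continuous_intros\<close>)
    then have "continuous_on {?a<..<x+1} (avg h u)"
    proof (rule continuous_on_eq)
      fix y assume "y \<in> {?a<..<x+1}"
      then show "(?I (y + h) - ?I y) /\<^sub>R h = avg h u y"
        unfolding avg_def using integral_interval_diff[OF int, of ?a y "y+h"] \<open>h > 0\<close> by simp
    qed
    then show ?thesis by (auto simp: continuous_on_eq_continuous_at)
  qed
  then show ?thesis by (simp add: continuous_on_eq_continuous_at)
qed

text \<open>For bounded \<open>u\<close> of bounded support, Lebesgue differentiation and dominated convergence make the
averages converge in \<open>L\<^sup>2\<close>; averaging twice produces elements of \<open>D(H\<^sub>0)\<close>.\<close>

lemma avg_approx:
  assumes int: "\<And>a b. u integrable_on {a..b}" and M: "\<And>x. cmod (u x) \<le> M"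
    and supp: "\<And>x. \<bar>x\<bar> \<ge> R \<Longrightarrow> u x = 0" and "\<delta> > 0" "\<epsilon> > 0"
  shows "\<exists>h>0. h < \<delta> \<and> sqnorm \<Lambda> (\<lambda>x. u x - avg h u x) < \<epsilon>"
proof -
  \<comment> \<open>The shift by 2 keeps \<open>h k\<close> strictly below \<open>\<delta>\<close>
    from \<open>k = 0\<close> on.\<close>
  define h where "h k = \<delta> / real (k + 2)" for k :: nat
  have hpos: "h k > 0" "h k < \<delta>" for k using \<open>\<delta> > 0\<close> by (auto simp: h_def divide_less_eq)
  have h0: "h \<longlonglongrightarrow> 0" unfolding h_def
    by (rule LIMSEQ_ignore_initial_segment[OF lim_const_over_n])
  obtain N where N: "negligible N" "\<And>x e. x \<notin> N \<Longrightarrow> 0 < e \<Longrightarrow> \<exists>d>0. \<forall>h. 0 < h \<and> h < d \<longrightarrow>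
       norm (integral (cbox x (x + h *\<^sub>R One)) u /\<^sub>R h ^ DIM(real) - u x) < e"
    using integrable_ccontinuous_explicit[of u] int by (metis cbox_interval)
  have lim: "(\<lambda>k. avg (h k) u x) \<longlonglongrightarrow> u x" if xN: "x \<notin> N" for x
  proof (rule tendstoI)
    fix e :: real assume "e > 0"
    obtain d where d: "d > 0" "\<And>h. 0 < h \<Longrightarrow> h < d \<Longrightarrow> norm (avg h u x - u x) < e"
      using N(2)[OF xN \<open>e > 0\<close>] unfolding avg_def by auto
    have "\<forall>\<^sub>F k in sequentially. h k < d" using order_tendstoD(2)[OF h0 d(1)] .
    then show "\<forall>\<^sub>F k in sequentially. dist (avg (h k) u x) (u x) < e"
      by eventually_elim (use d(2) hpos in \<open>auto simp: dist_norm\<close>)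
  qed
  have um: "u \<in> borel_measurable lebesgue" by (rule L2_bounded_support(1)[OF int M supp])
  have am: "avg (h k) u \<in> borel_measurable lebesgue" for k
    using continuous_avg[OF int hpos(1)] by (intro measurable_completion) (simp add: borel_measurable_continuous_onI)
  have "(\<lambda>k. sqnorm \<Lambda> (\<lambda>x. u x - avg (h k) u x)) \<longlonglongrightarrow> (LINT x|(lebesgue :: real measure). 0)"
    unfolding sqnorm_def set_lebesgue_integral_def
  proof (rule integral_dominated_convergence)
    \<comment> \<open>Averaging over intervals shorter than \<open>\<delta>\<close> enlarges the
      support by less than \<open>\<delta>\<close>, and \<open>2 * M\<close> bounds the difference
      between a function and its average.\<close>
    let ?w = "\<lambda>x. (2 * M)\<^sup>2 * indicator {-\<bar>R\<bar>-\<delta>..\<bar>R\<bar>+\<delta>} x"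
    have "integrable lebesgue (indicator {-\<bar>R\<bar>-\<delta>..\<bar>R\<bar>+\<delta>} :: real \<Rightarrow> real)"
      by (rule integrable_real_indicator) (auto simp: emeasure_lborel_Icc_eq)
    then show "integrable lebesgue ?w" by (rule integrable_mult_right)
    show "(\<lambda>x. indicat_real (Omega \<Lambda>) x *\<^sub>R (cmod (u x - avg (h k) u x))\<^sup>2) \<in> borel_measurable lebesgue" for k
      using um am[of k] by (intro borel_measurable_scaleR borel_measurable_indicator borel_measurable_power borel_measurable_norm borel_measurable_diff) auto
    show "AE x in lebesgue. (\<lambda>k. indicat_real (Omega \<Lambda>) x *\<^sub>R (cmod (u x - avg (h k) u x))\<^sup>2) \<longlonglongrightarrow> 0"
    proof (rule AE_I'[of N])
      show "N \<in> null_sets lebesgue" using N(1) by (simp add: negligible_iff_null_sets)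
      have "(\<lambda>k. indicat_real (Omega \<Lambda>) x *\<^sub>R (cmod (u x - avg (h k) u x))\<^sup>2) \<longlonglongrightarrow> indicat_real (Omega \<Lambda>) x *\<^sub>R (cmod (u x - u x))\<^sup>2" if "x \<notin> N" for x
        by (intro tendsto_intros lim[OF that])
      then show "{x \<in> space lebesgue. \<not> (\<lambda>k. indicat_real (Omega \<Lambda>) x *\<^sub>R (cmod (u x - avg (h k) u x))\<^sup>2) \<longlonglongrightarrow> 0} \<subseteq> N"
        by auto
    qed
    show "AE x in lebesgue. norm (indicat_real (Omega \<Lambda>) x *\<^sub>R (cmod (u x - avg (h k) u x))\<^sup>2) \<le> ?w x" for k
    proof (intro AE_I2)
      fix x
      show "norm (indicat_real (Omega \<Lambda>) x *\<^sub>R (cmod (u x - avg (h k) u x))\<^sup>2) \<le> ?w x"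
      proof (cases "x \<in> {-\<bar>R\<bar>-\<delta>..\<bar>R\<bar>+\<delta>}")
        case True
        have "cmod (u x - avg (h k) u x) \<le> 2 * M"
          using norm_triangle_ineq4[of "u x" "avg (h k) u x"] M[of x] avg_bound[OF int M hpos(1)[of k], of x] by linarith
        then have "(cmod (u x - avg (h k) u x))\<^sup>2 \<le> (2 * M)\<^sup>2" by (intro power_mono) auto
        then show ?thesis using True by (auto simp: indicator_def)
      next
        case False
        have "avg (h k) u x = 0" by (rule avg_eq_0, rule supp) (use False hpos[of k] in auto)
        moreover have "u x = 0" by (rule supp) (use False \<open>\<delta> > 0\<close> in auto)
        ultimately show ?thesis by simp
      qed
    qed
  qed simp
  then have "\<forall>\<^sub>F k in sequentially. sqnorm \<Lambda> (\<lambda>x. u x - avg (h k) u x) < \<epsilon>"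
    using \<open>\<epsilon> > 0\<close> by (intro order_tendstoD(2)) auto
  then obtain k where "sqnorm \<Lambda> (\<lambda>x. u x - avg (h k) u x) < \<epsilon>" by (auto simp: eventually_sequentially)
  then show ?thesis using hpos by blast
qed

text \<open>The support keeps the distance \<open>\<delta>\<close> from the gap, and two averagings
  of length below \<open>\<delta> / 4\<close> cannot bridge it, so value and derivative vanish at
  the boundary. Each averaging costs less than \<open>\<epsilon> / 4\<close>, doubled by
  \<open>sqnorm_add_le\<close>.\<close>

lemma bounded_support_approx:
  assumes \<Lambda>: "\<Lambda> > 0" and int: "\<And>a b. u integrable_on {a..b}" and M: "\<And>x. cmod (u x) \<le> M"
    and supp: "\<And>x. \<bar>x\<bar> \<ge> R \<Longrightarrow> u x = 0" and gap: "\<And>x. \<bar>x\<bar> \<le> \<Lambda> + \<delta> \<Longrightarrow> u x = 0" and "\<delta> > 0" "\<epsilon> > 0"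
  shows "\<exists>\<psi>\<in>D_H0 \<Lambda>. sqnorm \<Lambda> (\<lambda>x. u x - \<psi> x) < \<epsilon>"
proof -
  obtain h where h: "h > 0" "h < \<delta>/4" "sqnorm \<Lambda> (\<lambda>x. u x - avg h u x) < \<epsilon>/4"
    using avg_approx[OF int M supp, where \<delta>="\<delta>/4" and \<epsilon>="\<epsilon>/4" and \<Lambda>=\<Lambda>] \<open>\<delta> > 0\<close> \<open>\<epsilon> > 0\<close> by auto
  define w where "w = avg h u"
  have wc: "continuous_on UNIV w" unfolding w_def by (rule continuous_avg[OF int h(1)])
  have wint: "w integrable_on {a..b}" for a b
    by (rule integrable_continuous_interval, rule continuous_on_subset[OF wc]) auto
  have wM: "cmod (w x) \<le> M" for x unfolding w_def by (rule avg_bound[OF int M h(1)])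
  have wsupp: "w x = 0" if "\<bar>x\<bar> \<ge> R + \<delta>" for x unfolding w_def
    by (rule avg_eq_0, rule supp) (use that h in auto)
  have wgap: "w x = 0" if "\<bar>x\<bar> \<le> \<Lambda> + \<delta>/2" for x unfolding w_def
    by (rule avg_eq_0, rule gap) (use that h in auto)
  obtain k where k: "k > 0" "k < \<delta>/4" "sqnorm \<Lambda> (\<lambda>x. w x - avg k w x) < \<epsilon>/4"
    using avg_approx[OF wint wM wsupp, where \<delta>="\<delta>/4" and \<epsilon>="\<epsilon>/4" and \<Lambda>=\<Lambda>] \<open>\<delta> > 0\<close> \<open>\<epsilon> > 0\<close> by auto
  define \<psi> where "\<psi> = avg k w"
  have \<psi>c: "continuous_on UNIV \<psi>" unfolding \<psi>_def by (rule continuous_avg[OF wint k(1)])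
  have \<psi>int: "\<psi> integrable_on {a..b}" for a b
    by (rule integrable_continuous_interval, rule continuous_on_subset[OF \<psi>c]) auto
  have \<psi>M: "cmod (\<psi> x) \<le> M" for x unfolding \<psi>_def by (rule avg_bound[OF wint wM k(1)])
  have \<psi>supp: "\<psi> x = 0" if "\<bar>x\<bar> \<ge> R + \<delta> + \<delta>" for x unfolding \<psi>_def
    by (rule avg_eq_0, rule wsupp) (use that k in auto)
  have \<psi>gap: "\<psi> x = 0" if "\<bar>x\<bar> \<le> \<Lambda>" for x unfolding \<psi>_def
    by (rule avg_eq_0, rule wgap) (use that k in auto)
  have uL: "L2 \<Lambda> u" by (rule L2_bounded_support(2)[OF int M supp])
  have wL: "L2 \<Lambda> w" by (rule L2_bounded_support(2)[OF wint wM wsupp])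
  have \<psi>L: "L2 \<Lambda> \<psi>" by (rule L2_bounded_support(2)[OF \<psi>int \<psi>M \<psi>supp])
  \<comment> \<open>Density of the derivative of the double average: iterated difference quotients
    of the bounded \<open>u\<close>, hence bounded and of bounded support.\<close>
  let ?q = "dquot k (dquot h u)"
  have dh: "(dquot h u has_integral (w d - w c)) {c..d}" if "c \<le> d" for c d
    unfolding w_def by (rule has_integral_avg[OF int h(1) that])
  have qi: "(?q has_integral (dquot k w d - dquot k w c)) {c..d}" if "c \<le> d" for c d
    by (rule has_integral_dquot[OF dh that])
  have qL: "L2 \<Lambda> ?q"
  proof (rule L2_bounded_support(2))
    show "?q integrable_on {a..b}" for a b
      using qi[of a b] by (cases "a \<le> b") auto
    have "cmod (dquot s f x) \<le> 2 * C / s" if "s > 0" "\<And>x. cmod (f x) \<le> C" for s f C x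
    proof -
      have "cmod (f (x + s) - f x) \<le> 2 * C" using norm_triangle_ineq4[of "f (x+s)" "f x"] that(2)[of x] that(2)[of "x+s"] by linarith
      moreover have "cmod (dquot s f x) = cmod (f (x + s) - f x) / s"
        using \<open>s > 0\<close> by (simp add: dquot_def divide_inverse mult.commute)
      ultimately show ?thesis using \<open>s > 0\<close> by (simp add: divide_right_mono)
    qed
    note dq = this
    show "cmod (?q x) \<le> 2 * (2 * M / h) / k" for x by (rule dq[OF k(1) dq[OF h(1) M]])
    show "?q x = 0" if "\<bar>x\<bar> \<ge> R + \<delta> + \<delta>" for x
      unfolding dquot_def using that h k by (simp add: supp)
  qed
  note C = D_H0starI[OF \<Lambda> \<psi>L qL, of "dquot k w"]
  have p: "(\<psi> has_vector_derivative dquot k w x) (at x within S)" for S x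
    unfolding \<psi>_def by (rule has_vector_derivative_at_within[OF avg_has_vector_derivative[OF wc k(1)]])
  have "\<psi> \<in> D_H0star \<Lambda>" by (rule C(1)[OF p qi])
  moreover have "d1 \<Lambda> \<psi> x = 0" if "x = \<Lambda> \<or> x = -\<Lambda>" for x
  proof -
    have "d1 \<Lambda> \<psi> x = dquot k w x"
    proof (rule C(2)[OF p qi])
      show "is_halfline \<Lambda> (if x = \<Lambda> then {\<Lambda>..} else {..-\<Lambda>})" by simp
      show "x \<in> (if x = \<Lambda> then {\<Lambda>..} else {..-\<Lambda>})" using that by auto
    qed
    also have "\<dots> = 0" unfolding dquot_def using that k \<Lambda> by (auto simp: wgap)
    finally show ?thesis .
  qed
  ultimately have "\<psi> \<in> D_H0 \<Lambda>" using \<psi>gap \<Lambda> by (simp add: D_H0_def)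
  moreover have "sqnorm \<Lambda> (\<lambda>x. u x - \<psi> x) < \<epsilon>"
  proof -
    have "sqnorm \<Lambda> (\<lambda>x. (u x - w x) + (w x - \<psi> x)) \<le> 2 * sqnorm \<Lambda> (\<lambda>x. u x - w x) + 2 * sqnorm \<Lambda> (\<lambda>x. w x - \<psi> x)"
      by (intro sqnorm_add_le L2_diff uL wL \<psi>L)
    then show ?thesis using h(3) k(3) unfolding w_def[symmetric] \<psi>_def[symmetric] by simp
  qed
  ultimately show ?thesis by blast
qed

text \<open>Truncation makes \<open>\<phi>\<close> bounded, of bounded support and zero near the
  gap, as the previous lemma requires. Dominated convergence controls the error, since on
  \<open>Omega\<close> the truncation equals \<open>\<phi>\<close> or 0 at each point.\<close>

lemma D_H0_dense:
  assumes \<Lambda>: "\<Lambda> > 0" and \<phi>: "L2 \<Lambda> \<phi>" and "\<epsilon> > 0"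
  shows "\<exists>\<psi>\<in>D_H0 \<Lambda>. l2norm \<Lambda> (\<lambda>x. \<phi> x - \<psi> x) < \<epsilon>"
proof -
  let ?\<phi> = "\<lambda>x. indicator (Omega \<Lambda>) x *\<^sub>R \<phi> x"
  have \<phi>m[measurable]: "?\<phi> \<in> borel_measurable lebesgue" by (rule L2_measurable[OF \<phi>])
  \<comment> \<open>The single parameter \<open>n\<close> bounds both the values and the position,
    and \<open>1/(real n+1)\<close> is the distance kept from the gap.\<close>
  define B where "B n = {x \<in> space lebesgue. cmod (?\<phi> x) \<le> real n} \<inter> ({-real n<..<-\<Lambda>-1/(real n+1)} \<union> {\<Lambda>+1/(real n+1)<..<real n})" for n :: nat
  have Bm: "B n \<in> sets lebesgue" for n
  proof -
    have "{x \<in> space lebesgue. cmod (?\<phi> x) \<le> real n} \<in> sets lebesgue" by measurable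
    then show ?thesis unfolding B_def by (rule sets.Int) auto
  qed
  define u where "u n x = indicator (B n) x *\<^sub>R ?\<phi> x" for n x
  have um: "u n \<in> borel_measurable lebesgue" for n
    unfolding u_def by (intro borel_measurable_scaleR borel_measurable_indicator Bm \<phi>m)
  have uM: "cmod (u n x) \<le> real n" for n x by (auto simp: u_def B_def indicator_def)
  have B_bounds: "\<bar>x\<bar> < real n" "\<bar>x\<bar> > \<Lambda> + 1/(real n+1)" if "x \<in> B n" for n x
  proof -
    have "1 / (real n + 1) \<ge> 0" by simp
    moreover have "- real n < x \<and> x < - \<Lambda> - 1 / (real n + 1) \<or> \<Lambda> + 1 / (real n + 1) < x \<and> x < real n"
      using that unfolding B_def by auto
    ultimately show "\<bar>x\<bar> < real n" "\<bar>x\<bar> > \<Lambda> + 1/(real n+1)" using \<Lambda> by linarith+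
  qed
  have usupp: "u n x = 0" if "\<bar>x\<bar> \<ge> real n" for n x using that B_bounds(1)[of x n] by (auto simp: u_def indicator_def)
  have ugap: "u n x = 0" if "\<bar>x\<bar> \<le> \<Lambda> + 1/(real n+1)" for n x using that B_bounds(2)[of x n] by (auto simp: u_def indicator_def)
  have uint: "u n integrable_on {a..b}" for n a b
  proof -
    have "u n absolutely_integrable_on {a..b}"
    proof (rule measurable_bounded_by_integrable_imp_absolutely_integrable)
      show "u n \<in> borel_measurable (lebesgue_on {a..b})" by (rule measurable_restrict_space1[OF um])
      show "(\<lambda>_. real n) integrable_on {a..b}" by (rule integrable_const_ivl)
    qed (use uM in auto)
    then show ?thesis by (simp add: set_lebesgue_integral_eq_integral)
  qed
  have uL: "L2 \<Lambda> (u n)" for n by (rule L2_bounded_support(2)[OF uint uM usupp])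
  have "(\<lambda>n. sqnorm \<Lambda> (\<lambda>x. \<phi> x - u n x)) \<longlonglongrightarrow> (LINT x|(lebesgue :: real measure). 0)"
    unfolding sqnorm_def set_lebesgue_integral_def
  proof (rule integral_dominated_convergence)
    show "integrable lebesgue (\<lambda>x. indicat_real (Omega \<Lambda>) x *\<^sub>R (cmod (\<phi> x))\<^sup>2)"
      using L2_square_integrable[OF \<phi>] unfolding set_integrable_def .
    show "(\<lambda>x. indicat_real (Omega \<Lambda>) x *\<^sub>R (cmod (\<phi> x - u n x))\<^sup>2) \<in> borel_measurable lebesgue" for n
      using L2_square_integrable[OF L2_diff[OF \<phi> uL]] unfolding set_integrable_def by auto
    show "AE x in lebesgue. (\<lambda>n. indicat_real (Omega \<Lambda>) x *\<^sub>R (cmod (\<phi> x - u n x))\<^sup>2) \<longlonglongrightarrow> 0"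
    proof (intro AE_I2 tendsto_eventually)
      fix x
      show "\<forall>\<^sub>F n in sequentially. indicat_real (Omega \<Lambda>) x *\<^sub>R (cmod (\<phi> x - u n x))\<^sup>2 = 0"
      proof (cases "x \<in> Omega \<Lambda>")
        case True
        then have "\<bar>x\<bar> - \<Lambda> > 0" by (auto simp: Omega_def)
        then obtain m1 where m1: "inverse (real (Suc m1)) < \<bar>x\<bar> - \<Lambda>" using reals_Archimedean by blast
        obtain m2 where m2: "max \<bar>x\<bar> (cmod (\<phi> x)) < real m2" using reals_Archimedean2 by blast
        have "\<phi> x - u n x = 0" if n: "n \<ge> max m1 m2" for n
        proof -
          have "1 / (real n + 1) \<le> inverse (real (Suc m1))" using n by (simp add: field_simps)
          moreover have "real m2 \<le> real n" using n by simp
          ultimately have "x \<in> B n" using m1 m2 True unfolding B_def by (auto simp: abs_if split: if_splits)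
          then show ?thesis using True by (simp add: u_def)
        qed
        then show ?thesis by (intro eventually_sequentiallyI[of "max m1 m2"]) auto
      qed simp
    qed
    show "AE x in lebesgue. norm (indicat_real (Omega \<Lambda>) x *\<^sub>R (cmod (\<phi> x - u n x))\<^sup>2) \<le> indicat_real (Omega \<Lambda>) x *\<^sub>R (cmod (\<phi> x))\<^sup>2" for n
      by (intro AE_I2) (auto simp: u_def indicator_def)
  qed simp
  then have "\<forall>\<^sub>F n in sequentially. sqnorm \<Lambda> (\<lambda>x. \<phi> x - u n x) < \<epsilon>\<^sup>2/4"
    using \<open>\<epsilon> > 0\<close> by (intro order_tendstoD(2)) auto
  then obtain n where n: "sqnorm \<Lambda> (\<lambda>x. \<phi> x - u n x) < \<epsilon>\<^sup>2/4" by (auto simp: eventually_sequentially)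
  have "\<exists>\<psi>\<in>D_H0 \<Lambda>. sqnorm \<Lambda> (\<lambda>x. u n x - \<psi> x) < \<epsilon>\<^sup>2/4"
    by (rule bounded_support_approx[where R = "real n" and \<delta> = "1/(real n+1)", OF \<Lambda> uint uM usupp ugap]) (use \<open>\<epsilon> > 0\<close> in auto)
  then obtain \<psi> where \<psi>: "\<psi> \<in> D_H0 \<Lambda>" "sqnorm \<Lambda> (\<lambda>x. u n x - \<psi> x) < \<epsilon>\<^sup>2/4" by blast
  have \<psi>L: "L2 \<Lambda> \<psi>" using \<psi>(1) by (simp add: D_H0_def D_H0star_def)
  have "sqnorm \<Lambda> (\<lambda>x. (\<phi> x - u n x) + (u n x - \<psi> x)) \<le> 2 * sqnorm \<Lambda> (\<lambda>x. \<phi> x - u n x) + 2 * sqnorm \<Lambda> (\<lambda>x. u n x - \<psi> x)"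
    by (intro sqnorm_add_le L2_diff \<phi> uL \<psi>L)
  then have "sqnorm \<Lambda> (\<lambda>x. \<phi> x - \<psi> x) < \<epsilon>\<^sup>2" using n \<psi>(2) by simp
  then have "l2norm \<Lambda> (\<lambda>x. \<phi> x - \<psi> x) < \<epsilon>"
    unfolding l2norm_def sqnorm_def[symmetric] using \<open>\<epsilon> > 0\<close> by (simp add: real_less_lsqrt)
  then show ?thesis using \<psi>(1) by blast
qed

section \<open>Exponentials and prescribed boundary values\<close>

lemma exp_real_has_vector_derivative:
  "((\<lambda>x. exp (\<kappa> * complex_of_real x)) has_vector_derivative \<kappa> * exp (\<kappa> * of_real x)) (at x within S)"
  by (rule has_vector_derivative_real_field[where f = "\<lambda>z. exp (\<kappa> * z)"]) (auto intro!: derivative_eq_intros)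

definition expR :: "real \<Rightarrow> complex \<Rightarrow> real \<Rightarrow> complex" where
  "expR \<Lambda> \<kappa> x = (if x \<ge> \<Lambda> then exp (\<kappa> * of_real x) else 0)"

definition expL :: "real \<Rightarrow> complex \<Rightarrow> real \<Rightarrow> complex" where
  "expL \<Lambda> \<kappa> x = (if x \<le> -\<Lambda> then exp (\<kappa> * of_real x) else 0)"

lemma L2_expR: assumes "Re \<kappa> < 0" shows "L2 \<Lambda> (expR \<Lambda> \<kappa>)"
proof (rule L2I[where g = "\<lambda>x. indicator {\<Lambda>..} x *\<^sub>R exp (- (- 2 * Re \<kappa>) * x)"])
  have "(\<lambda>x. indicator {\<Lambda>..} x *\<^sub>R exp (\<kappa> * complex_of_real x)) \<in> borel_measurable borel"
    by (intro borel_measurable_scaleR borel_measurable_indicator borel_measurable_continuous_onI continuous_intros) auto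
  then have "expR \<Lambda> \<kappa> \<in> borel_measurable lebesgue"
    by (intro measurable_completion) (simp add: expR_def[abs_def] indicator_def if_distrib[of "\<lambda>c. c *\<^sub>R _"] cong: if_cong)
  then show "set_borel_measurable lebesgue (Omega \<Lambda>) (expR \<Lambda> \<kappa>)" unfolding set_borel_measurable_def
    by (intro borel_measurable_scaleR borel_measurable_indicator) auto
  have "(\<lambda>x. exp (- (- 2 * Re \<kappa>) * x)) absolutely_integrable_on {\<Lambda>..}"
    using assms by (intro nonnegative_absolutely_integrable_1 integrable_on_exp_minus_to_infinity) auto
  then show "set_integrable lebesgue (Omega \<Lambda>) (\<lambda>x. indicator {\<Lambda>..} x *\<^sub>R exp (- (- 2 * Re \<kappa>) * x))"
    unfolding set_integrable_def by (rule integrable_mult_indicator[OF Omega_sets(2)])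
  show "(cmod (expR \<Lambda> \<kappa> x))\<^sup>2 \<le> indicator {\<Lambda>..} x *\<^sub>R exp (- (- 2 * Re \<kappa>) * x)" for x
    by (auto simp: expR_def exp_double[symmetric] mult.assoc)
qed

text \<open>Reflection reduces the decay at minus infinity to an integrable exponential on
  \<open>{\<Lambda>..}\<close>. The argument is kept as \<open>0 + (-1) * x\<close>, the shape of
  the affine substitution, which is performed in \<open>lborel\<close>.\<close>

lemma L2_expL: assumes "Re \<kappa> > 0" shows "L2 \<Lambda> (expL \<Lambda> \<kappa>)"
proof (rule L2I[where g = "\<lambda>x. indicator {\<Lambda>..} (0 + (-1) * x) *\<^sub>R exp (- (2 * Re \<kappa>) * (0 + (-1) * x))"])
  have "(\<lambda>x. indicator {..-\<Lambda>} x *\<^sub>R exp (\<kappa> * complex_of_real x)) \<in> borel_measurable borel"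
    by (intro borel_measurable_scaleR borel_measurable_indicator borel_measurable_continuous_onI continuous_intros) auto
  then have "expL \<Lambda> \<kappa> \<in> borel_measurable lebesgue"
    by (intro measurable_completion) (simp add: expL_def[abs_def] indicator_def if_distrib[of "\<lambda>c. c *\<^sub>R _"] cong: if_cong)
  then show "set_borel_measurable lebesgue (Omega \<Lambda>) (expL \<Lambda> \<kappa>)" unfolding set_borel_measurable_def
    by (intro borel_measurable_scaleR borel_measurable_indicator) auto
  have "(\<lambda>x. exp (- (2 * Re \<kappa>) * x)) absolutely_integrable_on {\<Lambda>..}"
    using assms by (intro nonnegative_absolutely_integrable_1 integrable_on_exp_minus_to_infinity) auto
  then have i: "integrable lebesgue (\<lambda>x. indicator {\<Lambda>..} x *\<^sub>R exp (- (2 * Re \<kappa>) * x))"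
    unfolding set_integrable_def .
  have m: "(\<lambda>x. indicator {\<Lambda>..} x *\<^sub>R exp (- (2 * Re \<kappa>) * x)) \<in> borel_measurable lborel"
    by (intro borel_measurable_scaleR borel_measurable_indicator) (auto intro!: borel_measurable_continuous_onI continuous_intros)
  have "integrable lborel (\<lambda>x. indicator {\<Lambda>..} x *\<^sub>R exp (- (2 * Re \<kappa>) * x))"
    by (rule iffD1[OF integrable_completion[OF m] i])
  from lborel_integrable_real_affine[OF this, of "-1" 0]
  have aff: "integrable lborel (\<lambda>x. indicator {\<Lambda>..} (0 + (-1) * x) *\<^sub>R exp (- (2 * Re \<kappa>) * (0 + (-1) * x)))" by simp
  have "integrable lebesgue (\<lambda>x. indicator {\<Lambda>..} (0 + (-1) * x) *\<^sub>R exp (- (2 * Re \<kappa>) * (0 + (-1) * x)))"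
    by (rule iffD2[OF integrable_completion[OF borel_measurable_integrable[OF aff]] aff])
  then show "set_integrable lebesgue (Omega \<Lambda>) (\<lambda>x. indicator {\<Lambda>..} (0 + (-1) * x) *\<^sub>R exp (- (2 * Re \<kappa>) * (0 + (-1) * x)))"
    unfolding set_integrable_def by (rule integrable_mult_indicator[OF Omega_sets(2)])
  show "(cmod (expL \<Lambda> \<kappa> x))\<^sup>2 \<le> indicator {\<Lambda>..} (0 + (-1) * x) *\<^sub>R exp (- (2 * Re \<kappa>) * (0 + (-1) * x))" for x
    by (auto simp: expL_def exp_double[symmetric] mult.assoc)
qed

lemma D_H0star_expR:
  assumes \<Lambda>: "\<Lambda> > 0" and \<kappa>: "Re \<kappa> < 0"
  shows "expR \<Lambda> \<kappa> \<in> D_H0star \<Lambda>" "d1 \<Lambda> (expR \<Lambda> \<kappa>) \<Lambda> = \<kappa> * exp (\<kappa> * of_real \<Lambda>)" "d1 \<Lambda> (expR \<Lambda> \<kappa>) (-\<Lambda>) = 0"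
proof -
  \<comment> \<open>The factor \<open>c\<close> lets one statement serve twice: with
    \<open>c = 1\<close> for the function and with \<open>c = \<kappa>\<close> for its
    derivative.\<close>
  have der: "((\<lambda>x. c * expR \<Lambda> \<kappa> x) has_vector_derivative c * (\<kappa> * expR \<Lambda> \<kappa> x)) (at x within S)" if S: "is_halfline \<Lambda> S" "x \<in> S" for S x c
  proof (cases "S = {\<Lambda>..}")
    case True
    have E: "((\<lambda>x. c * exp (\<kappa> * complex_of_real x)) has_vector_derivative c * (\<kappa> * exp (\<kappa> * of_real x))) (at x within S)"
      by (intro has_vector_derivative_mult_right exp_real_has_vector_derivative)
    have e: "expR \<Lambda> \<kappa> y = exp (\<kappa> * of_real y)" if "y \<in> S" for y using True that by (simp add: expR_def)
    show ?thesis unfolding e[OF S(2)]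
      by (rule has_vector_derivative_transform[OF S(2) _ E]) (simp add: e)
  next
    case False
    then have "S = {..-\<Lambda>}" using S(1) by (simp add: is_halfline_def)
    then have e: "expR \<Lambda> \<kappa> y = 0" if "y \<in> S" for y using that \<Lambda> by (simp add: expR_def)
    show ?thesis unfolding e[OF S(2)]
      by (rule has_vector_derivative_transform[OF S(2), of _ "\<lambda>_. 0"]) (simp_all add: e)
  qed
  have p: "(expR \<Lambda> \<kappa> has_vector_derivative \<kappa> * expR \<Lambda> \<kappa> x) (at x within S)" if "is_halfline \<Lambda> S" "x \<in> S" for S x
    using der[OF that, of 1] by simp
  have pq: "((\<lambda>x. \<kappa> * (\<kappa> * expR \<Lambda> \<kappa> x)) has_integral (\<kappa> * expR \<Lambda> \<kappa> d - \<kappa> * expR \<Lambda> \<kappa> c)) {c..d}"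
    if "is_halfline \<Lambda> S" "{c..d} \<subseteq> S" "c \<le> d" for S c d
    by (rule fundamental_theorem_of_calculus[OF that(3)])
       (use that in \<open>auto intro!: has_vector_derivative_within_subset[OF der[of S]]\<close>)
  have q: "L2 \<Lambda> (\<lambda>x. \<kappa> * (\<kappa> * expR \<Lambda> \<kappa> x))" by (intro L2_cmult L2_expR \<kappa>)
  note C = D_H0starI[where p = "\<lambda>x. \<kappa> * expR \<Lambda> \<kappa> x", OF \<Lambda> L2_expR[OF \<kappa>] q p pq]
  show "expR \<Lambda> \<kappa> \<in> D_H0star \<Lambda>" by (rule C(1))
  have "d1 \<Lambda> (expR \<Lambda> \<kappa>) x = \<kappa> * expR \<Lambda> \<kappa> x" if "is_halfline \<Lambda> S" "x \<in> S" for S x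
    by (rule C(2)) (assumption | rule that)+
  from this[of "{\<Lambda>..}" \<Lambda>] this[of "{..-\<Lambda>}" "-\<Lambda>"]
  show "d1 \<Lambda> (expR \<Lambda> \<kappa>) \<Lambda> = \<kappa> * exp (\<kappa> * of_real \<Lambda>)" "d1 \<Lambda> (expR \<Lambda> \<kappa>) (-\<Lambda>) = 0"
    using \<Lambda> by (auto simp: expR_def)
qed

lemma D_H0star_expL:
  assumes \<Lambda>: "\<Lambda> > 0" and \<kappa>: "Re \<kappa> > 0"
  shows "expL \<Lambda> \<kappa> \<in> D_H0star \<Lambda>" "d1 \<Lambda> (expL \<Lambda> \<kappa>) (-\<Lambda>) = \<kappa> * exp (- \<kappa> * of_real \<Lambda>)" "d1 \<Lambda> (expL \<Lambda> \<kappa>) \<Lambda> = 0"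
proof -
  have der: "((\<lambda>x. c * expL \<Lambda> \<kappa> x) has_vector_derivative c * (\<kappa> * expL \<Lambda> \<kappa> x)) (at x within S)" if S: "is_halfline \<Lambda> S" "x \<in> S" for S x c
  proof (cases "S = {\<Lambda>..}")
    case True
    then have e: "expL \<Lambda> \<kappa> y = 0" if "y \<in> S" for y using that \<Lambda> by (simp add: expL_def)
    show ?thesis unfolding e[OF S(2)]
      by (rule has_vector_derivative_transform[OF S(2), of _ "\<lambda>_. 0"]) (simp_all add: e)
  next
    case False
    then have S': "S = {..-\<Lambda>}" using S(1) by (simp add: is_halfline_def)
    have E: "((\<lambda>x. c * exp (\<kappa> * complex_of_real x)) has_vector_derivative c * (\<kappa> * exp (\<kappa> * of_real x))) (at x within S)"
      by (intro has_vector_derivative_mult_right exp_real_has_vector_derivative)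
    have e: "expL \<Lambda> \<kappa> y = exp (\<kappa> * of_real y)" if "y \<in> S" for y using S' that by (simp add: expL_def)
    show ?thesis unfolding e[OF S(2)]
      by (rule has_vector_derivative_transform[OF S(2) _ E]) (simp add: e)
  qed
  have p: "(expL \<Lambda> \<kappa> has_vector_derivative \<kappa> * expL \<Lambda> \<kappa> x) (at x within S)" if "is_halfline \<Lambda> S" "x \<in> S" for S x
    using der[OF that, of 1] by simp
  have pq: "((\<lambda>x. \<kappa> * (\<kappa> * expL \<Lambda> \<kappa> x)) has_integral (\<kappa> * expL \<Lambda> \<kappa> d - \<kappa> * expL \<Lambda> \<kappa> c)) {c..d}"
    if "is_halfline \<Lambda> S" "{c..d} \<subseteq> S" "c \<le> d" for S c d
    by (rule fundamental_theorem_of_calculus[OF that(3)])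
       (use that in \<open>auto intro!: has_vector_derivative_within_subset[OF der[of S]]\<close>)
  have q: "L2 \<Lambda> (\<lambda>x. \<kappa> * (\<kappa> * expL \<Lambda> \<kappa> x))" by (intro L2_cmult L2_expL \<kappa>)
  note C = D_H0starI[where p = "\<lambda>x. \<kappa> * expL \<Lambda> \<kappa> x", OF \<Lambda> L2_expL[OF \<kappa>] q p pq]
  show "expL \<Lambda> \<kappa> \<in> D_H0star \<Lambda>" by (rule C(1))
  have "d1 \<Lambda> (expL \<Lambda> \<kappa>) x = \<kappa> * expL \<Lambda> \<kappa> x" if "is_halfline \<Lambda> S" "x \<in> S" for S x
    by (rule C(2)) (assumption | rule that)+
  from this[of "{\<Lambda>..}" \<Lambda>] this[of "{..-\<Lambda>}" "-\<Lambda>"]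
  show "d1 \<Lambda> (expL \<Lambda> \<kappa>) (-\<Lambda>) = \<kappa> * exp (- \<kappa> * of_real \<Lambda>)" "d1 \<Lambda> (expL \<Lambda> \<kappa>) \<Lambda> = 0"
    using \<Lambda> by (auto simp: expL_def)
qed

lemma D_H0star_add:
  assumes "\<Lambda> > 0" "\<psi> \<in> D_H0star \<Lambda>" "\<phi> \<in> D_H0star \<Lambda>"
  shows "(\<lambda>x. a * \<psi> x + b * \<phi> x) \<in> D_H0star \<Lambda>"
    "d1 \<Lambda> (\<lambda>x. a * \<psi> x + b * \<phi> x) \<Lambda> = a * d1 \<Lambda> \<psi> \<Lambda> + b * d1 \<Lambda> \<phi> \<Lambda>"
    "d1 \<Lambda> (\<lambda>x. a * \<psi> x + b * \<phi> x) (-\<Lambda>) = a * d1 \<Lambda> \<psi> (-\<Lambda>) + b * d1 \<Lambda> \<phi> (-\<Lambda>)"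
  using D_H0star_linear(1)[OF assms, of a b] D_H0star_linear(2)[OF assms, of "{\<Lambda>..}" \<Lambda> a b]
    D_H0star_linear(2)[OF assms, of "{..-\<Lambda>}" "-\<Lambda>" a b] by auto

text \<open>On each side two exponentials of different rates have linearly independent pairs of
  value and derivative at the endpoint. This provides test elements with arbitrary data for the
  adjoint boundary condition.\<close>

lemma boundary_values_surjective:
  assumes \<Lambda>: "\<Lambda> > 0"
  shows "\<exists>\<psi>\<in>D_H0star \<Lambda>. \<psi> (-\<Lambda>) = z1 \<and> d1 \<Lambda> \<psi> (-\<Lambda>) = z2 \<and> \<psi> \<Lambda> = z3 \<and> d1 \<Lambda> \<psi> \<Lambda> = z4"
proof -
  define E where "E = exp (complex_of_real \<Lambda>)"
  have E: "exp (- complex_of_real \<Lambda>) = inverse E" "exp (- (2 * complex_of_real \<Lambda>)) = inverse E * inverse E" "E \<noteq> 0"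
    unfolding E_def by (auto simp: exp_minus mult_exp_exp[symmetric] exp_double power2_eq_square)
  have R1: "expR \<Lambda> (-1) \<in> D_H0star \<Lambda>" "d1 \<Lambda> (expR \<Lambda> (-1)) \<Lambda> = - inverse E" "d1 \<Lambda> (expR \<Lambda> (-1)) (-\<Lambda>) = 0"
      "expR \<Lambda> (-1) \<Lambda> = inverse E" "expR \<Lambda> (-1) (-\<Lambda>) = 0"
    using D_H0star_expR[OF \<Lambda>, of "-1"] E \<Lambda> by (auto simp: expR_def)
  have R2: "expR \<Lambda> (-2) \<in> D_H0star \<Lambda>" "d1 \<Lambda> (expR \<Lambda> (-2)) \<Lambda> = - 2 * (inverse E * inverse E)" "d1 \<Lambda> (expR \<Lambda> (-2)) (-\<Lambda>) = 0"
      "expR \<Lambda> (-2) \<Lambda> = inverse E * inverse E" "expR \<Lambda> (-2) (-\<Lambda>) = 0"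
    using D_H0star_expR[OF \<Lambda>, of "-2"] E \<Lambda> by (auto simp: expR_def)
  have L1: "expL \<Lambda> 1 \<in> D_H0star \<Lambda>" "d1 \<Lambda> (expL \<Lambda> 1) \<Lambda> = 0" "d1 \<Lambda> (expL \<Lambda> 1) (-\<Lambda>) = inverse E"
      "expL \<Lambda> 1 \<Lambda> = 0" "expL \<Lambda> 1 (-\<Lambda>) = inverse E"
    using D_H0star_expL[OF \<Lambda>, of 1] E \<Lambda> by (auto simp: expL_def)
  have L2: "expL \<Lambda> 2 \<in> D_H0star \<Lambda>" "d1 \<Lambda> (expL \<Lambda> 2) \<Lambda> = 0" "d1 \<Lambda> (expL \<Lambda> 2) (-\<Lambda>) = 2 * (inverse E * inverse E)"
      "expL \<Lambda> 2 \<Lambda> = 0" "expL \<Lambda> 2 (-\<Lambda>) = inverse E * inverse E"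
    using D_H0star_expL[OF \<Lambda>, of 2] E \<Lambda> by (auto simp: expL_def)
  \<comment> \<open>The coefficients solve a 2 by 2 system on each side. On the right, the values
    \<open>s\<close> and \<open>t\<close> of the two terms at \<open>\<Lambda>\<close> satisfy
    \<open>s + t = z3\<close> and \<open>- s - 2 * t = z4\<close>; the powers of \<open>E\<close>
    undo the exponential factors.\<close>
  let ?r = "\<lambda>x. ((2 * z3 + z4) * E) * expR \<Lambda> (-1) x + (- (z3 + z4) * E * E) * expR \<Lambda> (-2) x"
  let ?l = "\<lambda>x. ((2 * z1 - z2) * E) * expL \<Lambda> 1 x + ((z2 - z1) * E * E) * expL \<Lambda> 2 x"
  note r = D_H0star_add[OF \<Lambda> R1(1) R2(1), of "(2 * z3 + z4) * E" "- (z3 + z4) * E * E"]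
  note l = D_H0star_add[OF \<Lambda> L1(1) L2(1), of "(2 * z1 - z2) * E" "(z2 - z1) * E * E"]
  note rl = D_H0star_add[OF \<Lambda> r(1) l(1), of 1 1]
  show ?thesis
  proof (intro bexI[OF _ rl(1)] conjI)
    have "1 * d1 \<Lambda> ?r (-\<Lambda>) + 1 * d1 \<Lambda> ?l (-\<Lambda>) = z2"
      using E(3) by (simp only: r(3) l(3) R1 R2 L1 L2) (simp add: field_simps)
    then show "d1 \<Lambda> (\<lambda>x. 1 * ?r x + 1 * ?l x) (-\<Lambda>) = z2" by (rule trans[OF rl(3)])
    have "1 * d1 \<Lambda> ?r \<Lambda> + 1 * d1 \<Lambda> ?l \<Lambda> = z4"
      using E(3) by (simp only: r(2) l(2) R1 R2 L1 L2) (simp add: field_simps)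
    then show "d1 \<Lambda> (\<lambda>x. 1 * ?r x + 1 * ?l x) \<Lambda> = z4" by (rule trans[OF rl(2)])
    show "1 * ?r (-\<Lambda>) + 1 * ?l (-\<Lambda>) = z1"
      using E(3) by (simp only: R1 R2 L1 L2) (simp add: field_simps)
    show "1 * ?r \<Lambda> + 1 * ?l \<Lambda> = z3"
      using E(3) by (simp only: R1 R2 L1 L2) (simp add: field_simps)
  qed
qed

section \<open>Regularity of the adjoint\<close>

text \<open>Integration starts at the boundary point of the half-line containing \<open>x\<close>;
  on the left it runs backwards, hence the sign. As in \<open>halfline\<close>, the sign of
  \<open>x\<close> selects the side.\<close>

definition prim :: "real \<Rightarrow> (real \<Rightarrow> complex) \<Rightarrow> real \<Rightarrow> complex" where
  "prim \<Lambda> f x = (if x \<ge> 0 then integral {\<Lambda>..x} f else - integral {x..-\<Lambda>} f)"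

lemma prim_has_integral:
  assumes \<Lambda>: "\<Lambda> > 0" and int: "\<And>S c d. is_halfline \<Lambda> S \<Longrightarrow> {c..d} \<subseteq> S \<Longrightarrow> f integrable_on {c..d}"
    and S: "is_halfline \<Lambda> S" "{c..d} \<subseteq> S" "c \<le> d"
  shows "(f has_integral (prim \<Lambda> f d - prim \<Lambda> f c)) {c..d}"
proof -
  have i: "f integrable_on {c..d}" by (rule int[OF S(1,2)])
  have "integral {c..d} f = prim \<Lambda> f d - prim \<Lambda> f c"
  proof (cases "S = {\<Lambda>..}")
    case True
    then have c: "\<Lambda> \<le> c" using S(2,3) by auto
    have "f integrable_on {\<Lambda>..d}" by (rule int[of "{\<Lambda>..}"]) auto
    then show ?thesis using Henstock_Kurzweil_Integration.integral_combine[OF c S(3), of f] c S(3) \<Lambda>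
      by (simp add: prim_def algebra_simps)
  next
    case False
    then have "S = {..-\<Lambda>}" using S(1) by (simp add: is_halfline_def)
    then have d: "d \<le> -\<Lambda>" using S(2,3) by auto
    have "f integrable_on {c..-\<Lambda>}" by (rule int[of "{..-\<Lambda>}"]) auto
    then show ?thesis using Henstock_Kurzweil_Integration.integral_combine[OF S(3) d, of f] d S(3) \<Lambda>
      by (simp add: prim_def algebra_simps)
  qed
  then show ?thesis using i by (simp add: has_integral_iff)
qed

lemma primitive_has_vector_derivative:
  fixes g K :: "real \<Rightarrow> complex"
  assumes S: "is_halfline \<Lambda> S" "x \<in> S" and g: "continuous_on S g"
    and K: "\<And>c d. {c..d} \<subseteq> S \<Longrightarrow> c \<le> d \<Longrightarrow> (g has_integral (K d - K c)) {c..d}"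
  shows "(K has_vector_derivative g x) (at x within S)"
proof -
  \<comment> \<open>Intersecting with \<open>{x-1..x+1}\<close> gives a compact interval with the
    same small neighbourhoods of \<open>x\<close> in \<open>S\<close>, also when \<open>x\<close> is
    the endpoint of \<open>S\<close>.\<close>
  obtain a b where ab: "{a..b} = S \<inter> {x-1..x+1}"
  proof (cases "S = {\<Lambda>..}")
    case True
    then have "{max \<Lambda> (x-1)..x+1} = S \<inter> {x-1..x+1}" by auto
    then show thesis by (rule that)
  next
    case False
    then have "S = {..-\<Lambda>}" using S(1) by (simp add: is_halfline_def)
    then have "{x-1..min (-\<Lambda>) (x+1)} = S \<inter> {x-1..x+1}" by auto
    then show thesis by (rule that)
  qed
  have x: "x \<in> {a..b}" using ab S(2) by auto
  have sub: "{a..b} \<subseteq> S" using ab by blast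
  have "((\<lambda>y. integral {a..y} g) has_vector_derivative g x) (at x within {a..b})"
    by (rule integral_has_vector_derivative[OF continuous_on_subset[OF g sub] x])
  then have D: "((\<lambda>y. K a + integral {a..y} g) has_vector_derivative g x) (at x within {a..b})"
    using has_vector_derivative_add[OF has_vector_derivative_const[of "K a"], of "\<lambda>y. integral {a..y} g" "g x"] by simp
  have "(K has_vector_derivative g x) (at x within {a..b})"
  proof (rule has_vector_derivative_transform[OF x _ D])
    fix y assume y: "y \<in> {a..b}"
    then have "{a..y} \<subseteq> {a..b}" "a \<le> y" by auto
    then have "(g has_integral (K y - K a)) {a..y}" using sub by (intro K) (blast, simp)
    then show "K y = K a + integral {a..y} g" by (simp add: integral_unique)
  qed
  moreover have "at x within {a..b} = at x within S"
    unfolding ab by (rule at_within_nhd[of x "{x-1<..<x+1}"]) auto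
  ultimately show ?thesis by simp
qed

text \<open>To the left of \<open>c\<close> the term \<open>integral {c..x} f\<close> is 0 because
  the interval is empty, in agreement with a primitive of a function vanishing there. The value at
  \<open>c\<close> itself is arbitrary and is discarded as a null set.\<close>

lemma initial_primitive_has_integral:
  fixes f :: "real \<Rightarrow> complex"
  assumes int: "\<And>a b. f integrable_on {a..b}" and zero: "\<And>x. x < c \<Longrightarrow> f x = 0" and "x \<le> y"
  shows "(f has_integral (integral {c..y} f - integral {c..x} f)) {x..y}"
proof -
  have Z: "integral {s..t} f = 0" if "t \<le> c" for s t
  proof -
    have "((\<lambda>_. 0) has_integral 0) {s..t}" by simp
    then have "(f has_integral 0) {s..t}"
      by (rule has_integral_spike[of "{c}", rotated -1]) (use that zero in auto)
    then show ?thesis by (rule integral_unique)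
  qed
  have F: "integral {c..t} f = 0" if "t \<le> c" for t using that by (cases "t = c") auto
  have "integral {x..y} f = integral {c..y} f - integral {c..x} f"
  proof -
    consider "y \<le> c" | "x \<le> c" "c \<le> y" | "c \<le> x" using \<open>x \<le> y\<close> by linarith
    then show ?thesis
    proof cases
      case 1
      then show ?thesis using Z[of y x] F[of y] F[of x] \<open>x \<le> y\<close> by simp
    next
      case 2
      then show ?thesis using Henstock_Kurzweil_Integration.integral_combine[OF 2 int] Z[of c x] F[of x] by simp
    next
      case 3
      then show ?thesis using Henstock_Kurzweil_Integration.integral_combine[OF 3 \<open>x \<le> y\<close> int] by (simp add: algebra_simps)
    qed
  qed
  then show ?thesis using int[of x y] by (simp add: has_integral_iff)
qed

lemma initial_primitive_final:
  fixes f :: "real \<Rightarrow> complex"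
  assumes int: "\<And>a b. f integrable_on {a..b}" and zero: "\<And>x. x > d \<Longrightarrow> f x = 0" and "c \<le> d" "d \<le> x"
  shows "integral {c..x} f = integral {c..d} f"
proof -
  have "((\<lambda>_. 0) has_integral 0) {d..x}" by simp
  then have "(f has_integral 0) {d..x}"
    by (rule has_integral_spike[of "{d}", rotated -1]) (use zero in auto)
  then have "integral {d..x} f = 0" by (rule integral_unique)
  then show ?thesis using Henstock_Kurzweil_Integration.integral_combine[OF \<open>c \<le> d\<close> \<open>d \<le> x\<close> int] by simp
qed

lemma continuous_on_UNIV_if_primitive:
  fixes f F :: "real \<Rightarrow> complex"
  assumes ai: "\<And>a b. f absolutely_integrable_on {a..b}"
    and F: "\<And>x y. x \<le> y \<Longrightarrow> (f has_integral (F y - F x)) {x..y}"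
  shows "continuous_on UNIV F"
proof -
  have "isCont F x" for x
  proof -
    have "continuous_on {x-1..x+1} F"
      by (rule abs_cont_on_imp_continuous_on, rule abs_cont_on_if_integral[OF ai F])
    then show ?thesis by (rule continuous_on_interior) (auto simp: interior_atLeastAtMost_real)
  qed
  then show ?thesis by (simp add: continuous_on_eq_continuous_at)
qed

text \<open>Integrating \<open>u\<close> twice from \<open>c\<close> gives \<open>G\<close> and
  \<open>\<psi>\<close>. Vanishing mean makes \<open>G\<close> vanish at \<open>d\<close>, and
  vanishing first moment makes \<open>\<psi>\<close> vanish there too, so that \<open>\<psi>\<close>
  is supported in \<open>{c..d}\<close> with zero boundary data.\<close>

lemma test_function:
  assumes \<Lambda>: "\<Lambda> > 0" and S: "is_halfline \<Lambda> S" "{c..d} \<subseteq> S" and cd: "c < d"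
    and u: "L2 \<Lambda> u" and supp: "\<And>x. x \<notin> {c..d} \<Longrightarrow> u x = 0"
    and i0: "(u has_integral 0) {c..d}" and i1: "((\<lambda>x. complex_of_real (x - m) * u x) has_integral 0) {c..d}"
  shows "\<exists>\<psi>\<in>D_H0 \<Lambda>. aeq \<Lambda> (d2 \<Lambda> \<psi>) u \<and> (\<forall>x. x \<notin> {c<..<d} \<longrightarrow> \<psi> x = 0) \<and> d1 \<Lambda> \<psi> c = 0 \<and> d1 \<Lambda> \<psi> d = 0 \<and>
      (\<exists>N. negligible N \<and> (\<forall>x\<in>{c<..<d} - N. (d1 \<Lambda> \<psi> has_vector_derivative u x) (at x)))"
proof -
  have ucd: "u absolutely_integrable_on {c..d}" by (rule L2_absolutely_integrable_interval[OF u S])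
  have "(\<lambda>x. if x \<in> {c..d} then u x else 0) absolutely_integrable_on UNIV"
    using ucd absolutely_integrable_restrict_UNIV by blast
  moreover have "(\<lambda>x. if x \<in> {c..d} then u x else 0) = u" using supp by auto
  ultimately have uU: "u absolutely_integrable_on UNIV" by simp
  have ua: "u absolutely_integrable_on {a..b}" for a b by (rule absolutely_integrable_on_subinterval[OF uU]) auto
  have ui: "u integrable_on {a..b}" for a b using ua by (simp add: set_lebesgue_integral_eq_integral)
  define G where "G x = integral {c..x} u" for x
  have Gi: "(u has_integral (G y - G x)) {x..y}" if "x \<le> y" for x y
    unfolding G_def by (rule initial_primitive_has_integral[OF ui _ that]) (use supp in auto)
  have Gc: "continuous_on UNIV G" by (rule continuous_on_UNIV_if_primitive[OF ua Gi])
  have G0: "G x = 0" if "x \<le> c" for x using that by (cases "x = c") (auto simp: G_def)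
  have G1: "G x = 0" if "x \<ge> d" for x
    unfolding G_def using initial_primitive_final[OF ui _ _ that, of c] supp i0 cd by (auto simp: integral_unique)
  have Gcont: "continuous_on T G" for T using Gc continuous_on_subset by blast
  have Ga: "G absolutely_integrable_on {a..b}" for a b by (rule absolutely_integrable_continuous_real[OF Gcont])
  have Gint: "G integrable_on {a..b}" for a b by (rule integrable_continuous_interval[OF Gcont])
  define \<psi> where "\<psi> x = integral {c..x} G" for x
  have \<psi>i: "(G has_integral (\<psi> y - \<psi> x)) {x..y}" if "x \<le> y" for x y
    unfolding \<psi>_def by (rule initial_primitive_has_integral[OF Gint _ that]) (use G0 in auto)
  have \<psi>c: "continuous_on T \<psi>" for T
    using continuous_on_UNIV_if_primitive[OF Ga \<psi>i] continuous_on_subset by blast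
  have \<psi>0: "\<psi> x = 0" if "x \<le> c" for x using that by (cases "x = c") (auto simp: \<psi>_def)
  have \<psi>der: "(\<psi> has_vector_derivative G x) (at x within T)" if "is_halfline \<Lambda> T" "x \<in> T" for x T
    by (rule primitive_has_vector_derivative[OF that Gcont \<psi>i])
  have \<psi>der': "(\<psi> has_vector_derivative G x) (at x)" if "x \<in> {c<..<d}" for x
  proof -
    have "x \<in> S" using that S(2) by (auto simp: subset_iff)
    moreover have "at x within S = at x" by (rule at_within_interior[OF halfline_interior[OF S that]])
    ultimately show ?thesis using \<psi>der[OF S(1)] by metis
  qed
  have "\<exists>N. negligible N \<and> (\<forall>x\<in>{c<..<d} - N. (G has_vector_derivative u x) (at x))"
    by (rule indefinite_integral_has_vector_derivative[where c = 0, OF ui]) (simp add: G_def)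
  then obtain N where N: "negligible N" "\<And>x. x \<in> {c<..<d} - N \<Longrightarrow> (G has_vector_derivative u x) (at x)" by blast
  \<comment> \<open>Green's formula against \<open>x - m\<close>, whose second derivative is 0: as
    \<open>G\<close> vanishes at both ends, the first moment of \<open>u\<close> equals
    \<open>- \<psi> d\<close>.\<close>
  have "((\<lambda>x. complex_of_real (x - m) * u x - 0 * \<psi> x) has_integral
      (complex_of_real (d - m) * G d - 1 * \<psi> d) - (complex_of_real (c - m) * G c - 1 * \<psi> c)) {c..d}"
  proof (rule Green_interval[OF cd N(1)])
    have lin: "((\<lambda>x. complex_of_real (x - m)) has_vector_derivative 1) (at x within T)" for x T
    proof -
      have "((\<lambda>x. x - m) has_real_derivative 1) (at x within T)"
        by (auto intro!: derivative_eq_intros)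
      from has_vector_derivative_of_real[OF this] show ?thesis by simp
    qed
    show "abs_cont_on {c..d} (\<lambda>x. complex_of_real (x - m))"
      by (rule abs_cont_on_if_continuous_derivative[OF lin]) auto
    show "abs_cont_on {c..d} (\<lambda>x. 1)"
      by (rule abs_cont_on_if_continuous_derivative[where f' = "\<lambda>_. 0"]) auto
    show "abs_cont_on {c..d} \<psi>" by (rule abs_cont_on_if_integral[OF Ga \<psi>i])
    show "abs_cont_on {c..d} G" by (rule abs_cont_on_if_integral[OF ua Gi])
    fix x assume x: "x \<in> {c<..<d} - N"
    show "((\<lambda>x. complex_of_real (x - m)) has_vector_derivative 1) (at x)" by (rule lin)
    show "((\<lambda>x. 1::complex) has_vector_derivative 0) (at x)" by simp
    show "(\<psi> has_vector_derivative G x) (at x)" by (rule \<psi>der') (use x in auto)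
    show "(G has_vector_derivative u x) (at x)" by (rule N(2)[OF x])
  qed
  then have "((\<lambda>x. complex_of_real (x - m) * u x) has_integral - \<psi> d) {c..d}"
    using G1[of d] G0[of c] \<psi>0[of c] by simp
  then have "\<psi> d = 0" using has_integral_unique[OF _ i1] by fastforce
  then have \<psi>1: "\<psi> x = 0" if "x \<ge> d" for x
    using initial_primitive_final[OF Gint _ less_imp_le[OF cd] that] G1 unfolding \<psi>_def by simp
  have \<psi>z: "\<psi> x = 0" if "x \<notin> {c<..<d}" for x using that \<psi>0[of x] \<psi>1[of x] by auto
  have "bounded (\<psi> ` {c..d})" by (intro compact_imp_bounded compact_continuous_image \<psi>c) auto
  then obtain M where M: "\<And>x. x \<in> {c..d} \<Longrightarrow> cmod (\<psi> x) \<le> M" unfolding bounded_iff by blast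
  have \<psi>L: "L2 \<Lambda> \<psi>"
  proof (rule L2_bounded_support(2))
    show "\<psi> integrable_on {a..b}" for a b by (rule integrable_continuous_interval[OF \<psi>c])
    show "cmod (\<psi> x) \<le> max M 0" for x using M[of x] \<psi>z[of x] by (cases "x \<in> {c..d}") auto
    show "\<psi> x = 0" if "\<bar>x\<bar> \<ge> max \<bar>c\<bar> \<bar>d\<bar>" for x by (rule \<psi>z) (use that in auto)
  qed
  have Gi': "(u has_integral (G y - G x)) {x..y}" if "is_halfline \<Lambda> T" "{x..y} \<subseteq> T" "x \<le> y" for T x y by (rule Gi[OF that(3)])
  note C = D_H0starI[where p = G, OF \<Lambda> \<psi>L u \<psi>der Gi']
  have \<psi>D: "\<psi> \<in> D_H0star \<Lambda>" by (rule C(1))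
  have d1: "d1 \<Lambda> \<psi> x = G x" if "is_halfline \<Lambda> T" "x \<in> T" for T x by (rule C(2)) (assumption | rule that)+
  have d2: "aeq \<Lambda> (d2 \<Lambda> \<psi>) u" by (rule C(3))
  have Gz: "G x = 0" if "x \<notin> {c<..<d}" for x using that G0[of x] G1[of x] by auto
  \<comment> \<open>\<open>{c<..<d}\<close> lies in \<open>Omega\<close>, so the boundary points are
    outside it even when \<open>c\<close> or \<open>d\<close> is one of them.\<close>
  have bd: "\<Lambda> \<notin> {c<..<d}" "-\<Lambda> \<notin> {c<..<d}" using open_interval_Omega[OF S] \<Lambda> by (auto simp: Omega_def)
  have "\<psi> \<in> D_H0 \<Lambda>"
    using \<psi>D d1[of "{\<Lambda>..}" \<Lambda>] d1[of "{..-\<Lambda>}" "-\<Lambda>"] Gz[OF bd(1)] Gz[OF bd(2)] \<psi>z[OF bd(1)] \<psi>z[OF bd(2)]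
    by (simp add: D_H0_def)
  moreover have "c \<in> S" "d \<in> S" using S(2) cd by (auto simp: subset_iff)
  then have "d1 \<Lambda> \<psi> c = 0" "d1 \<Lambda> \<psi> d = 0"
    using d1[OF S(1) \<open>c \<in> S\<close>] d1[OF S(1) \<open>d \<in> S\<close>] Gz[of c] Gz[of d] by auto
  moreover have "(d1 \<Lambda> \<psi> has_vector_derivative u x) (at x)" if x: "x \<in> {c<..<d} - N" for x
  proof (rule has_vector_derivative_transform_within_open[OF N(2)[OF x]])
    show "open {c<..<d}" by simp
    show "x \<in> {c<..<d}" using x by simp
    show "G y = d1 \<Lambda> \<psi> y" if "y \<in> {c<..<d}" for y
      by (rule d1[OF S(1), symmetric]) (use that S(2) in \<open>auto simp: subset_iff\<close>)
  qed
  ultimately show ?thesis using d2 \<psi>z N(1) by blast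
qed

lemma L2_restrict: assumes "L2 \<Lambda> f" shows "L2 \<Lambda> (\<lambda>x. indicator {c..d} x *\<^sub>R f x)"
proof (rule L2I[OF _ L2_square_integrable[OF assms]])
  have "(\<lambda>x. indicator {c..d} x *\<^sub>R (indicator (Omega \<Lambda>) x *\<^sub>R f x)) \<in> borel_measurable lebesgue"
    by (intro borel_measurable_scaleR[OF borel_measurable_indicator L2_measurable[OF assms]]) auto
  then show "set_borel_measurable lebesgue (Omega \<Lambda>) (\<lambda>x. indicator {c..d} x *\<^sub>R f x)"
    unfolding set_borel_measurable_def by (simp add: mult.commute)
  show "(cmod (indicator {c..d} x *\<^sub>R f x))\<^sup>2 \<le> (cmod (f x))\<^sup>2" for x by (simp add: indicator_def)
qed

lemma L2_restrict_continuous: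
  fixes k :: "real \<Rightarrow> complex"
  assumes k: "continuous_on {c..d} k" shows "L2 \<Lambda> (\<lambda>x. indicator {c..d} x *\<^sub>R k x)"
proof -
  have "bounded (k ` {c..d})" by (intro compact_imp_bounded compact_continuous_image k) auto
  then obtain M where M: "\<And>x. x \<in> {c..d} \<Longrightarrow> cmod (k x) \<le> M" unfolding bounded_iff by blast
  have eq: "(\<lambda>x. indicator {c..d} x *\<^sub>R k x) = (\<lambda>x. if x \<in> {c..d} then k x else 0)" by (auto simp: indicator_def)
  have U: "(\<lambda>x. if x \<in> {c..d} then k x else 0) integrable_on UNIV"
    unfolding integrable_restrict_UNIV by (rule integrable_continuous_interval[OF k])
  show ?thesis
  proof (rule L2_bounded_support(2))
    show "(\<lambda>x. indicator {c..d} x *\<^sub>R k x) integrable_on {a..b}" for a b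
      unfolding eq using integrable_on_subcbox[OF U, of a b] by simp
    show "cmod (indicator {c..d} x *\<^sub>R k x) \<le> max M 0" for x using M[of x] by (auto simp: indicator_def)
    show "indicator {c..d} x *\<^sub>R k x = 0" if "\<bar>x\<bar> \<ge> \<bar>c\<bar> + \<bar>d\<bar> + 1" for x using that by (auto simp: indicator_def)
  qed
qed

text \<open>An endpoint of \<open>{c..d}\<close> may be a boundary point and thus lie outside
  \<open>Omega\<close>. Where \<open>h\<close> is nonzero the two sets differ by at most the null
  set \<open>{\<Lambda>, -\<Lambda>}\<close>.\<close>

lemma LINT_Omega_eq_integral:
  fixes h :: "real \<Rightarrow> complex"
  assumes h: "set_integrable lebesgue (Omega \<Lambda>) h" and S: "is_halfline \<Lambda> S" "{c..d} \<subseteq> S"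
    and z: "\<And>x. x \<notin> {c..d} \<Longrightarrow> h x = 0"
  shows "(LINT x:Omega \<Lambda>|lebesgue. h x) = integral {c..d} h"
proof -
  have "{x \<in> Omega \<Lambda> - {c..d}. h x \<noteq> 0} = {}" using z by auto
  then have n: "negligible {x \<in> Omega \<Lambda> - {c..d}. h x \<noteq> 0}" by (simp only: negligible_empty)
  have "{x \<in> {c..d} - Omega \<Lambda>. h x \<noteq> 0} \<subseteq> {\<Lambda>, -\<Lambda>}"
  proof
    fix x assume x: "x \<in> {x \<in> {c..d} - Omega \<Lambda>. h x \<noteq> 0}"
    then have "x \<in> S" "x \<notin> Omega \<Lambda>" using S(2) by auto
    then show "x \<in> {\<Lambda>, -\<Lambda>}" using S(1) by (auto simp: is_halfline_def Omega_def)
  qed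
  then have "negligible {x \<in> {c..d} - Omega \<Lambda>. h x \<noteq> 0}" by (rule negligible_subset[rotated]) auto
  from integral_spike_set[OF n this] have "integral (Omega \<Lambda>) h = integral {c..d} h" .
  then show ?thesis using set_lebesgue_integral_eq_integral(2)[OF h] by simp
qed

lemma ip_cong_AE:
  assumes "L2 \<Lambda> f" "L2 \<Lambda> g" "aeq \<Lambda> f f'" "aeq \<Lambda> g g'"
  shows "ip \<Lambda> f g = ip \<Lambda> f' g'"
proof -
  have L: "L2 \<Lambda> f'" "L2 \<Lambda> g'" using assms L2_cong_AE by blast+
  show ?thesis unfolding ip_def set_lebesgue_integral_def
  proof (rule integral_cong_AE)
    show "(\<lambda>x. indicator (Omega \<Lambda>) x *\<^sub>R (cnj (f x) * g x)) \<in> borel_measurable lebesgue"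
      using L2_product_integrable[OF assms(1,2)] unfolding set_integrable_def by auto
    show "(\<lambda>x. indicator (Omega \<Lambda>) x *\<^sub>R (cnj (f' x) * g' x)) \<in> borel_measurable lebesgue"
      using L2_product_integrable[OF L] unfolding set_integrable_def by auto
    show "AE x in lebesgue. indicator (Omega \<Lambda>) x *\<^sub>R (cnj (f x) * g x) = indicator (Omega \<Lambda>) x *\<^sub>R (cnj (f' x) * g' x)"
      using assms(3,4) unfolding aeq_def by eventually_elim (auto simp: indicator_def)
  qed
qed

lemma interval_ip_integrable:
  assumes "L2 \<Lambda> f" "L2 \<Lambda> g" "is_halfline \<Lambda> S" "{c..d} \<subseteq> S"
  shows "(\<lambda>x. cnj (f x) * g x) integrable_on {c..d}"
  by (rule set_lebesgue_integral_eq_integral(1)[OF Omega_absolutely_integrable_interval[OF L2_product_integrable[OF assms(1,2)] assms(3,4)]])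

text \<open>With \<open>K'' = \<eta>\<close>, the function \<open>w = \<phi> + K\<close> is orthogonal on \<open>[c,d]\<close> to the second derivative of every
test function supported there. The difference \<open>u\<close> of \<open>w\<close> and its \<open>L\<^sup>2\<close>-projection to the affine
functions is itself such a second derivative, hence \<open>u = 0\<close>.\<close>

lemma adjoint_local_affine:
  fixes \<phi> \<eta> G K :: "real \<Rightarrow> complex"
  assumes \<Lambda>: "\<Lambda> > 0" and \<phi>: "L2 \<Lambda> \<phi>" and \<eta>: "L2 \<Lambda> \<eta>"
    and adj: "\<And>\<psi>. \<psi> \<in> D_H0 \<Lambda> \<Longrightarrow> ip \<Lambda> \<phi> (Hop \<Lambda> \<psi>) = ip \<Lambda> \<eta> \<psi>"
    and S: "is_halfline \<Lambda> S" "{c..d} \<subseteq> S" and cd: "c < d"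
    and G: "\<And>x y. {x..y} \<subseteq> S \<Longrightarrow> x \<le> y \<Longrightarrow> (\<eta> has_integral (G y - G x)) {x..y}"
    and K: "\<And>x. x \<in> S \<Longrightarrow> (K has_vector_derivative G x) (at x within S)"
  shows "\<exists>\<alpha> \<beta>. AE x in lebesgue. x \<in> {c..d} \<longrightarrow> \<phi> x + K x = \<alpha> + \<beta> * of_real x"
proof -
  \<comment> \<open>With the midpoint \<open>m\<close> the functions 1 and \<open>x - m\<close> are
    orthogonal on \<open>{c..d}\<close>; \<open>D\<close> is the squared norm of the latter.\<close>
  define m where "m = (c + d) / 2"
  define D where "D = (d - c)^3 / 12"
  have D: "D > 0" using cd by (simp add: D_def)
  have Kc: "continuous_on {c..d} K"
    by (rule continuous_on_vector_derivative[of _ _ G], rule has_vector_derivative_within_subset[OF K]) (use S(2) in auto)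
  \<comment> \<open>Cut off to \<open>{c..d}\<close>, the functions become square integrable on all
    of \<open>Omega\<close>, so that the lemmas on \<open>L2\<close> apply to them.\<close>
  define f0 where "f0 x = indicator {c..d} x *\<^sub>R \<phi> x" for x
  define k0 where "k0 x = indicator {c..d} x *\<^sub>R K x" for x
  define e0 where "e0 x = indicator {c..d} x *\<^sub>R (1::complex)" for x
  define e1 where "e1 x = indicator {c..d} x *\<^sub>R complex_of_real (x - m)" for x
  define w where "w x = f0 x + k0 x" for x
  have L: "L2 \<Lambda> f0" "L2 \<Lambda> k0" "L2 \<Lambda> e0" "L2 \<Lambda> e1"
    unfolding f0_def k0_def e0_def e1_def
    by (intro L2_restrict \<phi> L2_restrict_continuous Kc continuous_intros)+
  have Lw: "L2 \<Lambda> w" unfolding w_def by (intro L2_add L)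
  let ?I = "\<lambda>f g. integral {c..d} (\<lambda>x. cnj (f x) * g x)"
  have II: "((\<lambda>x. cnj (f x) * g x) has_integral ?I f g) {c..d}" if "L2 \<Lambda> f" "L2 \<Lambda> g" for f g
    using interval_ip_integrable[OF that S] by (rule integrable_integral)
  have E00: "?I e0 e0 = of_real (d - c)"
  proof -
    have "?I e0 e0 = integral {c..d} (\<lambda>x. 1)"
      by (rule Henstock_Kurzweil_Integration.integral_cong) (auto simp: e0_def)
    then show ?thesis using cd by (simp add: scaleR_conv_of_real)
  qed
  have E01: "?I e0 e1 = 0"
  proof -
    have "((\<lambda>x. x - m) has_integral ((d - m)\<^sup>2 / 2 - (c - m)\<^sup>2 / 2)) {c..d}"
      by (rule fundamental_theorem_of_calculus)
         (use cd in \<open>auto intro!: derivative_eq_intros simp: has_real_derivative_iff_has_vector_derivative[symmetric]\<close>)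
    moreover have "(d - m)\<^sup>2 / 2 - (c - m)\<^sup>2 / 2 = 0" by (simp add: m_def power2_eq_square field_simps)
    ultimately have "((\<lambda>x. complex_of_real (x - m)) has_integral of_real 0) {c..d}" by (metis has_integral_of_real)
    moreover have "?I e0 e1 = integral {c..d} (\<lambda>x. complex_of_real (x - m))"
      by (rule Henstock_Kurzweil_Integration.integral_cong) (auto simp: e0_def e1_def)
    ultimately show ?thesis by (simp add: integral_unique)
  qed
  have E10: "?I e1 e0 = 0"
  proof -
    have "?I e1 e0 = ?I e0 e1" by (rule Henstock_Kurzweil_Integration.integral_cong) (auto simp: e0_def e1_def)
    then show ?thesis using E01 by simp
  qed
  have E11: "?I e1 e1 = of_real D"
  proof -
    have "((\<lambda>x. (x - m)\<^sup>2) has_integral ((d - m)^3 / 3 - (c - m)^3 / 3)) {c..d}"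
      by (rule fundamental_theorem_of_calculus)
         (use cd in \<open>auto intro!: derivative_eq_intros simp: has_real_derivative_iff_has_vector_derivative[symmetric] power2_eq_square\<close>)
    moreover have "(d - m)^3 / 3 - (c - m)^3 / 3 = D" by (simp add: m_def D_def power3_eq_cube field_simps)
    ultimately have "((\<lambda>x. complex_of_real ((x - m)\<^sup>2)) has_integral of_real D) {c..d}" by (metis has_integral_of_real)
    moreover have "?I e1 e1 = integral {c..d} (\<lambda>x. complex_of_real ((x - m)\<^sup>2))"
      by (rule Henstock_Kurzweil_Integration.integral_cong) (auto simp: e1_def power2_eq_square)
    ultimately show ?thesis by (simp add: integral_unique)
  qed
  \<comment> \<open>Coefficients of the orthogonal projection of \<open>w\<close> onto the span of
    \<open>e0\<close> and \<open>e1\<close>, so that \<open>u\<close> is orthogonal to both.\<close>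
  define \<alpha> where "\<alpha> = ?I e0 w / of_real (d - c)"
  define \<beta> where "\<beta> = ?I e1 w / of_real D"
  define u where "u x = w x - \<alpha> * e0 x - \<beta> * e1 x" for x
  have Lu: "L2 \<Lambda> u" unfolding u_def by (intro L2_diff L2_cmult L Lw)
  have fu: "((\<lambda>x. cnj (f x) * u x) has_integral (?I f w - \<alpha> * ?I f e0 - \<beta> * ?I f e1)) {c..d}" if "L2 \<Lambda> f" for f
  proof -
    have "((\<lambda>x. cnj (f x) * w x - \<alpha> * (cnj (f x) * e0 x) - \<beta> * (cnj (f x) * e1 x)) has_integral
        (?I f w - \<alpha> * ?I f e0 - \<beta> * ?I f e1)) {c..d}"
      by (intro has_integral_diff has_integral_mult_right II that L Lw)
    then show ?thesis by (simp add: u_def algebra_simps)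
  qed
  have 0: "((\<lambda>x. cnj (e0 x) * u x) has_integral 0) {c..d}"
    using fu[OF L(3)] cd by (simp add: E00 E01 \<alpha>_def)
  have 1: "((\<lambda>x. cnj (e1 x) * u x) has_integral 0) {c..d}"
    using fu[OF L(4)] D by (simp add: E10 E11 \<beta>_def)
  have supp: "u x = 0" if "x \<notin> {c..d}" for x
    using that by (simp add: u_def w_def f0_def k0_def e0_def e1_def)
  have u0: "(u has_integral 0) {c..d}" by (rule has_integral_eq[OF _ 0]) (simp add: e0_def)
  have u1: "((\<lambda>x. complex_of_real (x - m) * u x) has_integral 0) {c..d}" by (rule has_integral_eq[OF _ 1]) (simp add: e1_def)
  obtain \<psi> N where \<psi>: "\<psi> \<in> D_H0 \<Lambda>" "aeq \<Lambda> (d2 \<Lambda> \<psi>) u" "\<And>x. x \<notin> {c<..<d} \<Longrightarrow> \<psi> x = 0" "d1 \<Lambda> \<psi> c = 0" "d1 \<Lambda> \<psi> d = 0"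
    and N: "negligible N" "\<And>x. x \<in> {c<..<d} - N \<Longrightarrow> (d1 \<Lambda> \<psi> has_vector_derivative u x) (at x)"
  proof -
    from test_function[OF \<Lambda> S cd Lu supp u0 u1]
    obtain \<psi> where A: "\<psi> \<in> D_H0 \<Lambda>" and B: "aeq \<Lambda> (d2 \<Lambda> \<psi>) u \<and> (\<forall>x. x \<notin> {c<..<d} \<longrightarrow> \<psi> x = 0) \<and> d1 \<Lambda> \<psi> c = 0 \<and> d1 \<Lambda> \<psi> d = 0 \<and>
      (\<exists>N. negligible N \<and> (\<forall>x\<in>{c<..<d} - N. (d1 \<Lambda> \<psi> has_vector_derivative u x) (at x)))"
      by (rule bexE)
    from B obtain N where N: "negligible N" "\<forall>x\<in>{c<..<d} - N. (d1 \<Lambda> \<psi> has_vector_derivative u x) (at x)" by (elim conjE exE)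
    show thesis by (rule that[OF A _ _ _ _ N(1)]) (use B N(2) in simp_all)
  qed
  have \<psi>D: "\<psi> \<in> D_H0star \<Lambda>" using \<psi>(1) by (simp add: D_H0_def)
  note \<psi>L = D_H0starD[OF \<psi>D]
  have ac: "abs_cont_on {c..d} K" "abs_cont_on {c..d} G"
  proof -
    show ac: "abs_cont_on {c..d} G"
    proof (rule abs_cont_on_if_integral[OF L2_absolutely_integrable_interval[OF \<eta> S]])
      fix x y assume "c \<le> x" "x \<le> y" "y \<le> d"
      then show "(\<eta> has_integral (G y - G x)) {x..y}" using S(2) by (intro G) auto
    qed
    show "abs_cont_on {c..d} K"
      by (rule abs_cont_on_if_continuous_derivative[OF _ abs_cont_on_imp_continuous_on[OF ac]],
          rule has_vector_derivative_within_subset[OF K]) (use S(2) in auto)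
  qed
  have "\<exists>N'. negligible N' \<and> (\<forall>x\<in>{c<..<d} - N'. (G has_vector_derivative \<eta> x) (at x))"
  proof (rule indefinite_integral_has_vector_derivative[where c = "G c"])
    show "\<eta> integrable_on {c..d}" using G[OF S(2)] cd by (auto simp: has_integral_iff)
    show "G x = G c + integral {c..x} \<eta>" if "x \<in> {c..d}" for x
    proof -
      have "{c..x} \<subseteq> S" using that S(2) by auto
      then have "(\<eta> has_integral (G x - G c)) {c..x}" using that by (intro G) auto
      then show ?thesis by (simp add: integral_unique)
    qed
  qed
  then obtain N' where N': "negligible N'" "\<And>x. x \<in> {c<..<d} - N' \<Longrightarrow> (G has_vector_derivative \<eta> x) (at x)" by blast
  note cnj_deriv = bounded_linear.has_vector_derivative[OF bounded_linear_cnj]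
  \<comment> \<open>\<open>\<psi>\<close> and its derivative vanish at \<open>c\<close> and
    \<open>d\<close>, so no boundary terms survive: pairing \<open>\<eta>\<close> with
    \<open>\<psi>\<close> equals pairing \<open>K\<close> with \<open>u\<close>.\<close>
  have Green: "((\<lambda>x. cnj (K x) * u x - cnj (\<eta> x) * \<psi> x) has_integral
      (cnj (K d) * d1 \<Lambda> \<psi> d - cnj (G d) * \<psi> d) - (cnj (K c) * d1 \<Lambda> \<psi> c - cnj (G c) * \<psi> c)) {c..d}"
  proof (rule Green_interval[OF cd, of "N \<union> N'" "\<lambda>x. cnj (K x)" "\<lambda>x. cnj (G x)"])
    show "negligible (N \<union> N')" using N(1) N'(1) by simp
    show "abs_cont_on {c..d} (\<lambda>x. cnj (K x))" "abs_cont_on {c..d} (\<lambda>x. cnj (G x))" using ac by (auto intro: abs_cont_on_cnj)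
    show "abs_cont_on {c..d} \<psi>" "abs_cont_on {c..d} (d1 \<Lambda> \<psi>)" using AC2_abs_cont[OF \<psi>L(2) S] by auto
    fix x assume x: "x \<in> {c<..<d} - (N \<union> N')"
    have "(K has_vector_derivative G x) (at x)"
    proof -
      have xi: "x \<in> {c<..<d}" using x by simp
      then have "x \<in> S" using S(2) by (auto simp: subset_iff)
      moreover have "at x within S = at x" by (rule at_within_interior[OF halfline_interior[OF S xi]])
      ultimately show ?thesis using K by metis
    qed
    then show "((\<lambda>x. cnj (K x)) has_vector_derivative cnj (G x)) (at x)" by (rule cnj_deriv)
    show "((\<lambda>x. cnj (G x)) has_vector_derivative cnj (\<eta> x)) (at x)" by (rule cnj_deriv[OF N'(2)]) (use x in auto)
    show "(\<psi> has_vector_derivative d1 \<Lambda> \<psi> x) (at x)" by (rule AC2_has_d1_at[OF \<Lambda> \<psi>L(2) S]) (use x in auto)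
    show "(d1 \<Lambda> \<psi> has_vector_derivative u x) (at x)" by (rule N(2)) (use x in auto)
  qed
  then have Green0: "((\<lambda>x. cnj (K x) * u x - cnj (\<eta> x) * \<psi> x) has_integral 0) {c..d}"
    using \<psi>(3)[of c] \<psi>(3)[of d] \<psi>(4,5) by simp
  have "((\<lambda>x. cnj (K x) * u x) has_integral ?I k0 u) {c..d}"
    by (rule has_integral_eq[OF _ II[OF L(2) Lu]]) (simp add: k0_def)
  from has_integral_diff[OF this Green0] have "?I \<eta> \<psi> = ?I k0 u" by (simp add: integral_unique)
  moreover have "ip \<Lambda> \<eta> \<psi> = ?I \<eta> \<psi>"
    unfolding ip_def by (rule LINT_Omega_eq_integral[OF L2_product_integrable[OF \<eta> \<psi>L(1)] S]) (use \<psi>(3) in auto)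
  moreover have "ip \<Lambda> \<phi> (Hop \<Lambda> \<psi>) = - ?I f0 u"
  proof -
    have "ip \<Lambda> \<phi> (Hop \<Lambda> \<psi>) = - ip \<Lambda> \<phi> (d2 \<Lambda> \<psi>)"
      unfolding ip_def Hop_def by (simp add: set_integral_uminus[OF L2_product_integrable[OF \<phi> \<psi>L(3)]])
    also have "ip \<Lambda> \<phi> (d2 \<Lambda> \<psi>) = ip \<Lambda> \<phi> u"
      by (rule ip_cong_AE[OF \<phi> \<psi>L(3) _ \<psi>(2)]) (simp add: aeq_def)
    also have "\<dots> = ?I \<phi> u"
      unfolding ip_def by (rule LINT_Omega_eq_integral[OF L2_product_integrable[OF \<phi> Lu] S]) (use supp in auto)
    also have "\<dots> = ?I f0 u" by (rule Henstock_Kurzweil_Integration.integral_cong) (simp add: f0_def)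
    finally show ?thesis .
  qed
  \<comment> \<open>The adjoint relation now says that \<open>w\<close> is orthogonal to
    \<open>u\<close>; the minus sign in \<open>Hop\<close> turns the difference into a sum.\<close>
  ultimately have sum0: "?I f0 u + ?I k0 u = 0" using adj[OF \<psi>(1)] by simp
  \<comment> \<open>As \<open>u\<close> is \<open>w\<close> minus its projection and is orthogonal
    to that projection, the integral of its squared modulus is the pairing of \<open>w\<close> with
    \<open>u\<close>.\<close>
  have "((\<lambda>x. cnj (f0 x) * u x + cnj (k0 x) * u x - cnj \<alpha> * (cnj (e0 x) * u x) - cnj \<beta> * (cnj (e1 x) * u x)) has_integral
      (?I f0 u + ?I k0 u - cnj \<alpha> * 0 - cnj \<beta> * 0)) {c..d}"
    by (intro has_integral_diff has_integral_add has_integral_mult_right II L Lu 0 1)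
  moreover have "cnj (f0 x) * u x + cnj (k0 x) * u x - cnj \<alpha> * (cnj (e0 x) * u x) - cnj \<beta> * (cnj (e1 x) * u x) = of_real ((cmod (u x))\<^sup>2)" for x
  proof -
    have "cnj (f0 x) * u x + cnj (k0 x) * u x - cnj \<alpha> * (cnj (e0 x) * u x) - cnj \<beta> * (cnj (e1 x) * u x) = u x * cnj (u x)"
      by (simp add: u_def w_def algebra_simps)
    then show ?thesis using complex_norm_square[of "u x"] by simp
  qed
  ultimately have "((\<lambda>x. complex_of_real ((cmod (u x))\<^sup>2)) has_integral 0) {c..d}" using sum0 by simp
  from has_integral_Re[OF this] have "((\<lambda>x. (cmod (u x))\<^sup>2) has_integral 0) {c..d}" by simp
  then have i0: "integral {c..d} (\<lambda>x. (cmod (u x))\<^sup>2) = 0" by (rule integral_unique)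
  have ai: "(\<lambda>x. (cmod (u x))\<^sup>2) absolutely_integrable_on {c..d}"
    by (rule Omega_absolutely_integrable_interval[OF L2_square_integrable[OF Lu] S])
  have "(LINT x|lebesgue. indicator {c..d} x *\<^sub>R (cmod (u x))\<^sup>2) = 0"
    using set_lebesgue_integral_eq_integral(2)[OF ai] i0 unfolding set_lebesgue_integral_def by simp
  moreover have "integrable lebesgue (\<lambda>x. indicator {c..d} x *\<^sub>R (cmod (u x))\<^sup>2)" using ai unfolding set_integrable_def .
  ultimately have "AE x in lebesgue. indicator {c..d} x *\<^sub>R (cmod (u x))\<^sup>2 = 0"
    using integral_nonneg_eq_0_iff_AE[of lebesgue "\<lambda>x. indicator {c..d} x *\<^sub>R (cmod (u x))\<^sup>2"] by simp
  then have "AE x in lebesgue. x \<in> {c..d} \<longrightarrow> \<phi> x + K x = (\<alpha> - \<beta> * of_real m) + \<beta> * of_real x"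
    by eventually_elim (auto simp: u_def w_def f0_def k0_def e0_def e1_def algebra_simps)
  then show ?thesis by blast
qed

text \<open>Two points determine an affine function, and two points of agreement exist because a
  null set together with one further point cannot exhaust \<open>{c..d}\<close>.\<close>

lemma affine_eq_AE:
  fixes \<alpha> \<beta> \<alpha>' \<beta>' :: complex
  assumes "c < d" "AE x in lebesgue. x \<in> {c..d} \<longrightarrow> \<alpha> + \<beta> * of_real x = \<alpha>' + \<beta>' * of_real x"
  shows "\<alpha> = \<alpha>' \<and> \<beta> = \<beta>'"
proof -
  obtain N where N: "N \<in> null_sets lebesgue" "{x \<in> space lebesgue. \<not> (x \<in> {c..d} \<longrightarrow> \<alpha> + \<beta> * of_real x = \<alpha>' + \<beta>' * of_real x)} \<subseteq> N"
    using assms(2) by (auto simp: eventually_ae_filter)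
  have neg: "negligible N" using N(1) by (simp add: negligible_iff_null_sets)
  have ex: "\<exists>x\<in>{c..d}. x \<notin> M" if "negligible M" for M
  proof (rule ccontr)
    assume "\<not> ?thesis"
    then have "{c..d} \<subseteq> M" by blast
    then have "negligible {c..d}" using that negligible_subset by blast
    then show False using \<open>c < d\<close> negligible_interval(1)[of c d] by simp
  qed
  obtain x where x: "x \<in> {c..d}" "x \<notin> N" using ex[OF neg] by blast
  obtain y where y: "y \<in> {c..d}" "y \<notin> insert x N" using ex[of "insert x N"] neg by (auto simp: negligible_insert)
  have e1: "\<alpha> + \<beta> * of_real x = \<alpha>' + \<beta>' * of_real x" and e2: "\<alpha> + \<beta> * of_real y = \<alpha>' + \<beta>' * of_real y"
    using x y N(2) by auto
  have "(\<beta> - \<beta>') * (of_real x - of_real y) = (\<alpha> + \<beta> * of_real x - (\<alpha>' + \<beta>' * of_real x)) - (\<alpha> + \<beta> * of_real y - (\<alpha>' + \<beta>' * of_real y))"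
    by (simp add: algebra_simps)
  also have "\<dots> = 0" by (simp only: e1 e2 diff_self)
  finally have "(\<beta> - \<beta>') * (of_real x - of_real y) = 0" .
  moreover have "complex_of_real x - of_real y \<noteq> 0" using y(2) by auto
  ultimately have "\<beta> = \<beta>'" by simp
  then show ?thesis using e1 by simp
qed

text \<open>\<open>K\<close> is the same on all intervals, and these increase to \<open>S\<close>
  from a nondegenerate first one. Agreement on that first interval forces equal coefficients, after
  which countably many null sets are collected.\<close>

lemma adjoint_halfline_affine:
  fixes \<phi> \<eta> G K :: "real \<Rightarrow> complex"
  assumes \<Lambda>: "\<Lambda> > 0" and \<phi>: "L2 \<Lambda> \<phi>" and \<eta>: "L2 \<Lambda> \<eta>"
    and adj: "\<And>\<psi>. \<psi> \<in> D_H0 \<Lambda> \<Longrightarrow> ip \<Lambda> \<phi> (Hop \<Lambda> \<psi>) = ip \<Lambda> \<eta> \<psi>"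
    and S: "is_halfline \<Lambda> S"
    and G: "\<And>x y. {x..y} \<subseteq> S \<Longrightarrow> x \<le> y \<Longrightarrow> (\<eta> has_integral (G y - G x)) {x..y}"
    and K: "\<And>x. x \<in> S \<Longrightarrow> (K has_vector_derivative G x) (at x within S)"
  shows "\<exists>\<alpha> \<beta>. AE x in lebesgue. x \<in> S \<longrightarrow> \<phi> x + K x = \<alpha> + \<beta> * of_real x"
proof -
  define a where "a n = (if S = {\<Lambda>..} then \<Lambda> else -\<Lambda> - 1 - real n)" for n :: nat
  define b where "b n = (if S = {\<Lambda>..} then \<Lambda> + 1 + real n else -\<Lambda>)" for n :: nat
  have S': "S = {\<Lambda>..} \<or> S = {..-\<Lambda>}" using S by (auto simp: is_halfline_def)
  have sub: "{a n..b n} \<subseteq> S" for n using S' by (auto simp: a_def b_def)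
  have lt: "a n < b n" for n by (simp add: a_def b_def)
  have base: "{a 0..b 0} \<subseteq> {a n..b n}" for n by (auto simp: a_def b_def)
  have "\<exists>\<alpha> \<beta>. AE x in lebesgue. x \<in> {a n..b n} \<longrightarrow> \<phi> x + K x = \<alpha> + \<beta> * of_real x" for n
    by (rule adjoint_local_affine[where G = G and K = K, OF \<Lambda> \<phi> \<eta> adj S sub lt G K])
  then obtain \<alpha> \<beta> where ab: "\<And>n. AE x in lebesgue. x \<in> {a n..b n} \<longrightarrow> \<phi> x + K x = \<alpha> n + \<beta> n * of_real x" by metis
  have eq: "\<alpha> n = \<alpha> 0 \<and> \<beta> n = \<beta> 0" for n
  proof (rule affine_eq_AE[OF lt[of 0]])
    show "AE x in lebesgue. x \<in> {a 0..b 0} \<longrightarrow> \<alpha> n + \<beta> n * of_real x = \<alpha> 0 + \<beta> 0 * of_real x"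
      using ab[of n] ab[of 0]
    proof eventually_elim
      case (elim x)
      then show ?case using base[of n] by auto
    qed
  qed
  have "AE x in lebesgue. \<forall>n. x \<in> {a n..b n} \<longrightarrow> \<phi> x + K x = \<alpha> 0 + \<beta> 0 * of_real x"
    unfolding AE_all_countable
  proof
    fix n show "AE x in lebesgue. x \<in> {a n..b n} \<longrightarrow> \<phi> x + K x = \<alpha> 0 + \<beta> 0 * of_real x"
      using ab[of n] unfolding eq[of n, THEN conjunct1] eq[of n, THEN conjunct2] .
  qed
  then have "AE x in lebesgue. x \<in> S \<longrightarrow> \<phi> x + K x = \<alpha> 0 + \<beta> 0 * of_real x"
  proof eventually_elim
    case (elim x)
    show ?case
    proof
      assume "x \<in> S"
      obtain n where "\<bar>x\<bar> + \<bar>\<Lambda>\<bar> < real n" using reals_Archimedean2 by blast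
      then have "x \<in> {a n..b n}" using \<open>x \<in> S\<close> S' by (auto simp: a_def b_def)
      then show "\<phi> x + K x = \<alpha> 0 + \<beta> 0 * of_real x" using elim by blast
    qed
  qed
  then show ?thesis by blast
qed

text \<open>On either half-line \<open>\<phi>\<close> equals an affine function minus
  \<open>K\<close> almost everywhere, and that expression is the representative
  \<open>\<xi>\<close>. Its second derivative is \<open>- \<eta>\<close>; the affine parts on the
  two sides are unrelated.\<close>

lemma adjoint_regularity:
  assumes \<Lambda>: "\<Lambda> > 0" and \<phi>: "L2 \<Lambda> \<phi>" and \<eta>: "L2 \<Lambda> \<eta>"
    and adj: "\<And>\<psi>. \<psi> \<in> D_H0 \<Lambda> \<Longrightarrow> ip \<Lambda> \<phi> (Hop \<Lambda> \<psi>) = ip \<Lambda> \<eta> \<psi>"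
  shows "\<exists>\<xi>\<in>D_H0star \<Lambda>. aeq \<Lambda> \<phi> \<xi> \<and> aeq \<Lambda> \<eta> (Hop \<Lambda> \<xi>)"
proof -
  define G where "G = prim \<Lambda> \<eta>"
  define K where "K = prim \<Lambda> G"
  have \<eta>a: "\<eta> absolutely_integrable_on {c..d}" if "is_halfline \<Lambda> S" "{c..d} \<subseteq> S" for S c d
    by (rule L2_absolutely_integrable_interval[OF \<eta> that])
  have \<eta>i: "\<eta> integrable_on {c..d}" if "is_halfline \<Lambda> S" "{c..d} \<subseteq> S" for S c d
    by (rule set_lebesgue_integral_eq_integral(1)[OF \<eta>a[OF that]])
  have G: "(\<eta> has_integral (G y - G x)) {x..y}" if "is_halfline \<Lambda> S" "{x..y} \<subseteq> S" "x \<le> y" for S x y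
    unfolding G_def by (rule prim_has_integral[OF \<Lambda> _ that]) (rule \<eta>i)
  have Gc: "continuous_on {c..d} G" if S: "is_halfline \<Lambda> S" "{c..d} \<subseteq> S" for S c d
  proof (rule abs_cont_on_imp_continuous_on, rule abs_cont_on_if_integral[OF \<eta>a[OF S]])
    fix x y assume "c \<le> x" "x \<le> y" "y \<le> d"
    then show "(\<eta> has_integral (G y - G x)) {x..y}" using S(2) by (intro G[OF S(1)]) auto
  qed
  have GS: "continuous_on S G" if S: "is_halfline \<Lambda> S" for S
  proof (cases "S = {\<Lambda>..}")
    case True
    show ?thesis unfolding continuous_on_eq_continuous_within
    proof
      fix x assume x: "x \<in> S"
      have "continuous (at x within {\<Lambda>..x+1}) G"
        using Gc[OF S, of \<Lambda> "x+1"] x True by (auto simp: continuous_on_eq_continuous_within)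
      moreover have "at x within {\<Lambda>..x+1} = at x within S"
        by (rule at_within_nhd[of x "{x-1<..<x+1}"]) (use True in auto)
      ultimately show "continuous (at x within S) G" by simp
    qed
  next
    case False
    then have S': "S = {..-\<Lambda>}" using S by (simp add: is_halfline_def)
    show ?thesis unfolding continuous_on_eq_continuous_within
    proof
      fix x assume x: "x \<in> S"
      have "continuous (at x within {x-1..-\<Lambda>}) G"
        using Gc[OF S, of "x-1" "-\<Lambda>"] x S' by (auto simp: continuous_on_eq_continuous_within)
      moreover have "at x within {x-1..-\<Lambda>} = at x within S"
        by (rule at_within_nhd[of x "{x-1<..<x+1}"]) (use S' in auto)
      ultimately show "continuous (at x within S) G" by simp
    qed
  qed
  have Gi: "G integrable_on {c..d}" if S: "is_halfline \<Lambda> S" "{c..d} \<subseteq> S" for S c d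
    by (rule integrable_continuous_interval[OF Gc[OF S]])
  have Ki: "(G has_integral (K y - K x)) {x..y}" if "is_halfline \<Lambda> S" "{x..y} \<subseteq> S" "x \<le> y" for S x y
    unfolding K_def by (rule prim_has_integral[OF \<Lambda> _ that]) (rule Gi)
  have K: "(K has_vector_derivative G x) (at x within S)" if S: "is_halfline \<Lambda> S" "x \<in> S" for S x
    by (rule primitive_has_vector_derivative[OF S GS[OF S(1)]]) (rule Ki[OF S(1)])
  obtain \<alpha>R \<beta>R where R: "AE x in lebesgue. x \<in> {\<Lambda>..} \<longrightarrow> \<phi> x + K x = \<alpha>R + \<beta>R * of_real x"
    using adjoint_halfline_affine[where G = G and K = K, OF \<Lambda> \<phi> \<eta> adj is_halfline_simps(2) G[OF is_halfline_simps(2)] K[OF is_halfline_simps(2)]] by blast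
  obtain \<alpha>L \<beta>L where L: "AE x in lebesgue. x \<in> {..-\<Lambda>} \<longrightarrow> \<phi> x + K x = \<alpha>L + \<beta>L * of_real x"
    using adjoint_halfline_affine[where G = G and K = K, OF \<Lambda> \<phi> \<eta> adj is_halfline_simps(1) G[OF is_halfline_simps(1)] K[OF is_halfline_simps(1)]] by blast
  define A where "A x = (if x \<ge> 0 then \<alpha>R + \<beta>R * complex_of_real x else \<alpha>L + \<beta>L * of_real x)" for x
  define B where "B x = (if x \<ge> 0 then \<beta>R else \<beta>L)" for x :: real
  define \<xi> where "\<xi> x = A x - K x" for x
  have ae: "aeq \<Lambda> \<phi> \<xi>"
    unfolding aeq_def using R L
  proof eventually_elim
    case (elim x)
    then show ?case using \<Lambda> by (auto simp: Omega_def \<xi>_def A_def eq_diff_eq)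
  qed
  have \<xi>L: "L2 \<Lambda> \<xi>" by (rule L2_cong_AE[OF \<phi> ae])
  have q: "L2 \<Lambda> (\<lambda>x. - \<eta> x)" using L2_cmult[OF \<eta>, of "-1"] by simp
  have A: "(A has_vector_derivative B x) (at x within S)" if S: "is_halfline \<Lambda> S" "x \<in> S" for S x
  proof -
    have lin: "((\<lambda>x. \<alpha> + \<beta> * complex_of_real x) has_vector_derivative \<beta>) (at x within S)" for \<alpha> \<beta>
      by (rule has_vector_derivative_real_field[where f = "\<lambda>z. \<alpha> + \<beta> * z"]) (auto intro!: derivative_eq_intros)
    show ?thesis
    proof (cases "S = {\<Lambda>..}")
      case True
      then have "A y = \<alpha>R + \<beta>R * of_real y" "B y = \<beta>R" if "y \<in> S" for y using that \<Lambda> by (auto simp: A_def B_def)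
      then show ?thesis using has_vector_derivative_transform[OF S(2) _ lin[of \<alpha>R \<beta>R], of A] S(2) by simp
    next
      case False
      then have "S = {..-\<Lambda>}" using S(1) by (simp add: is_halfline_def)
      then have "A y = \<alpha>L + \<beta>L * of_real y" "B y = \<beta>L" if "y \<in> S" for y using that \<Lambda> by (auto simp: A_def B_def)
      then show ?thesis using has_vector_derivative_transform[OF S(2) _ lin[of \<alpha>L \<beta>L], of A] S(2) by simp
    qed
  qed
  have p: "(\<xi> has_vector_derivative (B x - G x)) (at x within S)" if S: "is_halfline \<Lambda> S" "x \<in> S" for S x
    unfolding \<xi>_def by (intro has_vector_derivative_diff A[OF S] K[OF S])
  have pq: "((\<lambda>x. - \<eta> x) has_integral ((B d - G d) - (B c - G c))) {c..d}" if S: "is_halfline \<Lambda> S" "{c..d} \<subseteq> S" "c \<le> d" for S c d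
  proof -
    have "c \<in> S" "d \<in> S" using S(2,3) by auto
    then have "B c = B d" using S(1) \<Lambda> by (auto simp: is_halfline_def B_def)
    then show ?thesis using has_integral_neg[OF G[OF S]] by simp
  qed
  note C = D_H0starI[where p = "\<lambda>x. B x - G x", OF \<Lambda> \<xi>L q p pq]
  have "\<xi> \<in> D_H0star \<Lambda>" by (rule C(1))
  moreover have "aeq \<Lambda> (d2 \<Lambda> \<xi>) (\<lambda>x. - \<eta> x)" by (rule C(3))
  then have "aeq \<Lambda> \<eta> (Hop \<Lambda> \<xi>)" unfolding aeq_def Hop_def by eventually_elim auto
  ultimately show ?thesis using ae by blast
qed

section \<open>Boundary conditions\<close>

text \<open>For the matrix with rows \<open>(a1, a2)\<close> and \<open>(a3, a4)\<close> these are
  the entries of the identity that preserves the boundary form. Reality of a product means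
  invariance under \<open>cnj\<close>, and the last equation is the conjugate of the first.\<close>

lemma class_A_symplectic:
  assumes "class_A a1 a2 a3 a4"
  shows "cnj a4 * a1 - cnj a2 * a3 = 1" "cnj a3 * a1 = cnj a1 * a3" "cnj a4 * a2 = cnj a2 * a4"
    "cnj a1 * a4 - cnj a3 * a2 = 1"
proof -
  have A: "a1 * cnj a4 - cnj a2 * a3 = 1" "cnj (a1 * cnj a3) = a1 * cnj a3" "cnj (a2 * cnj a4) = a2 * cnj a4"
    using assms by (auto simp: class_A_def Reals_cnj_iff)
  show "cnj a4 * a1 - cnj a2 * a3 = 1" "cnj a3 * a1 = cnj a1 * a3" "cnj a4 * a2 = cnj a2 * a4"
    using A by (auto simp: mult.commute)
  have "cnj (a1 * cnj a4 - cnj a2 * a3) = 1" unfolding A(1) by simp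
  then show "cnj a1 * a4 - cnj a3 * a2 = 1" by (simp add: mult.commute)
qed

lemma bdry_form_cong_BC:
  assumes A: "class_A a1 a2 a3 a4" and "BC \<Lambda> a1 a2 a3 a4 \<phi>" "BC \<Lambda> a1 a2 a3 a4 \<psi>"
  shows "bdry_form \<Lambda> \<phi> \<psi> \<Lambda> = bdry_form \<Lambda> \<phi> \<psi> (-\<Lambda>)"
proof -
  define x x' y y' where "x = cnj (\<phi> (-\<Lambda>))" and "x' = cnj (d1 \<Lambda> \<phi> (-\<Lambda>))" and "y = \<psi> (-\<Lambda>)" and "y' = d1 \<Lambda> \<psi> (-\<Lambda>)"
  have "bdry_form \<Lambda> \<phi> \<psi> \<Lambda> = (cnj a1 * x + cnj a2 * x') * (a3 * y + a4 * y') - (cnj a3 * x + cnj a4 * x') * (a1 * y + a2 * y')"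
    using assms(2,3) unfolding bdry_form_def BC_def x_def x'_def y_def y'_def by simp
  \<comment> \<open>Sorted by the four products of boundary data, the coefficients are the entries
    of the transformed form, which class A evaluates.\<close>
  also have "\<dots> = (cnj a1 * a4 - cnj a3 * a2) * x * y' - (cnj a4 * a1 - cnj a2 * a3) * x' * y
      + (cnj a1 * a3 - cnj a3 * a1) * x * y + (cnj a2 * a4 - cnj a4 * a2) * x' * y'"
    by (simp add: algebra_simps)
  also have "\<dots> = x * y' - x' * y" unfolding class_A_symplectic(1,4)[OF A] using class_A_symplectic(2,3)[OF A] by simp
  also have "\<dots> = bdry_form \<Lambda> \<phi> \<psi> (-\<Lambda>)" by (simp add: bdry_form_def x_def x'_def y_def y'_def)
  finally show ?thesis .
qed

text \<open>The data of \<open>\<psi>\<close> at \<open>-\<Lambda>\<close> can be chosen freely and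
  determine those at \<open>\<Lambda>\<close>, so the hypothesis is a linear identity in two free
  variables.\<close>

lemma BC_if_bdry_form_vanishes:
  assumes \<Lambda>: "\<Lambda> > 0" and A: "class_A a1 a2 a3 a4"
    and eq: "\<And>\<psi>. \<psi> \<in> D_Halpha \<Lambda> a1 a2 a3 a4 \<Longrightarrow> bdry_form \<Lambda> \<phi> \<psi> \<Lambda> = bdry_form \<Lambda> \<phi> \<psi> (-\<Lambda>)"
  shows "BC \<Lambda> a1 a2 a3 a4 \<phi>"
proof -
  define p p' q q' where "p = \<phi> \<Lambda>" and "p' = d1 \<Lambda> \<phi> \<Lambda>" and "q = \<phi> (-\<Lambda>)" and "q' = d1 \<Lambda> \<phi> (-\<Lambda>)"
  have E: "cnj p * (a3 * v + a4 * v') - cnj p' * (a1 * v + a2 * v') = cnj q * v' - cnj q' * v" for v v'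
  proof -
    obtain \<psi> where \<psi>: "\<psi> \<in> D_H0star \<Lambda>" "\<psi> (-\<Lambda>) = v" "d1 \<Lambda> \<psi> (-\<Lambda>) = v'"
      "\<psi> \<Lambda> = a1 * v + a2 * v'" "d1 \<Lambda> \<psi> \<Lambda> = a3 * v + a4 * v'"
      using boundary_values_surjective[OF \<Lambda>, of v v' "a1 * v + a2 * v'" "a3 * v + a4 * v'"] by blast
    then have "\<psi> \<in> D_Halpha \<Lambda> a1 a2 a3 a4" by (simp add: D_Halpha_def BC_def)
    from eq[OF this] show ?thesis by (simp add: bdry_form_def \<psi> p_def p'_def q_def q'_def)
  qed
  \<comment> \<open>The choices \<open>(1, 0)\<close> and \<open>(0, 1)\<close> extract the two
    coefficients.\<close>
  have "cnj p * a3 - cnj p' * a1 = - cnj q'" "cnj p * a4 - cnj p' * a2 = cnj q"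
    using E[of 1 0] E[of 0 1] by auto
  then have "cnj (cnj p * a3 - cnj p' * a1) = cnj (- cnj q')" "cnj (cnj p * a4 - cnj p' * a2) = cnj (cnj q)" by auto
  then have q: "p * cnj a3 - p' * cnj a1 = - q'" "p * cnj a4 - p' * cnj a2 = q" by auto
  note S = class_A_symplectic[OF A]
  \<comment> \<open>Solving for the data at \<open>\<Lambda>\<close> uses the identities with the
    matrix factors in the opposite order, such as \<open>a1 * cnj a4 - a2 * cnj a3 = 1\<close>,
    which are consequences of \<open>S\<close>.\<close>
  have "p = a1 * q + a2 * q'" "p' = a3 * q + a4 * q'"
    using S q by algebra+
  then show ?thesis by (simp add: BC_def p_def p'_def q_def q'_def)
qed

lemma D_H0_subset_D_Halpha: "D_H0 \<Lambda> \<subseteq> D_Halpha \<Lambda> a1 a2 a3 a4"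
  by (auto simp: D_H0_def D_Halpha_def BC_def)

lemma op_le_subset: "D \<subseteq> D' \<Longrightarrow> op_le \<Lambda> D T D' T"
  by (auto simp: op_le_def aeq_def)

lemma L2_Hop: "\<psi> \<in> D_H0star \<Lambda> \<Longrightarrow> L2 \<Lambda> (Hop \<Lambda> \<psi>)"
  using L2_cmult[OF D_H0starD(3), of \<psi> \<Lambda> "-1"] by (simp add: Hop_def)

theorem self_adjoint_ext_D_Halpha:
  assumes \<Lambda>: "\<Lambda> > 0" and A: "class_A a1 a2 a3 a4"
  shows "self_adjoint_ext_H0 \<Lambda> (D_Halpha \<Lambda> a1 a2 a3 a4)"
proof -
  let ?D = "D_Halpha \<Lambda> a1 a2 a3 a4"
  have star: "\<psi> \<in> D_H0star \<Lambda>" if "\<psi> \<in> ?D" for \<psi> using that by (simp add: D_Halpha_def)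
  have "self_adjoint_op \<Lambda> ?D (Hop \<Lambda>)"
    unfolding self_adjoint_op_def
  proof (intro conjI ballI allI impI)
    fix \<psi> assume "\<psi> \<in> ?D"
    then show "L2 \<Lambda> \<psi>" "L2 \<Lambda> (Hop \<Lambda> \<psi>)" using star D_H0starD(1) L2_Hop by blast+
  next
    fix \<phi> and \<epsilon> :: real assume "L2 \<Lambda> \<phi>" "\<epsilon> > 0"
    then show "\<exists>\<psi>\<in>?D. l2norm \<Lambda> (\<lambda>x. \<phi> x - \<psi> x) < \<epsilon>"
      using D_H0_dense[OF \<Lambda>] D_H0_subset_D_Halpha by blast
  next
    fix \<psi>1 \<psi>2 assume "\<psi>1 \<in> ?D" "\<psi>2 \<in> ?D"
    then show "ip \<Lambda> \<psi>1 (Hop \<Lambda> \<psi>2) = ip \<Lambda> (Hop \<Lambda> \<psi>1) \<psi>2"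
      using ip_diff_eq_bdry_form[OF \<Lambda> star star, of \<psi>1 \<psi>2] bdry_form_cong_BC[OF A, of \<Lambda> \<psi>1 \<psi>2]
      by (simp add: D_Halpha_def)
  next
    fix \<phi> \<eta> assume *: "L2 \<Lambda> \<phi> \<and> L2 \<Lambda> \<eta> \<and> (\<forall>\<psi>\<in>?D. ip \<Lambda> \<phi> (Hop \<Lambda> \<psi>) = ip \<Lambda> \<eta> \<psi>)"
    then obtain \<xi> where \<xi>: "\<xi> \<in> D_H0star \<Lambda>" "aeq \<Lambda> \<phi> \<xi>" "aeq \<Lambda> \<eta> (Hop \<Lambda> \<xi>)"
      using adjoint_regularity[OF \<Lambda>, of \<phi> \<eta>] D_H0_subset_D_Halpha[of \<Lambda> a1 a2 a3 a4] by blast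
    have "BC \<Lambda> a1 a2 a3 a4 \<xi>"
    proof (rule BC_if_bdry_form_vanishes[OF \<Lambda> A])
      fix \<psi> assume \<psi>: "\<psi> \<in> ?D"
      have refl: "aeq \<Lambda> f f" for f by (simp add: aeq_def)
      \<comment> \<open>The inner products are known for \<open>\<phi>\<close> and
        \<open>\<eta>\<close>, the boundary values belong to \<open>\<xi>\<close>; equality almost
        everywhere connects them.\<close>
      have "ip \<Lambda> \<xi> (Hop \<Lambda> \<psi>) = ip \<Lambda> \<phi> (Hop \<Lambda> \<psi>)"
        by (rule ip_cong_AE[symmetric, OF _ L2_Hop[OF star[OF \<psi>]] \<xi>(2) refl]) (use * in simp)
      also have "\<dots> = ip \<Lambda> \<eta> \<psi>" using * \<psi> by blast
      also have "\<dots> = ip \<Lambda> (Hop \<Lambda> \<xi>) \<psi>"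
        by (rule ip_cong_AE[OF _ D_H0starD(1)[OF star[OF \<psi>]] \<xi>(3) refl]) (use * in simp)
      finally show "bdry_form \<Lambda> \<xi> \<psi> \<Lambda> = bdry_form \<Lambda> \<xi> \<psi> (-\<Lambda>)"
        using ip_diff_eq_bdry_form[OF \<Lambda> \<xi>(1) star[OF \<psi>]] by simp
    qed
    then have "\<xi> \<in> ?D" using \<xi>(1) by (simp add: D_Halpha_def)
    then show "\<exists>\<psi>\<in>?D. aeq \<Lambda> \<phi> \<psi> \<and> aeq \<Lambda> \<eta> (Hop \<Lambda> \<psi>)" using \<xi>(2,3) by blast
  qed
  then show ?thesis
    unfolding self_adjoint_ext_H0_def using op_le_subset[OF D_H0_subset_D_Halpha] by blast
qed

section \<open>The parametrization by deficiency functions\<close>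

definition zp :: complex where "zp = (1 + \<i>) / of_real (sqrt 2)"
definition zm :: complex where "zm = (1 - \<i>) / of_real (sqrt 2)"

lemma sqrt2_complex: "complex_of_real (sqrt 2) * complex_of_real (sqrt 2) = 2" "complex_of_real (sqrt 2) \<noteq> 0"
  by (auto simp: of_real_mult[symmetric] simp del: of_real_mult)

text \<open>\<open>zp\<close> and \<open>zm\<close> are e^(i pi/4) and e^(-i pi/4), with squares i
  and -i: exponentials with rate plus or minus \<open>zm\<close> are eigenfunctions of minus the
  second derivative for i, those with \<open>zp\<close> for -i. The difference
  \<open>zp - zm\<close> is the origin of the phase in both gammas.\<close>

lemma zp_zm: "zp * zm = 1" "zp \<noteq> zm" "Re zp > 0" "Re zm > 0" "zp - zm = \<i> * of_real (sqrt 2)"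
proof -
  show "zp * zm = 1" unfolding zp_def zm_def using sqrt2_complex by (simp add: field_simps)
  show "Re zp > 0" "Re zm > 0" unfolding zp_def zm_def by (auto simp: Re_divide_of_real)
  have "zp - zm = 2 * \<i> / of_real (sqrt 2)" unfolding zp_def zm_def by (simp add: diff_divide_distrib[symmetric])
  also have "\<dots> = \<i> * of_real (sqrt 2)" using sqrt2_complex by (simp add: field_simps)
  finally show d: "zp - zm = \<i> * of_real (sqrt 2)" .
  then show "zp \<noteq> zm" using sqrt2_complex(2) by auto
qed

lemma exp_quarter_pi:
  "exp (\<i> * pi / 4) = zp" "exp (- \<i> * pi / 4) = zm" "exp (\<i> * 3 * pi / 4) = - zm" "exp (- \<i> * 3 * pi / 4) = - zp"
proof -
  have s: "1 / sqrt 2 = sqrt 2 / 2" by (simp add: real_div_sqrt field_simps)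
  show p: "exp (\<i> * pi / 4) = zp"
    by (simp add: complex_eq_iff Re_exp Im_exp zp_def Re_divide_of_real Im_divide_of_real cos_45 sin_45 s)
  show m: "exp (- \<i> * pi / 4) = zm"
    by (simp add: complex_eq_iff Re_exp Im_exp zm_def Re_divide_of_real Im_divide_of_real cos_45 sin_45 s)
  have "exp (\<i> * 3 * pi / 4) = exp (\<i> * pi) * exp (- \<i> * pi / 4)"
    unfolding exp_add[symmetric] by (simp add: field_simps)
  then show "exp (\<i> * 3 * pi / 4) = - zm" using m by simp
  have "exp (- \<i> * 3 * pi / 4) = exp (- (\<i> * pi)) * exp (\<i> * pi / 4)"
    unfolding exp_add[symmetric] by (simp add: field_simps)
  then show "exp (- \<i> * 3 * pi / 4) = - zp" using p by (simp add: exp_minus)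
qed

lemma Nc_pos: "Nc \<Lambda> > 0" by (simp add: Nc_def)

text \<open>Common value of \<open>Lp\<close> at \<open>-\<Lambda>\<close> and of \<open>Rp\<close>
  at \<open>\<Lambda>\<close>; all boundary data of \<open>f\<close> and \<open>g\<close> are
  multiples of it.\<close>

definition Fc :: "real \<Rightarrow> complex" where "Fc \<Lambda> = of_real (Nc \<Lambda>) * exp (- zm * of_real \<Lambda>)"

lemma Fc_nonzero: "Fc \<Lambda> \<noteq> 0" using Nc_pos[of \<Lambda>] by (simp add: Fc_def)

lemma deficiency_eq:
  "Rp \<Lambda> x = of_real (Nc \<Lambda>) * expR \<Lambda> (- zm) x" "Rm \<Lambda> x = of_real (Nc \<Lambda>) * expR \<Lambda> (- zp) x"
  "Lp \<Lambda> x = of_real (Nc \<Lambda>) * expL \<Lambda> zm x" "Lm \<Lambda> x = of_real (Nc \<Lambda>) * expL \<Lambda> zp x"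
proof -
  have e: "(-1 + \<i>) * z / of_real (sqrt 2) = - zm * z" "(-1 - \<i>) * z / of_real (sqrt 2) = - zp * z"
    "(1 - \<i>) * z / of_real (sqrt 2) = zm * z" "(1 + \<i>) * z / of_real (sqrt 2) = zp * z" for z
    unfolding zp_def zm_def by (simp_all add: divide_inverse algebra_simps)
  show "Rp \<Lambda> x = of_real (Nc \<Lambda>) * expR \<Lambda> (- zm) x" "Rm \<Lambda> x = of_real (Nc \<Lambda>) * expR \<Lambda> (- zp) x"
    "Lp \<Lambda> x = of_real (Nc \<Lambda>) * expL \<Lambda> zm x" "Lm \<Lambda> x = of_real (Nc \<Lambda>) * expL \<Lambda> zp x"
    unfolding Rp_def Rm_def Lp_def Lm_def expR_def expL_def e by simp_all
qed

text \<open>The phase in the gammas converts the boundary value of \<open>Rm\<close> or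
  \<open>Lm\<close> into that of \<open>Lp\<close> and \<open>Rp\<close>, so that only expressions
  in the matrix entries remain as factors.\<close>

lemma exp_zp_shift: "exp (\<i> * sqrt 2 * \<Lambda>) * (of_real (Nc \<Lambda>) * exp (- zp * of_real \<Lambda>)) = Fc \<Lambda>"
proof -
  have zp: "zp = zm + \<i> * of_real (sqrt 2)" using zp_zm(5) by (simp add: diff_eq_eq add.commute)
  have "\<i> * sqrt 2 * \<Lambda> + - zp * of_real \<Lambda> = - zm * of_real \<Lambda>" unfolding zp by (simp add: algebra_simps)
  then have "exp (\<i> * sqrt 2 * \<Lambda>) * exp (- zp * of_real \<Lambda>) = exp (- zm * of_real \<Lambda>)"
    unfolding exp_add[symmetric] by (rule arg_cong)
  then show ?thesis unfolding Fc_def by (metis mult.left_commute)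
qed

text \<open>On the left \<open>f\<close> is \<open>Lp\<close> and on the right a multiple of
  \<open>Rm\<close>, so its derivative is \<open>zm\<close> times its value at
  \<open>-\<Lambda>\<close> and \<open>- zp\<close> times its value at \<open>\<Lambda>\<close>. The
  factor \<open>gamma_to\<close> is what makes the first boundary equation hold.\<close>

lemma boundary_values_f:
  fixes a1 a2 :: complex
  assumes \<Lambda>: "\<Lambda> > 0"
  defines "f \<equiv> \<lambda>x. Lp \<Lambda> x + gamma_to \<Lambda> a1 a2 * Rm \<Lambda> x"
  shows "f \<in> D_H0star \<Lambda>" "f (-\<Lambda>) = Fc \<Lambda>" "d1 \<Lambda> f (-\<Lambda>) = zm * Fc \<Lambda>"
    "f \<Lambda> = (a1 + a2 * zm) * Fc \<Lambda>" "d1 \<Lambda> f \<Lambda> = - zp * ((a1 + a2 * zm) * Fc \<Lambda>)"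
proof -
  have Rz: "Re (- zp) < 0" using zp_zm(3) by simp
  note L = D_H0star_expL[OF \<Lambda> zp_zm(4)] and R = D_H0star_expR[OF \<Lambda> Rz]
  define c where "c = gamma_to \<Lambda> a1 a2 * of_real (Nc \<Lambda>)"
  have f: "f = (\<lambda>x. of_real (Nc \<Lambda>) * expL \<Lambda> zm x + c * expR \<Lambda> (- zp) x)"
    unfolding f_def c_def deficiency_eq by (simp add: mult.assoc)
  note D = D_H0star_add[OF \<Lambda> L(1) R(1), of "of_real (Nc \<Lambda>)" c]
  have c: "c * exp (- zp * of_real \<Lambda>) = (a1 + a2 * zm) * Fc \<Lambda>"
    unfolding c_def gamma_to_def exp_quarter_pi exp_zp_shift[symmetric] by (simp only: mult_ac)
  have nL: "\<not> \<Lambda> \<le> - \<Lambda>" using \<Lambda> by simp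
  show "f \<in> D_H0star \<Lambda>" unfolding f by (rule D(1))
  show "f (-\<Lambda>) = Fc \<Lambda>" using nL unfolding f by (simp add: expL_def expR_def Fc_def)
  show "d1 \<Lambda> f (-\<Lambda>) = zm * Fc \<Lambda>" unfolding f D(3) L(2) R(3) by (simp add: Fc_def)
  show "f \<Lambda> = (a1 + a2 * zm) * Fc \<Lambda>" using nL c unfolding f by (simp add: expL_def expR_def)
  show "d1 \<Lambda> f \<Lambda> = - zp * ((a1 + a2 * zm) * Fc \<Lambda>)" unfolding f D(2) L(3) R(2) c[symmetric] by simp
qed

text \<open>Mirror image of \<open>f\<close>: the normalization is at \<open>\<Lambda>\<close>, so
  the first boundary equation has to be solved for the value at \<open>-\<Lambda>\<close>, which is
  the origin of the inverse in \<open>gamma_from\<close>.\<close>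

lemma boundary_values_g:
  fixes a1 a2 :: complex
  assumes \<Lambda>: "\<Lambda> > 0"
  defines "g \<equiv> \<lambda>x. Rp \<Lambda> x + gamma_from \<Lambda> a1 a2 * Lm \<Lambda> x"
  shows "g \<in> D_H0star \<Lambda>" "g \<Lambda> = Fc \<Lambda>" "d1 \<Lambda> g \<Lambda> = - zm * Fc \<Lambda>"
    "g (-\<Lambda>) = inverse (a1 + a2 * zp) * Fc \<Lambda>" "d1 \<Lambda> g (-\<Lambda>) = zp * (inverse (a1 + a2 * zp) * Fc \<Lambda>)"
proof -
  have Rz: "Re (- zm) < 0" using zp_zm(4) by simp
  note L = D_H0star_expL[OF \<Lambda> zp_zm(3)] and R = D_H0star_expR[OF \<Lambda> Rz]
  define c where "c = gamma_from \<Lambda> a1 a2 * of_real (Nc \<Lambda>)"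
  have g: "g = (\<lambda>x. of_real (Nc \<Lambda>) * expR \<Lambda> (- zm) x + c * expL \<Lambda> zp x)"
    unfolding g_def c_def deficiency_eq by (simp add: mult.assoc)
  note D = D_H0star_add[OF \<Lambda> R(1) L(1), of "of_real (Nc \<Lambda>)" c]
  have c: "c * exp (- zp * of_real \<Lambda>) = inverse (a1 + a2 * zp) * Fc \<Lambda>"
    unfolding c_def gamma_from_def exp_quarter_pi exp_zp_shift[symmetric] by (simp only: mult_ac)
  have nL: "\<not> \<Lambda> \<le> - \<Lambda>" using \<Lambda> by simp
  show "g \<in> D_H0star \<Lambda>" unfolding g by (rule D(1))
  show "g \<Lambda> = Fc \<Lambda>" using nL unfolding g by (simp add: expL_def expR_def Fc_def)
  show "d1 \<Lambda> g \<Lambda> = - zm * Fc \<Lambda>" unfolding g D(2) L(3) R(2) by (simp add: Fc_def)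
  show "g (-\<Lambda>) = inverse (a1 + a2 * zp) * Fc \<Lambda>" using nL c unfolding g by (simp add: expL_def expR_def)
  show "d1 \<Lambda> g (-\<Lambda>) = zp * (inverse (a1 + a2 * zp) * Fc \<Lambda>)" unfolding g D(3) L(2) R(3) c[symmetric] by simp
qed

text \<open>If \<open>a3 + a4 * zp\<close> vanished, so would \<open>a1 + a2 * zp\<close>, and the
  first column of the matrix would be \<open>- zp\<close> times the second. Reality of
  \<open>a2 * cnj a4\<close> would then make the left side of the first class A equation 0. The
  nonvanishing makes \<open>gamma_from\<close> meaningful.\<close>

lemma system_S_nonzero:
  assumes A: "class_A a1 a2 a3 a4" and S: "system_S a1 a2 a3 a4"
  shows "a1 + a2 * zm = - zm * (a3 + a4 * zm)" "a1 + a2 * zp = - zp * (a3 + a4 * zp)"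
    "a1 + a2 * zp \<noteq> 0" "a3 + a4 * zp \<noteq> 0"
proof -
  show "a1 + a2 * zm = - zm * (a3 + a4 * zm)" and p: "a1 + a2 * zp = - zp * (a3 + a4 * zp)"
    using S unfolding system_S_def exp_quarter_pi by (auto simp: mult.commute)
  have "zp \<noteq> 0" using zp_zm(1) by auto
  show nz: "a3 + a4 * zp \<noteq> 0"
  proof
    assume 3: "a3 + a4 * zp = 0"
    then have "a1 + a2 * zp = 0" using p by simp
    then have "a1 = - (a2 * zp)" "a3 = - (a4 * zp)" using 3 by (auto simp: eq_neg_iff_add_eq_0)
    then have "cnj a4 * a1 - cnj a2 * a3 = - zp * (cnj a4 * a2 - cnj a2 * a4)" by (simp add: algebra_simps)
    then show False using class_A_symplectic(1,3)[OF A] by simp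
  qed
  then show "a1 + a2 * zp \<noteq> 0" using p \<open>zp \<noteq> 0\<close> by simp
qed

text \<open>Under the boundary condition the data at \<open>-\<Lambda>\<close> determine those at
  \<open>\<Lambda>\<close>. At \<open>-\<Lambda>\<close> the data of \<open>f\<close> and
  \<open>g\<close> are proportional to \<open>(1, zm)\<close> and \<open>(1, zp)\<close>, so
  subtracting suitable multiples leaves an element of \<open>D_H0\<close>. The domains agree as sets
  of functions, the part in \<open>D_H0\<close> taking over the values on the gap.\<close>

lemma D_Hgamma_eq_D_Halpha:
  assumes \<Lambda>: "\<Lambda> > 0" and A: "class_A a1 a2 a3 a4" and S: "system_S a1 a2 a3 a4"
  shows "D_Hgamma \<Lambda> (gamma_to \<Lambda> a1 a2) (gamma_from \<Lambda> a1 a2) = D_Halpha \<Lambda> a1 a2 a3 a4"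
proof -
  define f where "f x = Lp \<Lambda> x + gamma_to \<Lambda> a1 a2 * Rm \<Lambda> x" for x
  define g where "g x = Rp \<Lambda> x + gamma_from \<Lambda> a1 a2 * Lm \<Lambda> x" for x
  note f = boundary_values_f[where ?a1.0 = a1 and ?a2.0 = a2, OF \<Lambda>, folded f_def] and g = boundary_values_g[where ?a1.0 = a1 and ?a2.0 = a2, OF \<Lambda>, folded g_def]
  note nz = system_S_nonzero[OF A S]
  have BCf: "f \<Lambda> = a1 * f (-\<Lambda>) + a2 * d1 \<Lambda> f (-\<Lambda>)" "d1 \<Lambda> f \<Lambda> = a3 * f (-\<Lambda>) + a4 * d1 \<Lambda> f (-\<Lambda>)"
  proof -
    show "f \<Lambda> = a1 * f (-\<Lambda>) + a2 * d1 \<Lambda> f (-\<Lambda>)" unfolding f by (simp add: algebra_simps)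
    \<comment> \<open>\<open>(S2)\<close> passes from the first row of the matrix to the second at
      the cost of \<open>- zm\<close>, which cancels the \<open>- zp\<close> from the derivative of
      \<open>Rm\<close>.\<close>
    have "d1 \<Lambda> f \<Lambda> = (zp * zm) * ((a3 + a4 * zm) * Fc \<Lambda>)" unfolding f nz(1) by (simp add: mult_ac)
    then show "d1 \<Lambda> f \<Lambda> = a3 * f (-\<Lambda>) + a4 * d1 \<Lambda> f (-\<Lambda>)" unfolding f zp_zm(1) by (simp add: algebra_simps)
  qed
  have BCg: "g \<Lambda> = a1 * g (-\<Lambda>) + a2 * d1 \<Lambda> g (-\<Lambda>)" "d1 \<Lambda> g \<Lambda> = a3 * g (-\<Lambda>) + a4 * d1 \<Lambda> g (-\<Lambda>)"
  proof -
    have "a1 * g (-\<Lambda>) + a2 * d1 \<Lambda> g (-\<Lambda>) = ((a1 + a2 * zp) * inverse (a1 + a2 * zp)) * Fc \<Lambda>"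
      unfolding g by (simp add: algebra_simps)
    then show "g \<Lambda> = a1 * g (-\<Lambda>) + a2 * d1 \<Lambda> g (-\<Lambda>)" unfolding g using nz(3) by simp
    have "a3 * g (-\<Lambda>) + a4 * d1 \<Lambda> g (-\<Lambda>) = (a3 + a4 * zp) * inverse (a1 + a2 * zp) * Fc \<Lambda>"
      unfolding g by (simp add: algebra_simps)
    also have "a3 + a4 * zp = - zm * (a1 + a2 * zp)" unfolding nz(2) using zp_zm(1) by (simp add: mult.assoc[symmetric] mult.commute)
    finally show "d1 \<Lambda> g \<Lambda> = a3 * g (-\<Lambda>) + a4 * d1 \<Lambda> g (-\<Lambda>)" unfolding g using nz(3) by simp
  qed
  have comb: "(\<lambda>x. \<psi> x + cL * f x + cR * g x) \<in> D_H0star \<Lambda>"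
    "d1 \<Lambda> (\<lambda>x. \<psi> x + cL * f x + cR * g x) \<Lambda> = d1 \<Lambda> \<psi> \<Lambda> + cL * d1 \<Lambda> f \<Lambda> + cR * d1 \<Lambda> g \<Lambda>"
    "d1 \<Lambda> (\<lambda>x. \<psi> x + cL * f x + cR * g x) (-\<Lambda>) = d1 \<Lambda> \<psi> (-\<Lambda>) + cL * d1 \<Lambda> f (-\<Lambda>) + cR * d1 \<Lambda> g (-\<Lambda>)"
    if "\<psi> \<in> D_H0star \<Lambda>" for \<psi> cL cR
    using D_H0star_add[OF \<Lambda> D_H0star_add(1)[OF \<Lambda> that f(1), of 1 cL] g(1), of 1 cR] D_H0star_add[OF \<Lambda> that f(1), of 1 cL] by auto
  show ?thesis
  proof (intro equalityI subsetI)
    fix \<psi> assume "\<psi> \<in> D_Hgamma \<Lambda> (gamma_to \<Lambda> a1 a2) (gamma_from \<Lambda> a1 a2)"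
    then obtain \<psi>0 cL cR where \<psi>0: "\<psi>0 \<in> D_H0 \<Lambda>" and \<psi>: "\<psi> = (\<lambda>x. \<psi>0 x + cL * f x + cR * g x)"
      unfolding D_Hgamma_def f_def g_def by blast
    have z: "\<psi>0 \<in> D_H0star \<Lambda>" "\<psi>0 \<Lambda> = 0" "\<psi>0 (-\<Lambda>) = 0" "d1 \<Lambda> \<psi>0 \<Lambda> = 0" "d1 \<Lambda> \<psi>0 (-\<Lambda>) = 0"
      using \<psi>0 by (auto simp: D_H0_def)
    have "BC \<Lambda> a1 a2 a3 a4 \<psi>"
      unfolding \<psi> BC_def comb[OF z(1)] z BCf BCg by (simp add: algebra_simps)
    then show "\<psi> \<in> D_Halpha \<Lambda> a1 a2 a3 a4" using comb(1)[OF z(1)] unfolding \<psi> by (simp add: D_Halpha_def)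
  next
    fix \<psi> assume "\<psi> \<in> D_Halpha \<Lambda> a1 a2 a3 a4"
    then have \<psi>: "\<psi> \<in> D_H0star \<Lambda>" and B: "\<psi> \<Lambda> = a1 * \<psi> (-\<Lambda>) + a2 * d1 \<Lambda> \<psi> (-\<Lambda>)" "d1 \<Lambda> \<psi> \<Lambda> = a3 * \<psi> (-\<Lambda>) + a4 * d1 \<Lambda> \<psi> (-\<Lambda>)"
      by (auto simp: D_Halpha_def BC_def)
    define x y where "x = \<psi> (-\<Lambda>)" and "y = d1 \<Lambda> \<psi> (-\<Lambda>)"
    \<comment> \<open>Writing the data \<open>(x, y)\<close> as a combination of
      \<open>(1, zm)\<close> and \<open>(1, zp)\<close> gives coefficients with denominator
      \<open>zp - zm\<close>; division by \<open>f (-\<Lambda>)\<close> and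
      \<open>g (-\<Lambda>)\<close> removes the normalization.\<close>
    define cL where "cL = (zp * x - y) / ((zp - zm) * f (-\<Lambda>))"
    define cR where "cR = (y - zm * x) / ((zp - zm) * g (-\<Lambda>))"
    have nzf: "f (-\<Lambda>) \<noteq> 0" "g (-\<Lambda>) \<noteq> 0" "zp - zm \<noteq> 0" using Fc_nonzero nz(3) zp_zm(2) unfolding f g by auto
    have df: "d1 \<Lambda> f (-\<Lambda>) = zm * f (-\<Lambda>)" "d1 \<Lambda> g (-\<Lambda>) = zp * g (-\<Lambda>)" unfolding f g by auto
    have c: "cL * f (-\<Lambda>) = (zp * x - y) / (zp - zm)" "cR * g (-\<Lambda>) = (y - zm * x) / (zp - zm)"
      unfolding cL_def cR_def using nzf by simp_all
    have X: "cL * f (-\<Lambda>) + cR * g (-\<Lambda>) = x"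
      unfolding c add_divide_distrib[symmetric] using nzf(3) by (simp add: algebra_simps nonzero_divide_eq_eq)
    have Y: "cL * d1 \<Lambda> f (-\<Lambda>) + cR * d1 \<Lambda> g (-\<Lambda>) = y"
    proof -
      have "cL * d1 \<Lambda> f (-\<Lambda>) + cR * d1 \<Lambda> g (-\<Lambda>) = zm * (cL * f (-\<Lambda>)) + zp * (cR * g (-\<Lambda>))"
        unfolding df by (simp add: mult_ac)
      also have "\<dots> = y"
        unfolding c times_divide_eq_right add_divide_distrib[symmetric] using nzf(3) by (simp add: algebra_simps nonzero_divide_eq_eq)
      finally show ?thesis .
    qed
    define \<psi>0 where "\<psi>0 = (\<lambda>t. \<psi> t + (- cL) * f t + (- cR) * g t)"
    note d = comb[OF \<psi>, of "- cL" "- cR", folded \<psi>0_def]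
    have v: "\<psi>0 (-\<Lambda>) = 0" "d1 \<Lambda> \<psi>0 (-\<Lambda>) = 0"
      using X Y unfolding d(3) by (auto simp: \<psi>0_def x_def y_def algebra_simps)
    \<comment> \<open>The boundary condition also holds for \<open>\<psi>0\<close>, so its zero data
      at \<open>-\<Lambda>\<close> propagate to \<open>\<Lambda>\<close>.\<close>
    have "\<psi>0 \<Lambda> = a1 * \<psi>0 (-\<Lambda>) + a2 * d1 \<Lambda> \<psi>0 (-\<Lambda>)"
      unfolding d(3) unfolding \<psi>0_def B BCf BCg by (simp add: algebra_simps)
    moreover have "d1 \<Lambda> \<psi>0 \<Lambda> = a3 * \<psi>0 (-\<Lambda>) + a4 * d1 \<Lambda> \<psi>0 (-\<Lambda>)"
      unfolding d(2,3) unfolding \<psi>0_def B BCf BCg by (simp add: algebra_simps)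
    ultimately have "\<psi>0 \<in> D_H0 \<Lambda>" using v d(1) by (simp add: D_H0_def)
    moreover have "\<psi> = (\<lambda>x. \<psi>0 x + cL * f x + cR * g x)" by (auto simp: \<psi>0_def)
    ultimately show "\<psi> \<in> D_Hgamma \<Lambda> (gamma_to \<Lambda> a1 a2) (gamma_from \<Lambda> a1 a2)"
      unfolding D_Hgamma_def f_def g_def by blast
  qed
qed

theorem theorem4:
  fixes \<Lambda> :: real and a1 a2 a3 a4 :: complex
  assumes "\<Lambda> > 0" and "class_A a1 a2 a3 a4"
  shows "self_adjoint_ext_H0 \<Lambda> (D_Halpha \<Lambda> a1 a2 a3 a4)
    \<and> (system_S a1 a2 a3 a4 \<longrightarrow>
        a1 + a2 * exp (\<i> * pi / 4) \<noteq> 0 \<and> a3 + a4 * exp (\<i> * pi / 4) \<noteq> 0 \<and>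
        gamma_to \<Lambda> a1 a2 = (a3 + a4 * exp (- \<i> * pi / 4)) * exp (\<i> * (sqrt 2 * \<Lambda> + 3 * pi / 4)) \<and>
        gamma_from \<Lambda> a1 a2 = inverse (a3 + a4 * exp (\<i> * pi / 4)) * exp (\<i> * (sqrt 2 * \<Lambda> + 3 * pi / 4)) \<and>
        self_adjoint_ext_H0 \<Lambda> (D_Hgamma \<Lambda> (gamma_to \<Lambda> a1 a2) (gamma_from \<Lambda> a1 a2)) \<and>
        op_le \<Lambda> (D_Halpha \<Lambda> a1 a2 a3 a4) (Hop \<Lambda>)
          (D_Hgamma \<Lambda> (gamma_to \<Lambda> a1 a2) (gamma_from \<Lambda> a1 a2)) (Hop \<Lambda>) \<and>
        op_le \<Lambda> (D_Hgamma \<Lambda> (gamma_to \<Lambda> a1 a2) (gamma_from \<Lambda> a1 a2)) (Hop \<Lambda>)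
          (D_Halpha \<Lambda> a1 a2 a3 a4) (Hop \<Lambda>))"
proof -
  have i: "self_adjoint_ext_H0 \<Lambda> (D_Halpha \<Lambda> a1 a2 a3 a4)" by (rule self_adjoint_ext_D_Halpha[OF assms])
  show ?thesis
  proof (intro conjI impI i)
    assume S: "system_S a1 a2 a3 a4"
    note nz = system_S_nonzero[OF assms(2) S]
    \<comment> \<open>The additional phase 3 pi/4 is the factor \<open>- zm\<close>; with
      \<open>(S2)\<close> and \<open>(S3)\<close> it turns the expressions in \<open>a1\<close>,
      \<open>a2\<close> into those in \<open>a3\<close>, \<open>a4\<close>.\<close>
    have e: "exp (\<i> * (sqrt 2 * \<Lambda> + 3 * pi / 4)) = exp (\<i> * sqrt 2 * \<Lambda>) * - zm"
      unfolding exp_quarter_pi(3)[symmetric] exp_add[symmetric] by (simp add: algebra_simps)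
    have inv: "inverse zp = zm" using zp_zm(1) by (rule inverse_unique)
    show "a1 + a2 * exp (\<i> * pi / 4) \<noteq> 0" "a3 + a4 * exp (\<i> * pi / 4) \<noteq> 0"
      unfolding exp_quarter_pi by (rule nz)+
    show "gamma_to \<Lambda> a1 a2 = (a3 + a4 * exp (- \<i> * pi / 4)) * exp (\<i> * (sqrt 2 * \<Lambda> + 3 * pi / 4))"
      unfolding gamma_to_def e exp_quarter_pi nz(1) by simp
    show "gamma_from \<Lambda> a1 a2 = inverse (a3 + a4 * exp (\<i> * pi / 4)) * exp (\<i> * (sqrt 2 * \<Lambda> + 3 * pi / 4))"
      unfolding gamma_from_def e exp_quarter_pi nz(2) by (simp add: inv)
    note eq = D_Hgamma_eq_D_Halpha[OF assms S]
    show "self_adjoint_ext_H0 \<Lambda> (D_Hgamma \<Lambda> (gamma_to \<Lambda> a1 a2) (gamma_from \<Lambda> a1 a2))" unfolding eq by (rule i)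
    show "op_le \<Lambda> (D_Halpha \<Lambda> a1 a2 a3 a4) (Hop \<Lambda>) (D_Hgamma \<Lambda> (gamma_to \<Lambda> a1 a2) (gamma_from \<Lambda> a1 a2)) (Hop \<Lambda>)"
      "op_le \<Lambda> (D_Hgamma \<Lambda> (gamma_to \<Lambda> a1 a2) (gamma_from \<Lambda> a1 a2)) (Hop \<Lambda>) (D_Halpha \<Lambda> a1 a2 a3 a4) (Hop \<Lambda>)"
      unfolding eq by (rule op_le_subset, rule subset_refl)+
  qed
qed

end
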